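(* One has $$\max\left\{\gamma_{\rm gap,h},\frac{h}{d(d+1)\sqrt{d+2}}\right\}\le\kappa_{M,h}\le\left(\gamma_{\rm gap,h}^2+\frac{h^2}{2d(d+1)(d+2)}\right)^{1/2}.$$ Therefore, along any mesh family with $h\to0$, $$\kappa_{M,h}=O(h)\iff\gamma_{\rm gap,h}=O(h),$$ and $\kappa_{M,h}$ is not $o(h)$.
   Context: Let $d\in\{2,3\}$, let $\Omega\subset\mathbb R^d$ be a bounded polyhedral Lipschitz domain, and let $\mathbb T_h$ be a finite conforming triangulation of $\overline\Omega$ into non-degenerate closed $d$-simplices (the intersection of two distinct elements is empty or a common subsimplex); no shape regularity is assumed. $h:=\max_{T\in\mathbb T_h}\operatorname{diam}(T)$. $(\cdot,\cdot)$ is the $L^2(\Omega)$ inner product (scalar or vector valued). For elementwise $H^1$ functions $v$, $\nabla_hv$ is the elementwise gradient and $|v|_{H^1(\mathbb T_h)}:=\|\nabla_hv\|_{L^2(\Omega)^d}$. $X_h$ is the space of functions constant on each $T\in\mathbb T_h$. $V_h^c:=\{v\in H_0^1(\Omega): v|_T \text{ affine } \forall T\in\mathbb T_h\}$. The Crouzeix--Raviart space $V_{h,0}^{\mathrm{CR}}$ consists of the elementwise affine functions $v$ such that $\int_F[\![v]\!]\,ds=0$ for all faces $F$, where $[\![v]\!]$ is the jump across an interior face and the trace of $v$ on a boundary face. For $g_h\in X_h$: $z_h^c(g_h)\in V_h^c$ is the unique solution of $(\nabla z_h^c(g_h),\nabla v_h)=(g_h,v_h)$ for all $v_h\in V_h^c$;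 $z_h^{\mathrm{CR}}(g_h)\in V_{h,0}^{\mathrm{CR}}$ is the unique solution of $(\nabla_h z_h^{\mathrm{CR}}(g_h),\nabla_h v_h)=(g_h,v_h)$ for all $v_h\in V_{h,0}^{\mathrm{CR}}$; the Marini flux is $\bm\sigma_h^M(g_h)|_T:=\nabla_h z_h^{\mathrm{CR}}(g_h)|_T-\frac{g_h|_T}{d}(\bm x-\bm x_T)$, with $\bm x_T$ the barycentre of $T$. Define $$\kappa_{M,h}:=\sup_{0\ne g_h\in X_h}\frac{\|\bm\sigma_h^M(g_h)-\nabla z_h^c(g_h)\|_{L^2(\Omega)^d}}{\|g_h\|_{L^2(\Omega)}},\qquad \gamma_{\rm gap,h}:=\max_{0\ne g_h\in X_h}\frac{|z_h^{\mathrm{CR}}(g_h)-z_h^c(g_h)|_{H^1(\mathbb T_h)}}{\|g_h\|_{L^2(\Omega)}}.$$ *)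

theory Defs
  imports "HOL-Analysis.Analysis" "HOL-Library.Landau_Symbols"
begin

section \<open>Polyhedral Lipschitz domains and their triangulations\<close>

text \<open>Near each boundary point \<open>\<Omega>\<close> is the strict epigraph, in some direction \<open>e\<close>, of a Lipschitz
  function of the coordinates orthogonal to \<open>e\<close>.\<close>

definition lipschitz_boundary :: "'a::euclidean_space set \<Rightarrow> bool" where
  "lipschitz_boundary \<Omega> \<longleftrightarrow>
     (\<forall>p\<in>frontier \<Omega>. \<exists>U e \<psi> L. open U \<and> p \<in> U \<and> norm e = 1 \<and>
        lipschitz_on L {y. y \<bullet> e = 0} \<psi> \<and>
        \<Omega> \<inter> U = {y \<in> U. \<psi> (y - (y \<bullet> e) *\<^sub>R e) < y \<bullet> e})"

definition polyhedral_lipschitz_domain :: "'a::euclidean_space set \<Rightarrow> bool" where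
  "polyhedral_lipschitz_domain \<Omega> \<longleftrightarrow>
     open \<Omega> \<and> connected \<Omega> \<and> \<Omega> \<noteq> {} \<and> bounded \<Omega> \<and>
     (\<exists>\<P>. finite \<P> \<and> (\<forall>P\<in>\<P>. polytope P) \<and> closure \<Omega> = \<Union>\<P>) \<and>
     lipschitz_boundary \<Omega>"

definition conforming_triangulation :: "'a::euclidean_space set \<Rightarrow> 'a set set \<Rightarrow> bool" where
  "conforming_triangulation \<Omega> \<T> \<longleftrightarrow>
     triangulation \<T> \<and> (\<forall>T\<in>\<T>. int DIM('a) simplex T) \<and> \<Union>\<T> = closure \<Omega>"

definition mesh_size :: "'a::euclidean_space set set \<Rightarrow> real" where
  "mesh_size \<T> = Max (diameter ` \<T>)"

definition barycentre :: "'a::euclidean_space set \<Rightarrow> 'a" where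
  "barycentre T = (\<Sum>v | v extreme_point_of T. v) /\<^sub>R real (card {v. v extreme_point_of T})"

text \<open>The element whose interior contains \<open>x\<close>; meaningful off the mesh skeleton, a null set.\<close>

definition element_at :: "'a::euclidean_space set set \<Rightarrow> 'a \<Rightarrow> 'a set" where
  "element_at \<T> x = (THE T. T \<in> \<T> \<and> x \<in> interior T)"


section \<open>Lebesgue and Sobolev spaces\<close>

text \<open>The value type is \<open>real\<close> for scalar functions and \<open>'a\<close> for vector fields.\<close>

definition L2_fun :: "'a::euclidean_space set \<Rightarrow> ('a \<Rightarrow> 'b::euclidean_space) \<Rightarrow> bool" where
  "L2_fun \<Omega> f \<longleftrightarrow> f \<in> borel_measurable (lebesgue_on \<Omega>) \<and>
     integrable (lebesgue_on \<Omega>) (\<lambda>x. (norm (f x))\<^sup>2)"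

definition L2_inner ::
  "'a::euclidean_space set \<Rightarrow> ('a \<Rightarrow> 'b::euclidean_space) \<Rightarrow> ('a \<Rightarrow> 'b) \<Rightarrow> real" where
  "L2_inner \<Omega> f g = (LINT x|lebesgue_on \<Omega>. f x \<bullet> g x)"

definition L2_norm :: "'a::euclidean_space set \<Rightarrow> ('a \<Rightarrow> 'b::euclidean_space) \<Rightarrow> real" where
  "L2_norm \<Omega> f = sqrt (L2_inner \<Omega> f f)"

definition gradient :: "('a::euclidean_space \<Rightarrow> real) \<Rightarrow> 'a \<Rightarrow> 'a" where
  "gradient f x = (THE D. GDERIV f x :> D)"

primrec C_k :: "nat \<Rightarrow> ('a::euclidean_space \<Rightarrow> real) \<Rightarrow> bool" where
  "C_k 0 f \<longleftrightarrow> continuous_on UNIV f"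
| "C_k (Suc k) f \<longleftrightarrow>
     (\<forall>x. f differentiable (at x)) \<and> (\<forall>i\<in>Basis. C_k k (\<lambda>x. gradient f x \<bullet> i))"

definition test_function :: "'a::euclidean_space set \<Rightarrow> ('a \<Rightarrow> real) \<Rightarrow> bool" where
  "test_function \<Omega> \<phi> \<longleftrightarrow> (\<forall>k. C_k k \<phi>) \<and>
     compact (closure {x. \<phi> x \<noteq> 0}) \<and> closure {x. \<phi> x \<noteq> 0} \<subseteq> \<Omega>"

definition weak_gradient ::
  "'a::euclidean_space set \<Rightarrow> ('a \<Rightarrow> real) \<Rightarrow> ('a \<Rightarrow> 'a) \<Rightarrow> bool" where
  "weak_gradient \<Omega> v G \<longleftrightarrow> (\<forall>\<phi>. test_function \<Omega> \<phi> \<longrightarrow>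
     (LINT x|lebesgue_on \<Omega>. v x *\<^sub>R gradient \<phi> x) = - (LINT x|lebesgue_on \<Omega>. \<phi> x *\<^sub>R G x))"

text \<open>\<open>H\<^sup>1\<^sub>0(\<Omega>)\<close> is the closure of the test functions in \<open>H\<^sup>1(\<Omega>)\<close>. Membership depends only on the
  almost-everywhere class of \<open>v\<close> on \<open>\<Omega>\<close>.\<close>

definition H10 :: "'a::euclidean_space set \<Rightarrow> ('a \<Rightarrow> real) set" where
  "H10 \<Omega> = {v. L2_fun \<Omega> v \<and> (\<exists>G. L2_fun \<Omega> G \<and> weak_gradient \<Omega> v G \<and>
     (\<exists>\<phi>::nat \<Rightarrow> 'a \<Rightarrow> real. (\<forall>n. test_function \<Omega> (\<phi> n)) \<and>
        (\<lambda>n. L2_norm \<Omega> (\<lambda>x. \<phi> n x - v x)) \<longlonglongrightarrow> 0 \<and>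
        (\<lambda>n. L2_norm \<Omega> (\<lambda>x. gradient (\<phi> n) x - G x)) \<longlonglongrightarrow> 0))}"


section \<open>Finite element spaces\<close>

text \<open>Piecewise functions are represented by their values on the interiors of the elements and are
  normalised to vanish elsewhere (on the mesh skeleton and outside the mesh), so that each
  almost-everywhere class on \<open>\<Omega>\<close> has exactly one representative.\<close>

definition P0 :: "'a::euclidean_space set set \<Rightarrow> ('a \<Rightarrow> real) set" where
  "P0 \<T> = {g. (\<forall>T\<in>\<T>. g constant_on interior T) \<and> (\<forall>x. x \<notin> \<Union>(interior ` \<T>) \<longrightarrow> g x = 0)}"

definition P1 :: "'a::euclidean_space set set \<Rightarrow> ('a \<Rightarrow> real) set" where
  "P1 \<T> = {v. (\<forall>T\<in>\<T>. \<exists>a b. \<forall>x\<in>interior T. v x = a \<bullet> x + b) \<and>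
     (\<forall>x. x \<notin> \<Union>(interior ` \<T>) \<longrightarrow> v x = 0)}"

text \<open>The elementwise gradient. For elementwise affine \<open>v\<close> in \<open>H\<^sup>1(\<Omega>)\<close> it coincides almost everywhere
  with the weak gradient.\<close>

definition broken_gradient ::
  "'a::euclidean_space set set \<Rightarrow> ('a \<Rightarrow> real) \<Rightarrow> 'a \<Rightarrow> 'a" where
  "broken_gradient \<T> v x = (if x \<in> \<Union>(interior ` \<T>) then gradient v x else 0)"

definition V_c :: "'a::euclidean_space set \<Rightarrow> 'a set set \<Rightarrow> ('a \<Rightarrow> real) set" where
  "V_c \<Omega> \<T> = P1 \<T> \<inter> H10 \<Omega>"

definition trace_from :: "'a::euclidean_space set \<Rightarrow> ('a \<Rightarrow> real) \<Rightarrow> 'a \<Rightarrow> real" where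
  "trace_from T v x = Lim (at x within interior T) v"

definition unit_normal :: "'a::euclidean_space set \<Rightarrow> 'a" where
  "unit_normal F = (SOME n. norm n = 1 \<and> (\<forall>x\<in>F. \<forall>y\<in>F. n \<bullet> (x - y) = 0))"

text \<open>Integral over a flat \<open>(d-1)\<close>-dimensional face with respect to surface measure. By Fubini it equals
  the volume integral, over the right prism of height 1 with base \<open>F\<close>, of the integrand extended
  constantly in the normal direction. The choice of sign in \<open>unit_normal\<close> does not matter.\<close>

definition face_integral :: "'a::euclidean_space set \<Rightarrow> ('a \<Rightarrow> real) \<Rightarrow> real" where
  "face_integral F f =
     (LINT x|lebesgue_on {y + t *\<^sub>R unit_normal F | y t. y \<in> F \<and> 0 \<le> t \<and> t \<le> 1}.
        f (closest_point (affine hull F) x))"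

definition V_CR :: "'a::euclidean_space set \<Rightarrow> 'a set set \<Rightarrow> ('a \<Rightarrow> real) set" where
  "V_CR \<Omega> \<T> = {v \<in> P1 \<T>.
     (\<forall>F. \<forall>T\<in>\<T>. \<forall>T'\<in>\<T>. T \<noteq> T' \<and> F facet_of T \<and> F facet_of T' \<longrightarrow>
        face_integral F (\<lambda>x. trace_from T v x - trace_from T' v x) = 0) \<and>
     (\<forall>F. \<forall>T\<in>\<T>. F facet_of T \<and> F \<subseteq> frontier \<Omega> \<longrightarrow> face_integral F (trace_from T v) = 0)}"


section \<open>Discrete solutions, Marini flux and the two constants\<close>

definition z_c :: "'a::euclidean_space set \<Rightarrow> 'a set set \<Rightarrow> ('a \<Rightarrow> real) \<Rightarrow> 'a \<Rightarrow> real" where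
  "z_c \<Omega> \<T> g = (THE z. z \<in> V_c \<Omega> \<T> \<and> (\<forall>v\<in>V_c \<Omega> \<T>.
     L2_inner \<Omega> (broken_gradient \<T> z) (broken_gradient \<T> v) = L2_inner \<Omega> g v))"

definition z_CR :: "'a::euclidean_space set \<Rightarrow> 'a set set \<Rightarrow> ('a \<Rightarrow> real) \<Rightarrow> 'a \<Rightarrow> real" where
  "z_CR \<Omega> \<T> g = (THE z. z \<in> V_CR \<Omega> \<T> \<and> (\<forall>v\<in>V_CR \<Omega> \<T>.
     L2_inner \<Omega> (broken_gradient \<T> z) (broken_gradient \<T> v) = L2_inner \<Omega> g v))"

definition marini_flux :: "'a::euclidean_space set \<Rightarrow> 'a set set \<Rightarrow> ('a \<Rightarrow> real) \<Rightarrow> 'a \<Rightarrow> 'a" where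
  "marini_flux \<Omega> \<T> g x = broken_gradient \<T> (z_CR \<Omega> \<T> g) x
     - (g x / real DIM('a)) *\<^sub>R (x - barycentre (element_at \<T> x))"

definition kappa_M :: "'a::euclidean_space set \<Rightarrow> 'a set set \<Rightarrow> real" where
  "kappa_M \<Omega> \<T> = (SUP g \<in> P0 \<T> - {\<lambda>_. 0}.
     L2_norm \<Omega> (\<lambda>x. marini_flux \<Omega> \<T> g x - broken_gradient \<T> (z_c \<Omega> \<T> g) x) / L2_norm \<Omega> g)"

definition gamma_gap :: "'a::euclidean_space set \<Rightarrow> 'a set set \<Rightarrow> real" where
  "gamma_gap \<Omega> \<T> = (GREATEST r. \<exists>g \<in> P0 \<T> - {\<lambda>_. 0}.
     r = L2_norm \<Omega> (broken_gradient \<T> (\<lambda>x. z_CR \<Omega> \<T> g x - z_c \<Omega> \<T> g x)) / L2_norm \<Omega> g)"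

end

theory Submission
  imports Defs
begin

text \<open>
  On each element the difference between the Marini flux and the conforming gradient is a constant
  vector (the gap between the two discrete gradients) plus a multiple of \<open>x - x\<^sub>T\<close>, which has mean zero.
  The two parts are orthogonal, so the squared flux error equals the squared gap plus
  \<open>\<Sum>\<^sub>T (g\<^sub>T / d)\<^sup>2 \<integral>\<^sub>T |x - x\<^sub>T|\<^sup>2\<close>. The second moment of a simplex is
  \<open>|T| / ((d+1)\<^sup>2 (d+2))\<close> times the sum of the squared edge lengths, which lies between
  \<open>(diam T)\<^sup>2\<close> and \<open>d (d+1) / 2 (diam T)\<^sup>2\<close>; a maximiser of the gap and the indicator of an element
  of maximal diameter give the lower bounds.

  Well-posedness of the Crouzeix--Raviart problem: a function with vanishing broken gradient takes the
  same value on neighbouring elements, and if that value is nonzero no facet in question lies on the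
  boundary, so the elements sharing it form a bounded set that a generic line cannot leave.
  Well-posedness of the conforming problem: composing test functions that converge to a piecewise
  constant \<open>v\<close> with a cutoff whose derivative vanishes at all values of \<open>v\<close> produces functions whose
  gradients tend to zero in \<open>L\<^sup>1\<close>, so \<open>v\<close> vanishes almost everywhere by integration by parts.
\<close>

text \<open>Both discrete solutions are \<open>THE\<close> values and \<open>gamma_gap\<close> is a
  \<open>GREATEST\<close>, so existence, uniqueness and attainment precede every estimate. Each is
  reduced to finitely many functionals or element values. Uniqueness is the obstacle: a vanishing
  broken gradient leaves one free constant per element. \<open>H10\<close> is accessible only
  through approximating test functions; the cutoff works because its derivative along them is of
  size |\<phi> - v|, so that an L2 bound on their gradients suffices. The Crouzeix--Raviart space
  controls only facet means, which leads to a geometric argument. Affine substitutions are proved up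
  to an unknown factor, and testing with the constant 1 on the simplex fixes it, so determinants
  never appear. Origin of the constants: the Marini correction carries 1/d, so the moment bounds are
  divided by d^2. This gives (d (d+1) / 2) / (d^2 (d+1)^2 (d+2)) = 1 / (2 d (d+1) (d+2)) above, and
  1 / (d^2 (d+1)^2 (d+2)), the square of 1 / (d (d+1) sqrt (d+2)), below.\<close>

section \<open>Affine maps and Lebesgue measure\<close>

text \<open>Evaluate \<open>\<integral>\<integral> 1\<^sub>A(x) 1\<^sub>B(x + y)\<close> in both orders, with shifts in either variable.\<close>

lemma translation_invariant_emeasure:
  fixes M :: "'a::euclidean_space measure"
  assumes sf: "sigma_finite_measure M" and sets_M: "sets M = sets borel"
    and inv: "\<And>a. distr M borel (\<lambda>x. a + x) = M"
    and A: "A \<in> sets borel" and B: "B \<in> sets borel"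
  shows "emeasure M A * emeasure lborel B = emeasure M B * emeasure lborel A"
proof -
  interpret M: sigma_finite_measure M by fact
  interpret P: pair_sigma_finite M lborel by unfold_locales
  have [measurable_cong]: "sets M = sets borel" by fact
  note [measurable] = A B
  have shiftM: "(\<integral>\<^sup>+x. f (a + x) \<partial>M) = (\<integral>\<^sup>+x. f x \<partial>M)" if [measurable]: "f \<in> borel_measurable borel" for f and a :: 'a
    by (subst (2) inv[of a, symmetric], subst nn_integral_distr) auto
  have shiftL: "(\<integral>\<^sup>+x. f (a + x) \<partial>lborel) = (\<integral>\<^sup>+x. f x \<partial>lborel)" if [measurable]: "f \<in> borel_measurable borel" for f and a :: 'a
    by (subst (2) lborel_distr_plus[of a, symmetric], subst nn_integral_distr) auto
  have neg: "(\<integral>\<^sup>+x. f (- x) \<partial>lborel) = (\<integral>\<^sup>+x. f x \<partial>lborel)" if [measurable]: "f \<in> borel_measurable borel" for f :: "'a \<Rightarrow> ennreal"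
    by (subst (2) lborel_affine[of "-1" 0]) (simp_all add: nn_integral_density nn_integral_distr)
  have "emeasure M A * emeasure lborel B = (\<integral>\<^sup>+x. (\<integral>\<^sup>+y. indicator A x * indicator B y \<partial>lborel) \<partial>M)"
    by (simp add: nn_integral_cmult nn_integral_multc sets_M)
  also have "\<dots> = (\<integral>\<^sup>+x. (\<integral>\<^sup>+y. indicator A x * indicator B (x + y) \<partial>lborel) \<partial>M)"
    using shiftL[of "indicator B"] by (simp add: nn_integral_cmult)
  also have "\<dots> = (\<integral>\<^sup>+y. (\<integral>\<^sup>+x. indicator A x * indicator B (x + y) \<partial>M) \<partial>lborel)"
    by (rule P.Fubini'[symmetric]) simp
  also have "\<dots> = (\<integral>\<^sup>+y. (\<integral>\<^sup>+x. indicator A (x - y) * indicator B x \<partial>M) \<partial>lborel)"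
  proof (rule nn_integral_cong)
    fix y :: 'a
    show "(\<integral>\<^sup>+x. indicator A x * indicator B (x + y) \<partial>M) = (\<integral>\<^sup>+x. indicator A (x - y) * indicator B x \<partial>M)"
      using shiftM[of "\<lambda>x. indicator A (x - y) * indicator B x" y] by (simp add: add.commute)
  qed
  also have "\<dots> = (\<integral>\<^sup>+x. (\<integral>\<^sup>+y. indicator A (x - y) * indicator B x \<partial>lborel) \<partial>M)"
    by (rule P.Fubini') simp
  also have "\<dots> = (\<integral>\<^sup>+x. emeasure lborel A * indicator B x \<partial>M)"
  proof (rule nn_integral_cong)
    fix x :: 'a
    have "(\<integral>\<^sup>+y. indicator A (x - y) \<partial>lborel) = emeasure lborel A"
      using neg[of "\<lambda>y. indicator A (x + y)"] shiftL[of "indicator A" x] by simp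
    then show "(\<integral>\<^sup>+y. indicator A (x - y) * indicator B x \<partial>lborel) = emeasure lborel A * indicator B x"
      by (simp add: nn_integral_multc)
  qed
  also have "\<dots> = emeasure M B * emeasure lborel A"
    using nn_integral_cmult[of "indicator B" M "emeasure lborel A"] by (simp add: sets_M mult.commute)
  finally show ?thesis .
qed

text \<open>The push-forward of Lebesgue measure under \<open>g\<close> is translation invariant,
  since a shift by \<open>a\<close> after \<open>g\<close> is a shift by \<open>inv g a\<close>
  before it; comparison with the unit cube makes it a multiple of Lebesgue measure. The multiple
  stays unspecified: each use recovers it from a test integrand.\<close>

lemma lborel_integral_affine:
  fixes g :: "'a::euclidean_space \<Rightarrow> 'a"
  assumes lin: "linear g" and inj: "inj g"
  obtains c :: real where "\<And>f :: 'a \<Rightarrow> real. f \<in> borel_measurable borel \<Longrightarrow>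
      (LINT x|lborel. f (g x + t)) = c * (LINT x|lborel. f x)"
proof -
  have "bij g" using lin inj linear_inj_imp_surj by (auto simp: bij_def)
  have ling: "linear (inv g)" using lin inj by (simp add: linear_injective_left_inverse \<open>bij g\<close> inj_linear_imp_inv_linear bij_is_surj)
  have contg [measurable]: "g \<in> borel_measurable borel"
    using lin by (simp add: borel_measurable_continuous_onI linear_continuous_on linear_linear)
  define M where "M = distr lborel borel g"
  have sets_M [measurable_cong]: "sets M = sets borel" by (simp add: M_def)
  have emM: "emeasure M A = emeasure lborel (inv g ` A)" if "A \<in> sets borel" for A
    using that \<open>bij g\<close> by (simp add: M_def emeasure_distr bij_vimage_eq_inv_image)
  have finM: "emeasure M A < \<infinity>" if "A \<in> sets borel" "bounded A" for A
  proof -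
    have "bounded (inv g ` A)" using that(2) ling by (simp add: bounded_linear_image linear_linear)
    then show ?thesis using emeasure_bounded_finite that emM by simp
  qed
  have "sigma_finite_measure M"
  proof (rule sigma_finite_measure.intro, intro exI conjI)
    show "countable (range (\<lambda>n::nat. ball (0::'a) n))" by auto
    show "range (\<lambda>n::nat. ball (0::'a) n) \<subseteq> sets M" by (auto simp: sets_M)
    show "\<Union> (range (\<lambda>n::nat. ball (0::'a) n)) = space M"
      using reals_Archimedean2 by (force simp: M_def)
    show "\<forall>a\<in>range (\<lambda>n::nat. ball (0::'a) n). emeasure M a \<noteq> \<infinity>"
      using finM by (metis bounded_ball borel_open imageE infinity_ennreal_def less_irrefl open_ball)
  qed
  moreover have "distr M borel (\<lambda>x. a + x) = M" for a
  proof -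
    have "distr M borel (\<lambda>x. a + x) = distr lborel borel (\<lambda>x. a + g x)"
      by (simp add: M_def distr_distr o_def)
    also have "(\<lambda>x. a + g x) = (\<lambda>x. g (inv g a + x))"
      using lin \<open>bij g\<close> by (simp add: linear_add bij_is_surj surj_f_inv_f)
    also have "distr lborel borel (\<lambda>x. g (inv g a + x)) = distr (distr lborel borel (\<lambda>x. inv g a + x)) borel g"
      by (simp add: distr_distr o_def)
    also have "\<dots> = M" by (simp add: lborel_distr_plus M_def)
    finally show ?thesis .
  qed
  ultimately have eq: "emeasure M A * emeasure lborel B = emeasure M B * emeasure lborel A"
    if "A \<in> sets borel" "B \<in> sets borel" for A B
    using translation_invariant_emeasure[of M A B] that sets_M by auto
  define B where "B = cbox 0 (One :: 'a)"
  have B: "emeasure lborel B = 1" "B \<in> sets borel" by (auto simp: B_def emeasure_lborel_cbox)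
  define c where "c = measure M B"
  have cB: "emeasure M B = ennreal c"
    using finM[of B] by (simp add: B_def c_def emeasure_eq_ennreal_measure less_top)
  have M: "M = density lborel (\<lambda>_. ennreal c)"
  proof (rule measure_eqI)
    fix A assume "A \<in> sets M"
    then have "A \<in> sets borel" by (simp add: sets_M)
    then show "emeasure M A = emeasure (density lborel (\<lambda>_. ennreal c)) A"
      using eq[of A B] B cB by (simp add: emeasure_density nn_integral_cmult)
  qed (simp add: sets_M)
  show ?thesis
  proof (rule that)
    fix f :: "'a \<Rightarrow> real" assume [measurable]: "f \<in> borel_measurable borel"
    have "(LINT x|lborel. f (g x + t)) = (LINT x|M. f (x + t))"
      unfolding M_def by (subst integral_distr) auto
    also have "\<dots> = c * (LINT x|lborel. f (x + t))"
      by (subst M, subst integral_density) (auto simp: c_def)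
    also have "(LINT x|lborel. f (x + t)) = (LINT x|distr lborel borel (\<lambda>x. t + x). f x)"
      by (subst integral_distr) (auto simp: add.commute)
    finally show "(LINT x|lborel. f (g x + t)) = c * (LINT x|lborel. f x)"
      by (simp add: lborel_distr_plus)
  qed
qed

section \<open>Second moments of a simplex\<close>

text \<open>An affine function on the whole space, not only on the simplex, so that its sign tells
  on which side of the facet opposite \<open>v\<close> a point lies.\<close>

definition bary :: "'a::euclidean_space set \<Rightarrow> 'a \<Rightarrow> 'a \<Rightarrow> real" where
  "bary C v = (SOME f. (\<exists>a b. f = (\<lambda>x. a \<bullet> x + b)) \<and> f v = 1 \<and> (\<forall>u\<in>C - {v}. f u = 0))"

locale full_simplex =
  fixes C :: "'a::euclidean_space set"
  assumes indep: "\<not> affine_dependent C" and card_C: "card C = DIM('a) + 1"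
begin

abbreviation "l \<equiv> bary C"
abbreviation "T \<equiv> convex hull C"

lemma finite_C: "finite C"
  using indep aff_independent_finite by blast

lemma affine_hull_C: "affine hull C = UNIV"
proof -
  have "aff_dim C = int DIM('a)" using indep card_C affine_independent_iff_card[of C] by simp
  then show ?thesis by (simp only: aff_dim_eq_full)
qed

text \<open>By affine independence the remaining vertices span a hyperplane
  \<open>{x. a \<bullet> x = b}\<close> that misses \<open>v\<close>. Dividing
  \<open>a \<bullet> x - b\<close> by its value at \<open>v\<close> gives a witness for the
  \<open>SOME\<close> in \<open>bary\<close>.\<close>

lemma bary_props:
  assumes "v \<in> C"
  shows "(\<exists>a b. l v = (\<lambda>x. a \<bullet> x + b)) \<and> l v v = 1 \<and> (\<forall>u\<in>C - {v}. l v u = 0)"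
proof -
  have ind: "\<not> affine_dependent (C - {v})"
    using indep affine_independent_subset by blast
  have "card (C - {v}) = DIM('a)" using card_C assms finite_C by simp
  then have "aff_dim (C - {v}) = int (DIM('a) - 1)"
    using ind affine_independent_iff_card[of "C - {v}"] by (simp add: of_nat_diff Suc_leI)
  then have "\<exists>a b. a \<noteq> 0 \<and> affine hull (C - {v}) = {x. a \<bullet> x = b}"
    by (rule aff_dim_eq_hyperplane[THEN iffD1])
  then obtain a b where ab: "a \<noteq> 0" "affine hull (C - {v}) = {x. a \<bullet> x = b}"
    by (elim exE conjE)
  have "v \<notin> affine hull (C - {v})" using indep assms unfolding affine_dependent_def by blast
  then have nz: "a \<bullet> v - b \<noteq> 0" using ab by auto
  have ub: "a \<bullet> u = b" if "u \<in> C - {v}" for u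
    using hull_inc[OF that, of affine] unfolding ab(2) by simp
  define k where "k = a \<bullet> v - b"
  have "\<exists>f. (\<exists>a b. f = (\<lambda>x. a \<bullet> x + b)) \<and> f v = 1 \<and> (\<forall>u\<in>C - {v}. f u = 0)"
  proof (rule exI[of _ "\<lambda>x. (a /\<^sub>R k) \<bullet> x + (- b / k)"], intro conjI ballI)
    show "\<exists>c d. (\<lambda>x. (a /\<^sub>R k) \<bullet> x + (- b / k)) = (\<lambda>x. c \<bullet> x + d)" by blast
    show "(a /\<^sub>R k) \<bullet> v + (- b / k) = 1" using nz by (simp add: k_def divide_simps)
    fix u assume "u \<in> C - {v}"
    from ub[OF this] show "(a /\<^sub>R k) \<bullet> u + (- b / k) = 0"
      using nz by (simp add: k_def divide_simps)
  qed
  then show ?thesis unfolding bary_def by (rule someI_ex)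
qed

lemma bary_affine:
  assumes "v \<in> C" obtains a b where "l v = (\<lambda>x. a \<bullet> x + b)"
  using bary_props assms by blast

lemma bary_vertex: "v \<in> C \<Longrightarrow> u \<in> C \<Longrightarrow> l v u = (if u = v then 1 else 0)"
  using bary_props by auto

lemma continuous_bary: "v \<in> C \<Longrightarrow> continuous_on S (l v)"
  by (erule bary_affine) (auto intro!: continuous_intros)

lemma measurable_bary [measurable]: "v \<in> C \<Longrightarrow> l v \<in> borel_measurable borel"
  using continuous_bary borel_measurable_continuous_onI by blast

lemma bary_shift: "v \<in> C \<Longrightarrow> l v (x + s *\<^sub>R (p - q)) = l v x + s * (l v p - l v q)"
  by (erule bary_affine) (simp add: inner_right_distrib inner_diff_right algebra_simps)

lemma bary_comb:
  assumes "v \<in> C" "sum u C = 1" shows "l v (\<Sum>w\<in>C. u w *\<^sub>R w) = u v"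
proof -
  obtain a b where ab: "l v = (\<lambda>x. a \<bullet> x + b)" using bary_affine assms by blast
  have "l v (\<Sum>w\<in>C. u w *\<^sub>R w) = (\<Sum>w\<in>C. u w * (a \<bullet> w)) + (\<Sum>w\<in>C. u w) * b"
    using assms by (simp add: ab inner_sum_right)
  also have "\<dots> = (\<Sum>w\<in>C. u w * l v w)"
    by (simp add: ab sum_distrib_right distrib_left sum.distrib)
  also have "\<dots> = (\<Sum>w\<in>C. if w = v then u w else 0)"
    using assms by (intro sum.cong) (auto simp: bary_vertex)
  also have "\<dots> = u v" using assms finite_C by simp
  finally show ?thesis .
qed

lemma bary_sum_scaleR: "(\<Sum>v\<in>C. l v x *\<^sub>R v) = x"
  and bary_sum: "(\<Sum>v\<in>C. l v x) = 1"
proof -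
  have "x \<in> affine hull C" by (simp add: affine_hull_C)
  then obtain u where u: "sum u C = 1" "(\<Sum>v\<in>C. u v *\<^sub>R v) = x"
    by (auto simp: affine_hull_finite[OF finite_C])
  then have "l v x = u v" if "v \<in> C" for v using bary_comb that by blast
  then show "(\<Sum>v\<in>C. l v x *\<^sub>R v) = x" "(\<Sum>v\<in>C. l v x) = 1" using u by simp_all
qed

text \<open>Faces are cut out by vanishing coordinates; this is how points are later located in a
  facet or in an intersection of elements.\<close>

lemma convex_hull_bary:
  assumes "D \<subseteq> C" shows "convex hull D = {x. (\<forall>v\<in>C. 0 \<le> l v x) \<and> (\<forall>v\<in>C - D. l v x = 0)}"
proof (intro set_eqI iffI; clarsimp)
  have fD: "finite D" using assms finite_C finite_subset by blast
  fix x assume "x \<in> convex hull D"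
  then obtain u where u: "\<And>x. x \<in> D \<Longrightarrow> 0 \<le> u x" "sum u D = 1" "(\<Sum>v\<in>D. u v *\<^sub>R v) = x"
    by (auto simp: convex_hull_finite[OF fD])
  \<comment> \<open>Extended by zero to \<open>C\<close>, the weights become the barycentric
    coordinates.\<close>
  define u' where "u' v = (if v \<in> D then u v else 0)" for v
  have "sum u' C = 1" "(\<Sum>v\<in>C. u' v *\<^sub>R v) = x"
    unfolding u'_def using assms finite_C u by (auto simp: sum.If_cases if_distrib[of "\<lambda>c. c *\<^sub>R _"] Int_absorb1 cong: if_cong)
  then have "l v x = u' v" if "v \<in> C" for v using bary_comb that by blast
  then show "(\<forall>v\<in>C. 0 \<le> l v x) \<and> (\<forall>v\<in>C - D. l v x = 0)" using u(1) by (auto simp: u'_def)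
next
  have fD: "finite D" using assms finite_C finite_subset by blast
  fix x assume x: "\<forall>v\<in>C. 0 \<le> l v x" "\<forall>v\<in>C - D. l v x = 0"
  have "(\<Sum>v\<in>D. l v x) = 1" "(\<Sum>v\<in>D. l v x *\<^sub>R v) = x"
    using sum.mono_neutral_left[OF finite_C assms, of "\<lambda>v. l v x"]
      sum.mono_neutral_left[OF finite_C assms, of "\<lambda>v. l v x *\<^sub>R v"] x bary_sum bary_sum_scaleR by auto
  then show "x \<in> convex hull D" using x assms by (auto simp: convex_hull_finite[OF fD] intro!: exI[of _ "\<lambda>v. l v x"])
qed

lemma T_bary: "T = {x. \<forall>v\<in>C. 0 \<le> l v x}"
  using convex_hull_bary[of C] by simp

lemma open_pos: "D \<subseteq> C \<Longrightarrow> open {x. \<forall>v\<in>D. 0 < l v x}"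
proof -
  assume D: "D \<subseteq> C"
  have "{x. \<forall>v\<in>D. 0 < l v x} = (\<Inter>v\<in>D. {x. 0 < l v x})" by auto
  moreover have "open {x. 0 < l v x}" if "v \<in> D" for v
    using that D by (intro open_Collect_less continuous_on_const continuous_bary) auto
  ultimately show ?thesis using finite_subset[OF D finite_C] by (simp add: open_INT)
qed

lemma interior_T: "(\<And>v. v \<in> C \<Longrightarrow> 0 < l v x) \<Longrightarrow> x \<in> interior T"
  using interiorI[OF open_pos[of C], of x T] by (force simp: T_bary)

lemma interior_T_nonempty: "interior T \<noteq> {}"
proof -
  have "C \<noteq> {}" using card_C by auto
  then have "(\<Sum>w\<in>C. (1 / card C) *\<^sub>R w) \<in> interior T"
    using finite_C by (intro interior_T) (subst bary_comb; simp add: card_gt_0_iff)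
  then show ?thesis by blast
qed

section \<open>Integration over the simplex by affine substitutions\<close>

lemma compact_T: "compact T"
  by (simp add: compact_convex_hull finite_C finite_imp_compact)

lemma borel_T [measurable]: "T \<in> sets borel"
  using compact_T compact_imp_closed borel_closed by blast

abbreviation I :: "('a \<Rightarrow> real) \<Rightarrow> real" where
  "I f \<equiv> LINT x|lborel. indicator T x * f x"

lemma integrable_I: "continuous_on UNIV f \<Longrightarrow> integrable lborel (\<lambda>x. indicator T x * f x)" for f :: "'a \<Rightarrow> real"
  using borel_integrable_compact[OF compact_T, of f] continuous_on_subset by fastforce

lemma I_one_pos: "0 < I (\<lambda>_. 1)"
proof -
  have "\<not> negligible (interior T)" using interior_T_nonempty open_not_negligible by blast
  then have "\<not> negligible T" using interior_subset negligible_subset by blast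
  then have "measure lebesgue T \<noteq> 0"
    using lmeasurable_compact[OF compact_T] by (simp add: negligible_iff_measure)
  then show ?thesis using borel_T by (simp add: zero_less_measure_iff)
qed

text \<open>The common form of the substitutions \<open>swap\<close> and \<open>halve\<close>. The
  translation part \<open>b *\<^sub>R w\<close> is split off, so that the linear part falls under
  \<open>lborel_integral_affine\<close>.\<close>

lemma affine_shear_integral:
  assumes "inj (\<lambda>x. x + (a \<bullet> x + b) *\<^sub>R w)"
  obtains c where "\<And>f :: 'a \<Rightarrow> real. f \<in> borel_measurable borel \<Longrightarrow>
      (LINT x|lborel. f (x + (a \<bullet> x + b) *\<^sub>R w)) = c * (LINT x|lborel. f x)"
proof -
  have "linear (\<lambda>x. x + (a \<bullet> x) *\<^sub>R w)"
    by (auto intro!: linearI simp: algebra_simps inner_right_distrib)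
  moreover have "inj (\<lambda>x. x + (a \<bullet> x) *\<^sub>R w)"
  proof (rule injI)
    fix x y assume "x + (a \<bullet> x) *\<^sub>R w = y + (a \<bullet> y) *\<^sub>R w"
    then have "x + (a \<bullet> x + b) *\<^sub>R w = y + (a \<bullet> y + b) *\<^sub>R w" by (simp add: algebra_simps)
    then show "x = y" using assms by (auto dest: injD)
  qed
  ultimately obtain c where "\<And>f :: 'a \<Rightarrow> real. f \<in> borel_measurable borel \<Longrightarrow>
      (LINT x|lborel. f ((x + (a \<bullet> x) *\<^sub>R w) + b *\<^sub>R w)) = c * (LINT x|lborel. f x)"
    using lborel_integral_affine[of "\<lambda>x. x + (a \<bullet> x) *\<^sub>R w" "b *\<^sub>R w"] by metis
  then show ?thesis by (intro that[of c]) (simp add: algebra_simps)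
qed

text \<open>The exchange of two vertices gives \<open>\<integral> l\<^sub>u\<^sup>2 = \<integral> l\<^sub>v\<^sup>2\<close>. Bisecting the edge \<open>u v\<close> writes the simplex as two
  copies of itself at half the volume, and pulling \<open>l\<^sub>u l\<^sub>v\<close> back along \<open>halve\<close> gives
  \<open>\<integral> l\<^sub>u l\<^sub>v = \<integral> l\<^sub>u l\<^sub>v / 2 + \<integral> l\<^sub>u\<^sup>2 / 4\<close>.\<close>

context
  fixes u v assumes uv: "u \<in> C" "v \<in> C" "u \<noteq> v"
begin

text \<open>The affine map that exchanges the vertices \<open>u\<close> and \<open>v\<close> and
  fixes all others.\<close>

definition "swap x = x + (l u x - l v x) *\<^sub>R (v - u)"
text \<open>The affine map that sends \<open>u\<close> to the midpoint of the edge
  \<open>u v\<close> and fixes all other vertices; its image of \<open>T\<close> is the half of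
  \<open>T\<close> nearer to \<open>v\<close>, in the sense that \<open>l u\<close> is at most
  \<open>l v\<close>.\<close>

definition "halve x = x + (l u x / 2) *\<^sub>R (v - u)"

lemma bary_swap: "w \<in> C \<Longrightarrow> l w (swap x) = (if w = u then l v x else if w = v then l u x else l w x)"
  unfolding swap_def using uv by (simp add: bary_shift bary_vertex)

lemma bary_halve: "w \<in> C \<Longrightarrow> l w (halve x) = (if w = u then l u x / 2 else if w = v then l v x + l u x / 2 else l w x)"
  unfolding halve_def using uv by (simp add: bary_shift bary_vertex)

lemma swap_integral:
  assumes [measurable]: "f \<in> borel_measurable borel"
  shows "I (\<lambda>x. f (swap x)) = I f"
proof -
  obtain a b a' b' where ab: "l u = (\<lambda>x. a \<bullet> x + b)" "l v = (\<lambda>x. a' \<bullet> x + b')" using bary_affine uv by metis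
  have sw: "swap = (\<lambda>x. x + ((a - a') \<bullet> x + (b - b')) *\<^sub>R (v - u))"
    by (auto simp: swap_def ab algebra_simps)
  have "swap (swap x) = x" for x
    unfolding swap_def[of "swap x"] using uv by (simp add: bary_swap) (simp add: swap_def algebra_simps)
  then have "inj swap" by (metis injI)
  with sw obtain c where c: "\<And>f :: 'a \<Rightarrow> real. f \<in> borel_measurable borel \<Longrightarrow>
      (LINT x|lborel. f (swap x)) = c * (LINT x|lborel. f x)"
    using affine_shear_integral[of "a - a'" "b - b'" "v - u"] by metis
  have T: "swap x \<in> T \<longleftrightarrow> x \<in> T" for x
    unfolding T_bary mem_Collect_eq using uv bary_swap[of u x] bary_swap[of v x] bary_swap[of _ x] by metis
  then have ind: "indicator T (swap x) = (indicator T x :: real)" for x by (auto simp: indicator_def)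
  \<comment> \<open>\<open>swap\<close> preserves \<open>T\<close>, so the integrand
    \<open>indicator T\<close>, whose integral is positive, forces the factor to be 1.\<close>
  have "c = 1" using c[of "indicator T"] I_one_pos ind by simp
  then show ?thesis using c[of "\<lambda>x. indicator T x * f x"] ind by simp
qed

text \<open>\<open>halve\<close> maps \<open>T\<close> onto \<open>T \<inter> H\<close>, so pulling
  back gives \<open>c\<close> times the integral over that half. A \<open>swap\<close>-symmetric
  integrand has half of its integral there, and the constant 1 shows \<open>c = 2\<close>.\<close>

lemma halve_integral:
  assumes cont: "continuous_on UNIV f" and sym: "\<And>x. f (swap x) = f x"
  shows "I (\<lambda>x. f (halve x)) = I f"
proof -
  have [measurable]: "f \<in> borel_measurable borel" using cont borel_measurable_continuous_onI by blast
  have [measurable]: "l u \<in> borel_measurable borel" "l v \<in> borel_measurable borel" using uv measurable_bary by auto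
  obtain a b a' b' where ab: "l u = (\<lambda>x. a \<bullet> x + b)" "l v = (\<lambda>x. a' \<bullet> x + b')" using bary_affine uv by metis
  have hv: "halve = (\<lambda>x. x + ((a /\<^sub>R 2) \<bullet> x + (b / 2)) *\<^sub>R (v - u))"
    by (auto simp: halve_def ab algebra_simps add_divide_distrib)
  have "inj halve"
  proof (rule injI)
    fix x y assume eq: "halve x = halve y"
    then have "l u x = l u y" using bary_halve[OF uv(1)] by (metis (full_types) field_sum_of_halves)
    then show "x = y" using eq by (simp add: halve_def)
  qed
  with hv obtain c where c: "\<And>f :: 'a \<Rightarrow> real. f \<in> borel_measurable borel \<Longrightarrow>
      (LINT x|lborel. f (halve x)) = c * (LINT x|lborel. f x)"
    using affine_shear_integral[of "a /\<^sub>R 2" "b / 2" "v - u"] by metis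
  define H where "H = {x. l u x \<le> l v x}"
  have [measurable]: "H \<in> sets borel" unfolding H_def by measurable
  have T: "halve x \<in> T \<inter> H \<longleftrightarrow> x \<in> T" for x
  proof
    assume "halve x \<in> T \<inter> H"
    then have *: "\<And>w. w \<in> C \<Longrightarrow> 0 \<le> l w (halve x)" "l u (halve x) \<le> l v (halve x)"
      by (auto simp: T_bary H_def)
    have "0 \<le> l w x" if "w \<in> C" for w
      using *(1)[OF that] *(1)[of u] *(2) uv that bary_halve[of w x] bary_halve[of v x] bary_halve[of u x]
      by (cases "w = u"; cases "w = v") simp_all
    then show "x \<in> T" by (simp add: T_bary)
  next
    assume "x \<in> T"
    then have *: "0 \<le> l w x" if "w \<in> C" for w
      using that by (auto simp: T_bary)
    have "0 \<le> l w (halve x)" if "w \<in> C" for w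
      using *[OF that] *[of u] *[of v] uv that bary_halve[of w x]
      by (cases "w = u"; cases "w = v") simp_all
    moreover have "l u (halve x) \<le> l v (halve x)"
      using *[of v] uv bary_halve[of v x] bary_halve[of u x] by simp
    ultimately show "halve x \<in> T \<inter> H" by (simp add: T_bary H_def)
  qed
  have *: "I (\<lambda>x. g (halve x)) = c / 2 * I g"
    if cont: "continuous_on UNIV g" and sym: "\<And>x. g (swap x) = g x" for g
  proof -
    have [measurable]: "g \<in> borel_measurable borel" using cont borel_measurable_continuous_onI by blast
    have int: "integrable lborel (\<lambda>x. indicator T x * (indicator H x * g x))"
      "integrable lborel (\<lambda>x. indicator T x * (indicator (-H) x * g x))"
       by (rule Bochner_Integration.integrable_bound[OF integrable_I[OF cont]]; auto simp: indicator_def)+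
    \<comment> \<open>\<open>swap\<close> carries the complement of \<open>H\<close> onto
      \<open>H\<close> only up to the bisecting hyperplane, which therefore has to be a null
      set.\<close>
    have neg: "{x. l u x = l v x} \<in> null_sets lborel"
    proof -
      have "l u u \<noteq> l v u" using uv by (simp add: bary_vertex)
      then have "a - a' \<noteq> 0 \<or> b' - b \<noteq> 0" by (auto simp: ab)
      then have "negligible {x. (a - a') \<bullet> x = b' - b}" by (rule negligible_hyperplane)
      moreover have "{x. (a - a') \<bullet> x = b' - b} = {x. l u x = l v x}"
        by (auto simp: ab algebra_simps)
      ultimately have "{x. l u x = l v x} \<in> null_sets lebesgue" by (simp add: negligible_iff_null_sets)
      moreover have "{x. l u x = l v x} \<in> sets borel" by measurable
      ultimately show ?thesis by (simp add: null_sets_completion_iff)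
    qed
    have "I (\<lambda>x. indicator (-H) x * g x) = I (\<lambda>x. indicator (-H) (swap x) * g x)"
      using swap_integral[of "\<lambda>x. indicator (-H) x * g x"] by (simp add: sym)
    also have "\<dots> = I (\<lambda>x. indicator H x * g x)"
    proof (rule integral_cong_AE)
      show "AE x in lborel. indicator T x * (indicator (-H) (swap x) * g x) = indicator T x * (indicator H x * g x)"
        using AE_not_in[OF neg]
        by eventually_elim (use uv in \<open>auto simp: indicator_def H_def bary_swap\<close>)
      have [measurable]: "swap \<in> borel_measurable borel" unfolding swap_def by measurable
      show "(\<lambda>x. indicator T x * (indicator (- H) (swap x) * g x)) \<in> borel_measurable lborel" by measurable
    qed measurable
    finally have "I g = 2 * I (\<lambda>x. indicator H x * g x)"
      using Bochner_Integration.integral_add[OF int]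
      by (simp add: indicator_compl flip: distrib_left) (simp add: algebra_simps)
    moreover have "I (\<lambda>x. g (halve x)) = c * I (\<lambda>x. indicator H x * g x)"
    proof -
      have "I (\<lambda>x. g (halve x)) = (LINT x|lborel. indicator (T \<inter> H) (halve x) * g (halve x))"
        using T by (intro Bochner_Integration.integral_cong) (auto simp: indicator_def)
      also have "\<dots> = c * (LINT x|lborel. indicator (T \<inter> H) x * g x)"
        by (rule c) measurable
      finally show ?thesis by (simp add: indicator_inter_arith mult.assoc)
    qed
    ultimately show ?thesis by simp
  qed
  have "c / 2 = 1" using *[of "\<lambda>_. 1"] I_one_pos by simp
  then show ?thesis using *[OF cont sym] by simp
qed

end

lemma second_moment_diag:
  assumes "u \<in> C" "v \<in> C" "u \<noteq> v"
  shows "I (\<lambda>x. l u x * l u x) = 2 * I (\<lambda>x. l u x * l v x)"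
    and "I (\<lambda>x. l u x * l u x) = I (\<lambda>x. l v x * l v x)"
    and "I (\<lambda>x. l u x) = I (\<lambda>x. l v x)"
proof -
  note cont = continuous_intros continuous_bary assms(1,2)
  show "I (\<lambda>x. l u x) = I (\<lambda>x. l v x)"
    using swap_integral[OF assms, of "l u"] assms measurable_bary by (simp add: bary_swap)
  show eq: "I (\<lambda>x. l u x * l u x) = I (\<lambda>x. l v x * l v x)"
    using swap_integral[OF assms, of "\<lambda>x. l u x * l u x"] assms measurable_bary by (simp add: bary_swap)
  have "I (\<lambda>x. l u x * l v x) = I (\<lambda>x. (1/2) * (l u x * l v x) + (1/4) * (l u x * l u x))"
  proof -
    have "I (\<lambda>x. l u x * l v x) = I (\<lambda>x. l u (halve u v x) * l v (halve u v x))"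
      using assms
      by (intro halve_integral[OF assms, symmetric])
        (auto simp: bary_swap intro!: continuous_intros continuous_bary)
    also have "\<dots> = I (\<lambda>x. (1/2) * (l u x * l v x) + (1/4) * (l u x * l u x))"
      using assms by (intro Bochner_Integration.integral_cong) (auto simp: bary_halve algebra_simps)
    finally show ?thesis .
  qed
  also have "\<dots> = (1/2) * I (\<lambda>x. l u x * l v x) + (1/4) * I (\<lambda>x. l u x * l u x)"
  proof -
    have "I (\<lambda>x. (1/2) * (l u x * l v x) + (1/4) * (l u x * l u x)) =
      (LINT x|lborel. (1/2) * (indicator T x * (l u x * l v x)) + (1/4) * (indicator T x * (l u x * l u x)))"
      by (simp add: algebra_simps)
    also have "\<dots> = (LINT x|lborel. (1/2) * (indicator T x * (l u x * l v x))) + (LINT x|lborel. (1/4) * (indicator T x * (l u x * l u x)))"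
      by (intro Bochner_Integration.integral_add Bochner_Integration.integrable_mult_right integrable_I cont)
    finally show ?thesis by simp
  qed
  finally show "I (\<lambda>x. l u x * l u x) = 2 * I (\<lambda>x. l u x * l v x)" by simp
qed

text \<open>The coordinates sum to 1 and, by exchange of vertices, all have the same
  integral.\<close>

lemma first_moment:
  assumes "v \<in> C" shows "I (l v) = I (\<lambda>_. 1) / (DIM('a) + 1)"
proof -
  have "I (\<lambda>_. 1) = I (\<lambda>x. \<Sum>w\<in>C. l w x)" by (simp add: bary_sum)
  also have "\<dots> = (\<Sum>w\<in>C. I (l w))"
    by (simp add: sum_distrib_left, subst Bochner_Integration.integral_sum)
      (auto intro!: integrable_I continuous_bary)
  also have "\<dots> = (\<Sum>w\<in>C. I (l v))" using second_moment_diag(3) assms by (intro sum.cong) auto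
  finally show ?thesis by (simp add: card_C field_simps)
qed

text \<open>Summing the integrals of \<open>l u * l w\<close> over \<open>w\<close> gives the
  integral of \<open>l u\<close>. One summand is the diagonal one and each of the other
  \<open>DIM('a)\<close> is half of it, whence the factor \<open>(DIM('a) + 2) / 2\<close>.\<close>

lemma second_moment:
  assumes "u \<in> C" "v \<in> C"
  shows "I (\<lambda>x. l u x * l v x) = I (\<lambda>_. 1) * (if u = v then 2 else 1) / ((DIM('a) + 1) * (DIM('a) + 2))"
proof -
  have *: "I (\<lambda>x. l u x * l w x) = I (\<lambda>x. l u x * l u x) * (if u = w then 1 else 1 / 2)" if "w \<in> C" for w
    using second_moment_diag(1)[OF assms(1) that] by auto
  have "I (l u) = I (\<lambda>x. \<Sum>w\<in>C. l u x * l w x)" by (simp add: bary_sum flip: sum_distrib_left)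
  also have "\<dots> = (\<Sum>w\<in>C. I (\<lambda>x. l u x * l w x))"
    using assms by (simp add: sum_distrib_left, subst Bochner_Integration.integral_sum)
      (auto intro!: integrable_I continuous_bary continuous_intros)
  also have "\<dots> = I (\<lambda>x. l u x * l u x) * (\<Sum>w\<in>C. if u = w then 1 else 1 / 2)"
    using * by (simp add: sum_distrib_left)
  also have "(\<Sum>w\<in>C. if u = w then 1 else 1 / 2) = (\<Sum>w\<in>C. 1 / 2 + (if u = w then 1 / 2 else 0 :: real))"
    by (intro sum.cong) auto
  also have "\<dots> = (DIM('a) + 2) / 2"
    using assms finite_C by (simp add: sum.distrib card_C)
  finally have "I (\<lambda>x. l u x * l u x) = 2 * I (l u) / (DIM('a) + 2)"
    by (simp add: field_simps)
  then have "I (\<lambda>x. l u x * l u x) = 2 * I (\<lambda>_. 1) / ((DIM('a) + 1) * (DIM('a) + 2))"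
    unfolding first_moment[OF assms(1)] by (simp add: algebra_simps)
  then show ?thesis using *[OF assms(2)] by (simp add: algebra_simps)
qed

section \<open>Moments about the barycentre\<close>

abbreviation "bc \<equiv> barycentre (convex hull C)"

lemma barycentre_T: "bc = (\<Sum>v\<in>C. v) /\<^sub>R (DIM('a) + 1)"
  unfolding barycentre_def extreme_point_of_convex_hull_affine_independent[OF indep] by (simp add: card_C)

lemma sum_minus_barycentre: "(\<Sum>v\<in>C. v - bc) = 0"
proof -
  have "(\<Sum>v\<in>C. v - bc) = (\<Sum>v\<in>C. v) - real (DIM('a) + 1) *\<^sub>R bc"
    by (simp add: sum_subtractf sum_constant_scaleR card_C del: of_nat_add)
  then show ?thesis unfolding barycentre_T by (simp del: of_nat_add)
qed

lemma minus_barycentre_bary: "x - bc = (\<Sum>v\<in>C. l v x *\<^sub>R (v - bc))"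
proof -
  have "(\<Sum>v\<in>C. l v x *\<^sub>R (v - bc)) = (\<Sum>v\<in>C. l v x *\<^sub>R v) - (\<Sum>v\<in>C. l v x) *\<^sub>R bc"
    by (simp add: scaleR_right_diff_distrib sum_subtractf scaleR_left.sum)
  then show ?thesis by (simp add: bary_sum bary_sum_scaleR)
qed

text \<open>All coordinates have the same integral, and the vertex offsets from the barycentre sum
  to zero.\<close>

lemma I_minus_barycentre: "I (\<lambda>x. w \<bullet> (x - bc)) = 0"
proof -
  have "I (\<lambda>x. w \<bullet> (x - bc)) = I (\<lambda>x. \<Sum>v\<in>C. l v x * (w \<bullet> (v - bc)))"
    by (subst minus_barycentre_bary) (simp add: inner_sum_right)
  also have "\<dots> = (LINT x|lborel. (\<Sum>v\<in>C. (indicator T x * l v x) * (w \<bullet> (v - bc))))"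
    by (simp add: sum_distrib_left mult.assoc)
  also have "\<dots> = (\<Sum>v\<in>C. I (l v) * (w \<bullet> (v - bc)))"
    by (subst Bochner_Integration.integral_sum)
      (auto intro!: integrable_I continuous_bary Bochner_Integration.integrable_mult_left)
  also have "\<dots> = I (\<lambda>_. 1) / (DIM('a) + 1) * (\<Sum>v\<in>C. w \<bullet> (v - bc))"
    by (simp add: first_moment sum_distrib_left)
  also have "(\<Sum>v\<in>C. w \<bullet> (v - bc)) = 0"
    by (subst inner_sum_right[symmetric]) (simp only: sum_minus_barycentre inner_zero_right)
  finally show ?thesis by simp
qed

text \<open>The second moments of the coordinates form a multiple of the all-ones matrix plus the
  identity. The all-ones part contributes the squared norm of the sum of the offsets
  \<open>v - bc\<close>, which is zero, so only the diagonal survives.\<close>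

lemma I_norm_minus_barycentre:
  "I (\<lambda>x. (norm (x - bc))\<^sup>2) = I (\<lambda>_. 1) / ((DIM('a) + 1) * (DIM('a) + 2)) * (\<Sum>v\<in>C. (norm (v - bc))\<^sup>2)"
proof -
  let ?K = "I (\<lambda>_. 1) / ((DIM('a) + 1) * (DIM('a) + 2))"
  have "I (\<lambda>x. (norm (x - bc))\<^sup>2) = (LINT x|lborel. (\<Sum>u\<in>C. \<Sum>v\<in>C. (indicator T x * (l u x * l v x)) * ((u - bc) \<bullet> (v - bc))))"
  proof (rule Bochner_Integration.integral_cong[OF refl])
    fix x
    have "(norm (x - bc))\<^sup>2 = (\<Sum>u\<in>C. l u x *\<^sub>R (u - bc)) \<bullet> (\<Sum>v\<in>C. l v x *\<^sub>R (v - bc))"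
      by (subst minus_barycentre_bary) (rule power2_norm_eq_inner)
    also have "\<dots> = (\<Sum>u\<in>C. \<Sum>v\<in>C. (l u x * l v x) * ((u - bc) \<bullet> (v - bc)))"
      unfolding inner_sum_left inner_sum_right by (subst sum.swap) (simp add: mult_ac inner_commute)
    finally show "indicator T x * (norm (x - bc))\<^sup>2 = (\<Sum>u\<in>C. \<Sum>v\<in>C. (indicator T x * (l u x * l v x)) * ((u - bc) \<bullet> (v - bc)))"
      by (simp add: sum_distrib_left mult.assoc)
  qed
  also have "\<dots> = (\<Sum>u\<in>C. \<Sum>v\<in>C. I (\<lambda>x. l u x * l v x) * ((u - bc) \<bullet> (v - bc)))"
  proof -
    have int: "integrable lborel (\<lambda>x. (indicator T x * (l u x * l v x)) * ((u - bc) \<bullet> (v - bc)))" if "u \<in> C" "v \<in> C" for u v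
      using that by (intro Bochner_Integration.integrable_mult_left integrable_I continuous_on_mult continuous_bary)
    have "(LINT x|lborel. (\<Sum>u\<in>C. \<Sum>v\<in>C. (indicator T x * (l u x * l v x)) * ((u - bc) \<bullet> (v - bc)))) =
      (\<Sum>u\<in>C. LINT x|lborel. (\<Sum>v\<in>C. (indicator T x * (l u x * l v x)) * ((u - bc) \<bullet> (v - bc))))"
      by (intro Bochner_Integration.integral_sum Bochner_Integration.integrable_sum int)
    also have "\<dots> = (\<Sum>u\<in>C. \<Sum>v\<in>C. LINT x|lborel. (indicator T x * (l u x * l v x)) * ((u - bc) \<bullet> (v - bc)))"
      by (intro sum.cong[OF refl] Bochner_Integration.integral_sum int)
    finally show ?thesis by simp
  qed
  also have "\<dots> = (\<Sum>u\<in>C. \<Sum>v\<in>C. ?K * ((u - bc) \<bullet> (v - bc)) + (if u = v then ?K * ((u - bc) \<bullet> (v - bc)) else 0))"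
    by (intro sum.cong refl) (simp add: second_moment del: of_nat_add)
  also have "\<dots> = ?K * (\<Sum>u\<in>C. \<Sum>v\<in>C. (u - bc) \<bullet> (v - bc)) + ?K * (\<Sum>u\<in>C. (u - bc) \<bullet> (u - bc))"
    using finite_C by (simp add: sum.distrib sum_distrib_left)
  also have "(\<Sum>u\<in>C. \<Sum>v\<in>C. (u - bc) \<bullet> (v - bc)) = (\<Sum>u\<in>C. u - bc) \<bullet> (\<Sum>v\<in>C. v - bc)"
    by (simp only: inner_sum_left inner_sum_right) (rule sum.swap)
  also have "\<dots> = 0" by (simp only: sum_minus_barycentre inner_zero_right)
  finally show ?thesis by (simp add: power2_norm_eq_inner)
qed

text \<open>When \<open>u - v\<close> is expanded about the barycentre, the cross terms cancel by
  \<open>sum_minus_barycentre\<close>. The double sum runs over ordered pairs and so counts each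
  edge twice.\<close>

lemma sum_norm_minus_barycentre:
  "(\<Sum>v\<in>C. (norm (v - bc))\<^sup>2) = (\<Sum>u\<in>C. \<Sum>v\<in>C. (norm (u - v))\<^sup>2) / (2 * (DIM('a) + 1))"
proof -
  have eq: "(norm (u - v))\<^sup>2 = (norm (u - bc))\<^sup>2 + (norm (v - bc))\<^sup>2 - 2 * ((u - bc) \<bullet> (v - bc))" for u v
    unfolding power2_norm_eq_inner by (simp add: inner_diff_left inner_diff_right inner_commute)
  have "(\<Sum>u\<in>C. \<Sum>v\<in>C. (norm (u - v))\<^sup>2) =
     (\<Sum>u\<in>C. \<Sum>v\<in>C. (norm (u - bc))\<^sup>2 + (norm (v - bc))\<^sup>2 - 2 * ((u - bc) \<bullet> (v - bc)))"
    by (intro sum.cong refl) (rule eq)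
  also have "\<dots> =
     (\<Sum>u\<in>C. \<Sum>v\<in>C. (norm (u - bc))\<^sup>2 + (norm (v - bc))\<^sup>2) - 2 * (\<Sum>u\<in>C. \<Sum>v\<in>C. (u - bc) \<bullet> (v - bc))"
    by (simp only: sum_subtractf sum_distrib_left)
  also have "(\<Sum>u\<in>C. \<Sum>v\<in>C. (u - bc) \<bullet> (v - bc)) = (\<Sum>u\<in>C. u - bc) \<bullet> (\<Sum>v\<in>C. v - bc)"
    by (simp only: inner_sum_left inner_sum_right) (rule sum.swap)
  also have "\<dots> = 0" by (simp only: sum_minus_barycentre inner_zero_right)
  also have "(\<Sum>u\<in>C. \<Sum>v\<in>C. (norm (u - bc))\<^sup>2 + (norm (v - bc))\<^sup>2) = 2 * (DIM('a) + 1) * (\<Sum>v\<in>C. (norm (v - bc))\<^sup>2)"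
    by (simp add: sum.distrib card_C sum_distrib_left[symmetric] algebra_simps)
  finally show ?thesis by (simp add: field_simps)
qed

text \<open>Of the ordered pairs of vertices, \<open>(d + 1) * d\<close> lie off the diagonal, and
  each contributes at most the squared diameter. The diameter is itself attained by a pair of
  vertices, which occurs in both orders.\<close>

lemma I_norm_minus_barycentre_bounds:
  fixes d :: real defines "d \<equiv> DIM('a)"
  shows "I (\<lambda>_. 1) * (diameter T)\<^sup>2 / ((d + 1)\<^sup>2 * (d + 2)) \<le> I (\<lambda>x. (norm (x - bc))\<^sup>2)"
    and "I (\<lambda>x. (norm (x - bc))\<^sup>2) \<le> I (\<lambda>_. 1) * d * (diameter T)\<^sup>2 / (2 * (d + 1) * (d + 2))"
proof -
  let ?S = "\<Sum>u\<in>C. \<Sum>v\<in>C. (norm (u - v))\<^sup>2"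
  have d: "d \<ge> 0" by (simp add: d_def)
  have eq: "I (\<lambda>x. (norm (x - bc))\<^sup>2) = I (\<lambda>_. 1) * ?S / (2 * (d + 1)\<^sup>2 * (d + 2))"
    unfolding I_norm_minus_barycentre sum_norm_minus_barycentre d_def by (simp add: power2_eq_square algebra_simps)
  have nm: "norm (u - v) \<le> diameter T" if "u \<in> C" "v \<in> C" for u v
    using diameter_bounded_bound[OF compact_imp_bounded[OF compact_T], of u v] that
    by (simp add: hull_inc dist_norm)
  have D0: "0 \<le> diameter T" using diameter_ge_0[OF compact_imp_bounded[OF compact_T]] .
  have inner: "(\<Sum>v\<in>C. (norm (u - v))\<^sup>2) \<le> d * (diameter T)\<^sup>2" if "u \<in> C" for u
  proof -
    have "(\<Sum>v\<in>C. (norm (u - v))\<^sup>2) = (\<Sum>v\<in>C - {u}. (norm (u - v))\<^sup>2)"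
      using finite_C that by (simp add: sum.remove)
    also have "\<dots> \<le> (\<Sum>v\<in>C - {u}. (diameter T)\<^sup>2)"
      using nm that by (intro sum_mono power_mono) auto
    also have "\<dots> = d * (diameter T)\<^sup>2" using finite_C that by (simp add: card_C d_def)
    finally show ?thesis .
  qed
  have upper: "?S \<le> (d + 1) * (d * (diameter T)\<^sup>2)"
    using sum_mono[of C "\<lambda>u. \<Sum>v\<in>C. (norm (u - v))\<^sup>2" "\<lambda>_. d * (diameter T)\<^sup>2", OF inner] by (simp add: card_C d_def algebra_simps)
  have "C \<noteq> {}" using card_C by auto
  then obtain u v where uv: "u \<in> C" "v \<in> C" "diameter T \<le> norm (u - v)"
  proof -
    obtain x y where "x \<in> T" "y \<in> T" "dist x y = diameter T"
      using diameter_compact_attained[OF compact_T] \<open>C \<noteq> {}\<close> by auto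
    moreover have "\<exists>u\<in>C. \<exists>v\<in>C. norm (x - y) \<le> norm (u - v)"
      using simplex_extremal_le_exists[OF finite_C] calculation by blast
    ultimately show ?thesis using that by (auto simp: dist_norm)
  qed
  have lower: "2 * (diameter T)\<^sup>2 \<le> ?S"
  proof (cases "u = v")
    case True
    then have "diameter T = 0" using uv D0 by simp
    then show ?thesis by (simp add: sum_nonneg)
  next
    case False
    \<comment> \<open>Each of the rows \<open>u\<close> and \<open>v\<close> of the double sum
      contains the extremal edge; they are two rows because \<open>u\<close> and \<open>v\<close>
      differ in this case.\<close>
    have "(\<Sum>w\<in>{u, v}. (diameter T)\<^sup>2) \<le> (\<Sum>w\<in>{u, v}. \<Sum>x\<in>C. (norm (w - x))\<^sup>2)"
    proof (rule sum_mono)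
      fix w assume "w \<in> {u, v}"
      then obtain x where x: "x \<in> C" "diameter T \<le> norm (w - x)" using uv by (auto simp: norm_minus_commute)
      have "(diameter T)\<^sup>2 \<le> (norm (w - x))\<^sup>2" using x D0 by (intro power_mono)
      also have "\<dots> \<le> (\<Sum>x\<in>C. (norm (w - x))\<^sup>2)" using x finite_C by (intro member_le_sum) auto
      finally show "(diameter T)\<^sup>2 \<le> (\<Sum>x\<in>C. (norm (w - x))\<^sup>2)" .
    qed
    also have "\<dots> \<le> ?S" using uv finite_C by (intro sum_mono2) (auto intro: sum_nonneg)
    finally show ?thesis using False by simp
  qed
  have P: "0 \<le> I (\<lambda>_. 1)" using I_one_pos by simp
  have "I (\<lambda>_. 1) * (diameter T)\<^sup>2 / ((d + 1)\<^sup>2 * (d + 2)) = I (\<lambda>_. 1) * (2 * (diameter T)\<^sup>2) / (2 * (d + 1)\<^sup>2 * (d + 2))"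
    using d by (simp add: divide_simps)
  also have "\<dots> \<le> I (\<lambda>_. 1) * ?S / (2 * (d + 1)\<^sup>2 * (d + 2))"
    using d P lower by (intro divide_right_mono mult_left_mono) auto
  finally show "I (\<lambda>_. 1) * (diameter T)\<^sup>2 / ((d + 1)\<^sup>2 * (d + 2)) \<le> I (\<lambda>x. (norm (x - bc))\<^sup>2)"
    by (simp only: eq)
  have "I (\<lambda>_. 1) * ?S / (2 * (d + 1)\<^sup>2 * (d + 2)) \<le> I (\<lambda>_. 1) * ((d + 1) * (d * (diameter T)\<^sup>2)) / (2 * (d + 1)\<^sup>2 * (d + 2))"
    using d P upper by (intro divide_right_mono mult_left_mono) auto
  also have "\<dots> = I (\<lambda>_. 1) * d * (diameter T)\<^sup>2 / (2 * (d + 1) * (d + 2))"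
  proof -
    have "a * ((d + 1) * b) / (2 * (d + 1)\<^sup>2 * (d + 2)) = a * b / (2 * (d + 1) * (d + 2))" for a b
      using d by (simp add: power2_eq_square divide_simps)
    then show ?thesis by (simp add: mult.assoc)
  qed
  finally show "I (\<lambda>x. (norm (x - bc))\<^sup>2) \<le> I (\<lambda>_. 1) * d * (diameter T)\<^sup>2 / (2 * (d + 1) * (d + 2))"
    by (simp only: eq)
qed

end

section \<open>Geometry of conforming triangulations\<close>

abbreviation verts :: "'a::euclidean_space set \<Rightarrow> 'a set" where
  "verts T \<equiv> {v. v extreme_point_of T}"

lemma eventually_line_in_open:
  fixes p w :: "'a::real_normed_vector"
  assumes "open U" "p \<in> U"
  shows "\<forall>\<^sub>F t in at_right 0. 0 < t \<and> t < 1 \<and> p + t *\<^sub>R w \<in> U"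
proof -
  have "((\<lambda>t. p + t *\<^sub>R w) \<longlongrightarrow> p + 0 *\<^sub>R w) (at_right 0)" by (intro tendsto_intros)
  then have "\<forall>\<^sub>F t in at_right 0. p + t *\<^sub>R w \<in> U" using assms by (auto dest: topological_tendstoD)
  moreover have "\<forall>\<^sub>F t in at_right 0. t \<in> {0<..<1::real}" by (rule eventually_at_right_real) simp
  ultimately show ?thesis by eventually_elim auto
qed

lemma line_meets_open:
  fixes p w :: "'a::real_normed_vector"
  assumes "open U" "p \<in> U"
  obtains t where "0 < t" "t < 1" "p + t *\<^sub>R w \<in> U"
  using eventually_happens'[OF trivial_limit_at_right_real eventually_line_in_open[OF assms]] by blast

text \<open>The identity \<open>interior (closure \<Omega>) = \<Omega>\<close> is the form in which
  the Lipschitz boundary enters: it puts the interior of every element inside \<Omega>, so that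
  integrals over \<Omega> split over the elements.\<close>

locale mesh =
  fixes \<Omega> :: "'a::euclidean_space set" and \<T> :: "'a set set"
  assumes conforming: "conforming_triangulation \<Omega> \<T>"
    and interior_closure: "interior (closure \<Omega>) = \<Omega>"
    and nonempty: "\<Omega> \<noteq> {}"
begin

lemma open_\<Omega>: "open \<Omega>"
  by (metis interior_closure open_interior)

lemma finite_\<T>: "finite \<T>" and Union_\<T>: "\<Union>\<T> = closure \<Omega>"
  and face_Int: "T \<in> \<T> \<Longrightarrow> T' \<in> \<T> \<Longrightarrow> (T \<inter> T') face_of T"
  using conforming by (auto simp: conforming_triangulation_def triangulation_def)

lemma \<T>_nonempty: "\<T> \<noteq> {}"
  using Union_\<T> nonempty closure_eq_empty by (metis Union_empty)

lemma simplex_verts: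
  assumes "T \<in> \<T>"
  shows "full_simplex (verts T)" and "convex hull (verts T) = T"
proof -
  obtain C where C: "\<not> affine_dependent C" "int (card C) = int DIM('a) + 1" "T = convex hull C"
    using conforming assms by (auto simp: conforming_triangulation_def simplex_def)
  then have "verts T = C" by (auto simp: extreme_point_of_convex_hull_affine_independent)
  then show "full_simplex (verts T)" "convex hull (verts T) = T"
    using C by (auto intro!: full_simplex.intro)
qed

lemma compact_element: "T \<in> \<T> \<Longrightarrow> compact T"
  using full_simplex.compact_T[OF simplex_verts(1)] simplex_verts(2) by simp

lemma convex_element: "T \<in> \<T> \<Longrightarrow> convex T"
  by (metis convex_convex_hull simplex_verts(2))

lemma bounded_\<Omega>: "bounded \<Omega>"
proof -
  have "bounded (closure \<Omega>)"
    unfolding Union_\<T>[symmetric] using finite_\<T> compact_element compact_imp_bounded by blast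
  then show ?thesis using bounded_subset closure_subset by blast
qed

lemma interior_element_nonempty: "T \<in> \<T> \<Longrightarrow> interior T \<noteq> {}"
  using full_simplex.interior_T_nonempty[OF simplex_verts(1)] simplex_verts(2) by simp

lemma interior_element_subset: "T \<in> \<T> \<Longrightarrow> interior T \<subseteq> \<Omega>"
  by (metis Sup_upper Union_\<T> interior_closure interior_mono)

lemma element_subset_closure: "T \<in> \<T> \<Longrightarrow> T \<subseteq> closure (interior T)"
  using convex_closure_interior[OF convex_element interior_element_nonempty] closure_subset by auto

lemma aff_dim_element: "T \<in> \<T> \<Longrightarrow> aff_dim T = DIM('a)"
  by (simp add: aff_dim_nonempty_interior interior_element_nonempty)

text \<open>The intersection is a face of both elements. A proper face has smaller dimension, so a
  face with nonempty interior is the whole element.\<close>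

lemma face_of_element_eq:
  assumes "T \<in> \<T>" "T' \<in> \<T>" "interior (T \<inter> T') \<noteq> {}"
  shows "T = T'"
proof -
  have "aff_dim (T \<inter> T') = DIM('a)" using assms by (simp add: aff_dim_nonempty_interior)
  then have "T \<inter> T' = T" "T' \<inter> T = T'"
    using face_of_aff_dim_lt[OF convex_element face_Int, OF assms(1) assms(1) assms(2)]
      face_of_aff_dim_lt[OF convex_element face_Int, OF assms(2) assms(2) assms(1)]
      aff_dim_element assms by (auto simp: Int_commute)
  then show ?thesis by blast
qed

lemma interior_disjoint:
  assumes "T \<in> \<T>" "T' \<in> \<T>" "x \<in> interior T" "x \<in> interior T'" shows "T = T'"
  using face_of_element_eq[OF assms(1,2)] assms(3,4) by (auto simp: interior_Int)

lemma element_at_eq: "T \<in> \<T> \<Longrightarrow> x \<in> interior T \<Longrightarrow> element_at \<T> x = T"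
  unfolding element_at_def by (rule the_equality) (simp, metis interior_disjoint)

section \<open>Facets and the elements that share them\<close>

lemma facet_vertex:
  assumes "T \<in> \<T>" "v \<in> verts T" shows "convex hull (verts T - {v}) facet_of T"
proof -
  interpret S: full_simplex "verts T" using simplex_verts assms by blast
  have "2 \<le> card (verts T)" unfolding S.card_C using DIM_positive[where 'a='a] by linarith
  then show ?thesis
    using facet_of_convex_hull_affine_independent_alt[OF S.indep, of "convex hull (verts T - {v})"]
      assms simplex_verts(2)[OF assms(1)] by auto
qed

text \<open>From a point of the facet inside \<Omega>, a small step out of \<open>T\<close> stays in
  \<Omega> and so lands in other elements. Their union is closed, hence contains the point itself,
  and the element found there meets \<open>T\<close> in a face that can only be this facet.\<close>

lemma shared_facet:
  assumes T: "T \<in> \<T>" and v: "v \<in> verts T" and F: "\<not> convex hull (verts T - {v}) \<subseteq> frontier \<Omega>"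
  shows "\<exists>T'\<in>\<T>. T' \<noteq> T \<and> convex hull (verts T - {v}) facet_of T'"
proof -
  interpret S: full_simplex "verts T" using simplex_verts T by blast
  let ?F = "convex hull (verts T - {v})"
  have hT: "convex hull (verts T) = T" using simplex_verts T by blast
  have Fsub: "?F \<subseteq> T" using hull_mono[of "verts T - {v}" "verts T" convex] hT by auto
  obtain p0 where p0: "p0 \<in> ?F" "p0 \<in> \<Omega>"
    using F Fsub T Union_\<T> interior_open[OF open_\<Omega>] by (auto simp: frontier_def)
  have Fb: "?F = {x. (\<forall>w\<in>verts T. 0 \<le> S.l w x) \<and> S.l v x = 0}"
    using S.convex_hull_bary[of "verts T - {v}"] v by (simp add: Diff_Diff_Int Int_absorb1)
  \<comment> \<open>The barycentre of the facet, which has \<open>DIM('a)\<close> vertices. Moving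
    \<open>p0\<close> slightly towards it makes all coordinates except \<open>l v\<close> positive
    without leaving \<Omega>.\<close>
  define c where "c = (\<Sum>w\<in>verts T. (if w = v then 0 else 1 / DIM('a)) *\<^sub>R w)"
  have c: "S.l w c = (if w = v then 0 else 1 / DIM('a))" if "w \<in> verts T" for w
    unfolding c_def
  proof (rule S.bary_comb[OF that])
    have "(\<Sum>w\<in>verts T. if w = v then 0 else 1 / real DIM('a)) = (\<Sum>w\<in>verts T - {v}. 1 / DIM('a))"
      using S.finite_C v by (simp add: sum.remove[of _ v])
    then show "(\<Sum>w\<in>verts T. if w = v then 0 else 1 / real DIM('a)) = 1"
      using S.finite_C v by (simp add: S.card_C)
  qed
  define p where "p t = p0 + t *\<^sub>R (c - p0)" for t
  have lp: "S.l w (p t) = S.l w p0 + t * (S.l w c - S.l w p0)" if "w \<in> verts T" for w t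
    unfolding p_def using S.bary_shift[OF that] .
  obtain t where t: "0 < t" "t < 1" "p t \<in> \<Omega>"
    unfolding p_def by (rule line_meets_open[OF open_\<Omega> p0(2)])
  define p1 where "p1 = p t"
  have p1v: "S.l v p1 = 0" using lp[OF v, of t] c[OF v] p0 Fb by (simp add: p1_def)
  have p1w: "0 < S.l w p1" if "w \<in> verts T" "w \<noteq> v" for w
  proof -
    have "S.l w p1 = (1 - t) * S.l w p0 + t / DIM('a)"
      using lp[OF that(1), of t] c[OF that(1)] that(2) by (simp add: p1_def algebra_simps)
    moreover have "0 \<le> S.l w p0" using p0 Fb that by auto
    ultimately show ?thesis using t by (simp add: add_nonneg_pos)
  qed
  have p1F: "p1 \<in> ?F" using p1v p1w Fb by (force simp: less_imp_le)
  have "p1 \<in> closure (\<Union>(\<T> - {T}))"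
  proof -
    \<comment> \<open>Any other vertex \<open>w\<close> serves: along \<open>w - v\<close> the
      coordinate \<open>l v\<close> becomes negative, so \<open>q s\<close> leaves \<open>T\<close>
      through the facet.\<close>
    obtain w where w: "w \<in> verts T" "w \<noteq> v"
    proof -
      have "\<not> verts T \<subseteq> {v}"
      proof
        assume "verts T \<subseteq> {v}"
        then have "card (verts T) \<le> 1" using card_mono[of "{v}"] by fastforce
        then show False by (simp add: S.card_C)
      qed
      then show ?thesis using that by blast
    qed
    define q where "q s = p1 + s *\<^sub>R (w - v)" for s :: real
    have lim: "(q \<longlongrightarrow> p1) (at_right 0)" unfolding q_def by (intro tendsto_eq_intros) auto
    have "\<forall>\<^sub>F s in at_right 0. 0 < s \<and> s < 1 \<and> q s \<in> \<Omega>"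
      unfolding q_def by (rule eventually_line_in_open[OF open_\<Omega> t(3)[folded p1_def]])
    then have "\<forall>\<^sub>F s in at_right 0. q s \<in> closure (\<Union>(\<T> - {T}))"
    proof eventually_elim
      case (elim s)
      have "S.l v (q s) = - s"
        unfolding q_def using v w p1v by (simp add: S.bary_shift S.bary_vertex)
      then have "q s \<notin> T" using elim v S.T_bary hT by force
      moreover have "q s \<in> \<Union>\<T>" using elim Union_\<T> closure_subset[of \<Omega>] by auto
      ultimately have "q s \<in> \<Union>(\<T> - {T})" by blast
      then show ?case using closure_subset[of "\<Union>(\<T> - {T})"] by (rule subsetD[rotated])
    qed
    then show ?thesis
      using Lim_in_closed_set[OF closed_closure _ trivial_limit_at_right_real lim] by blast
  qed
  moreover have "closed (\<Union>(\<T> - {T}))"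
    using finite_\<T> compact_element compact_imp_closed by (intro closed_Union) auto
  ultimately obtain T' where T': "T' \<in> \<T>" "T' \<noteq> T" "p1 \<in> T'" by auto
  have "(T \<inter> T') face_of (convex hull verts T)" using face_Int[OF T T'(1)] hT by simp
  then obtain C' where C': "C' \<subseteq> verts T" "T \<inter> T' = convex hull C'"
    using face_of_convex_hull_affine_independent[OF S.indep] by auto
  \<comment> \<open>All coordinates of \<open>p1\<close> other than \<open>l v\<close> are positive,
    so a face containing \<open>p1\<close> must have all the corresponding vertices.\<close>
  have "p1 \<in> convex hull C'" using p1F Fsub T' C' by blast
  then have "verts T - {v} \<subseteq> C'"
    using S.convex_hull_bary[OF C'(1)] p1w by force
  moreover have "C' \<noteq> verts T"
  proof
    assume "C' = verts T"
    then have "T \<inter> T' = T" using C' hT by simp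
    then show False using face_of_element_eq[OF T T'(1)] interior_element_nonempty[OF T] T'(2) by auto
  qed
  ultimately have "C' = verts T - {v}" using C' v by blast
  then have F_eq: "?F = T' \<inter> T" using C' by blast
  then have "?F face_of T'" using face_Int[OF T'(1) T] by simp
  moreover have "?F facet_of T" using facet_vertex T v by blast
  ultimately have "?F facet_of T'"
    using aff_dim_element T T' by (simp add: facet_of_def)
  then show ?thesis using T' by blast
qed

text \<open>The coordinates opposite to the facet in the two simplices vanish on the same hyperplane
  and are therefore proportional. The ratio \<open>k\<close> is negative, since otherwise the
  elements would overlap in an open set; so each point near \<open>q\<close> is on the side of
  \<open>T\<close> or on that of \<open>T'\<close>.\<close>

lemma facet_interior_Un:
  assumes T: "T \<in> \<T>" and T': "T' \<in> \<T>" "T \<noteq> T'" and v: "v \<in> verts T"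
    and F: "convex hull (verts T - {v}) facet_of T'"
    and qv: "bary (verts T) v q = 0" and qw: "\<And>w. w \<in> verts T \<Longrightarrow> w \<noteq> v \<Longrightarrow> 0 < bary (verts T) w q"
  shows "q \<in> interior (T \<union> T')"
proof -
  interpret S: full_simplex "verts T" using simplex_verts T by blast
  interpret S': full_simplex "verts T'" using simplex_verts T' by blast
  let ?F = "convex hull (verts T - {v})"
  have hT: "convex hull (verts T) = T" "convex hull (verts T') = T'" using simplex_verts T T' by auto
  obtain v' where v': "v' \<in> verts T'" "?F = convex hull (verts T' - {v'})"
    using F facet_of_convex_hull_affine_independent[OF S'.indep, of ?F] hT by auto
  have D: "verts T - {v} = verts T' - {v'}"
    using extreme_point_of_convex_hull_affine_independent[OF affine_independent_subset[OF S.indep Diff_subset]]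
      extreme_point_of_convex_hull_affine_independent[OF affine_independent_subset[OF S'.indep Diff_subset]] v'(2)
    by (metis (no_types, lifting) set_eqI)
  define k where "k = S'.l v' v"
  have lk: "S'.l v' x = k * S.l v x" for x
  proof -
    obtain a b where ab: "S'.l v' = (\<lambda>x. a \<bullet> x + b)" using S'.bary_affine v' by blast
    have "S'.l v' x = (\<Sum>w\<in>verts T. S.l w x * S'.l v' w)"
    proof -
      have "S'.l v' x = a \<bullet> (\<Sum>w\<in>verts T. S.l w x *\<^sub>R w) + (\<Sum>w\<in>verts T. S.l w x) * b"
        by (simp only: S.bary_sum S.bary_sum_scaleR ab)
      also have "\<dots> = (\<Sum>w\<in>verts T. S.l w x * S'.l v' w)"
        by (simp add: ab inner_sum_right sum_distrib_right distrib_left sum.distrib)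
      finally show ?thesis .
    qed
    also have "\<dots> = (\<Sum>w\<in>verts T. if w = v then S.l v x * k else 0)"
    proof (rule sum.cong[OF refl])
      fix w assume w: "w \<in> verts T"
      show "S.l w x * S'.l v' w = (if w = v then S.l v x * k else 0)"
      proof (cases "w = v")
        case False
        then have "w \<in> verts T' - {v'}" using w D by blast
        then show ?thesis using False v'(1) S'.bary_vertex[of v' w] by simp
      qed (simp add: k_def)
    qed
    also have "\<dots> = k * S.l v x" using S.finite_C v by simp
    finally show ?thesis .
  qed
  have k0: "k \<noteq> 0" using lk[of v'] S'.bary_vertex[OF v'(1) v'(1)] by auto
  have q_eq: "q = (\<Sum>w\<in>verts T'. (if w = v' then 0 else S.l w q) *\<^sub>R w)"
  proof -
    have "q = (\<Sum>w\<in>verts T. S.l w q *\<^sub>R w)" by (simp only: S.bary_sum_scaleR)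
    also have "\<dots> = (\<Sum>w\<in>verts T - {v}. S.l w q *\<^sub>R w)" using S.finite_C v qv by (simp add: sum.remove)
    also have "\<dots> = (\<Sum>w\<in>verts T'. (if w = v' then 0 else S.l w q) *\<^sub>R w)"
      unfolding D using S'.finite_C v'(1) by (simp add: sum.remove[of _ v'])
    finally show ?thesis .
  qed
  have sum1: "(\<Sum>w\<in>verts T'. if w = v' then 0 else S.l w q) = 1"
  proof -
    have "(\<Sum>w\<in>verts T'. if w = v' then 0 else S.l w q) = (\<Sum>w\<in>verts T - {v}. S.l w q)"
      unfolding D using S'.finite_C v'(1) by (simp add: sum.remove[of _ v'])
    also have "\<dots> = (\<Sum>w\<in>verts T. S.l w q)" using S.finite_C v qv by (simp add: sum.remove)
    finally show ?thesis by (simp add: S.bary_sum)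
  qed
  have qw': "0 < S'.l w q" if "w \<in> verts T' - {v'}" for w
  proof -
    have "S'.l w q = S.l w q"
      using S'.bary_comb[OF _ sum1, of w] that q_eq[symmetric] by auto
    then show ?thesis using that D qw by auto
  qed
  \<comment> \<open>On this neighbourhood the coordinates of the facet's vertices are positive in
    both simplices, so membership is decided by the opposite coordinate alone.\<close>
  define N where "N = {x. \<forall>w\<in>verts T - {v}. 0 < S.l w x} \<inter> {x. \<forall>w\<in>verts T' - {v'}. 0 < S'.l w x}"
  have oN: "open N" unfolding N_def by (intro open_Int S.open_pos S'.open_pos) auto
  have qN: "q \<in> N" using qw qw' by (auto simp: N_def)
  have inT: "x \<in> T" if "x \<in> N" "0 \<le> S.l v x" for x
  proof -
    have "0 \<le> S.l w x" if "w \<in> verts T" for w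
      using that \<open>x \<in> N\<close> \<open>0 \<le> S.l v x\<close> by (cases "w = v") (auto simp: N_def intro: less_imp_le)
    then have "x \<in> convex hull (verts T)" unfolding S.T_bary by blast
    then show ?thesis using hT by simp
  qed
  have inT': "x \<in> T'" if "x \<in> N" "0 \<le> S'.l v' x" for x
  proof -
    have "0 \<le> S'.l w x" if "w \<in> verts T'" for w
      using that \<open>x \<in> N\<close> \<open>0 \<le> S'.l v' x\<close> by (cases "w = v'") (auto simp: N_def intro: less_imp_le)
    then have "x \<in> convex hull (verts T')" unfolding S'.T_bary by blast
    then show ?thesis using hT by simp
  qed
  have "k < 0"
  proof (rule ccontr)
    assume "\<not> k < 0"
    then have "0 < k" using k0 by simp
    define P where "P = N \<inter> {x. 0 < S.l v x}"
    have "open P" unfolding P_def using oN v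
      by (intro open_Int open_Collect_less continuous_on_const S.continuous_bary) auto
    moreover have "P \<subseteq> T \<inter> T'" unfolding P_def using inT inT' lk \<open>0 < k\<close> by (auto simp: less_imp_le)
    moreover have "P \<noteq> {}"
    proof -
      obtain s where s: "0 < s" "q + s *\<^sub>R (v - q) \<in> N" using line_meets_open[OF oN qN] by blast
      have "S.l v (q + s *\<^sub>R (v - q)) = s"
        using v qv by (simp add: S.bary_shift S.bary_vertex)
      then show ?thesis using s by (auto simp: P_def)
    qed
    ultimately have "interior (T \<inter> T') \<noteq> {}" by (metis interior_maximal subset_empty)
    then show False using face_of_element_eq[OF T T'(1)] T'(2) by blast
  qed
  have "N \<subseteq> T \<union> T'"
  proof
    fix x assume x: "x \<in> N"
    show "x \<in> T \<union> T'"
    proof (cases "0 \<le> S.l v x")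
      case False
      then have "0 \<le> S'.l v' x" using lk[of x] \<open>k < 0\<close> by (simp add: mult_nonpos_nonpos)
      then show ?thesis using inT' x by blast
    qed (use inT x in blast)
  qed
  then show ?thesis using oN qN interiorI by blast
qed

text \<open>If \<open>e\<close> is parallel to both zero hyperplanes, the base point already lies in
  them. Otherwise eliminating \<open>s\<close> from the two equations confines the base point to a
  hyperplane.\<close>

lemma negligible_line_through_codim2:
  assumes T: "T \<in> \<T>" and uv: "u \<in> verts T" "v \<in> verts T" "u \<noteq> v"
  shows "negligible {p. \<exists>s. bary (verts T) u (p + s *\<^sub>R e) = 0 \<and> bary (verts T) v (p + s *\<^sub>R e) = 0}"
    (is "negligible ?B")
proof -
  interpret S: full_simplex "verts T" using simplex_verts T by blast
  obtain a b a' b' where ab: "S.l u = (\<lambda>x. a \<bullet> x + b)" "S.l v = (\<lambda>x. a' \<bullet> x + b')"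
    using S.bary_affine uv by metis
  have vals: "a \<bullet> u + b = 1" "a \<bullet> v + b = 0" "a' \<bullet> u + b' = 0" "a' \<bullet> v + b' = 1"
    using S.bary_vertex[OF uv(1) uv(1)] S.bary_vertex[OF uv(1) uv(2)]
      S.bary_vertex[OF uv(2) uv(1)] S.bary_vertex[OF uv(2) uv(2)] uv(3) by (auto simp: ab)
  show ?thesis
  proof (cases "a \<bullet> e = 0 \<and> a' \<bullet> e = 0")
    case True
    have "a \<noteq> 0" using vals by auto
    then have "negligible {p. a \<bullet> p = - b}" by (intro negligible_hyperplane) auto
    moreover have "?B \<subseteq> {p. a \<bullet> p = - b}" using True by (auto simp: ab inner_right_distrib)
    ultimately show ?thesis by (rule negligible_subset)
  next
    case False
    \<comment> \<open>The combination of the two equations whose normal \<open>c\<close> is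
      orthogonal to \<open>e\<close>, so that \<open>s\<close> drops out.\<close>
    define c where "c = (a' \<bullet> e) *\<^sub>R a - (a \<bullet> e) *\<^sub>R a'"
    define r where "r = - ((a' \<bullet> e) * b - (a \<bullet> e) * b')"
    have cu: "c \<bullet> x - r = (a' \<bullet> e) * (a \<bullet> x + b) - (a \<bullet> e) * (a' \<bullet> x + b')" for x
      by (simp add: c_def r_def inner_diff_left algebra_simps)
    \<comment> \<open>At \<open>u\<close> and \<open>v\<close> the function
      \<open>c \<bullet> x - r\<close> takes the values \<open>a' \<bullet> e\<close> and
      \<open>- (a \<bullet> e)\<close>, which are not both zero.\<close>
    have "c \<noteq> 0 \<or> r \<noteq> 0"
      using cu[of u] cu[of v] False unfolding vals by auto
    then have "negligible {p. c \<bullet> p = r}" by (rule negligible_hyperplane)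
    moreover have "?B \<subseteq> {p. c \<bullet> p = r}"
    proof clarsimp
      fix p s assume "S.l u (p + s *\<^sub>R e) = 0" "S.l v (p + s *\<^sub>R e) = 0"
      then have "c \<bullet> (p + s *\<^sub>R e) - r = 0" unfolding cu by (simp add: ab)
      moreover have "c \<bullet> e = 0" by (simp add: c_def inner_diff_left)
      ultimately show "c \<bullet> p = r" by (simp add: inner_right_distrib)
    qed
    ultimately show ?thesis by (rule negligible_subset)
  qed
qed

text \<open>A line in general position avoids all faces of codimension two, so it leaves the union of the elements in
  \<open>\<S>\<close> only through the relative interior of a facet, behind which lies another element of \<open>\<S>\<close>.\<close>

lemma no_facet_closed_submesh:
  assumes sub: "\<S> \<subseteq> \<T>" and ne: "\<S> \<noteq> {}"
    and step: "\<And>T v. T \<in> \<S> \<Longrightarrow> v \<in> verts T \<Longrightarrow>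
      \<exists>T'\<in>\<S>. T' \<noteq> T \<and> convex hull (verts T - {v}) facet_of T'"
  shows False
proof -
  obtain T0 where T0: "T0 \<in> \<S>" "T0 \<in> \<T>" using sub ne by blast
  obtain e :: 'a where e: "e \<in> Basis" using nonempty_Basis by blast
  define B where "B T u v = {p. \<exists>s. bary (verts T) u (p + s *\<^sub>R e) = 0 \<and> bary (verts T) v (p + s *\<^sub>R e) = 0}" for T u v
  define N where "N = (\<Union>T\<in>\<T>. \<Union>u\<in>verts T. \<Union>v\<in>verts T - {u}. B T u v)"
  have "finite (verts T)" if "T \<in> \<T>" for T
    using full_simplex.finite_C[OF simplex_verts(1)[OF that]] .
  then have "negligible N"
    unfolding N_def B_def using finite_\<T>
    by (intro negligible_Union finite_imageI ballI)
      (auto intro!: negligible_Union finite_imageI negligible_line_through_codim2)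
  moreover have "\<not> negligible (interior T0)"
    using open_not_negligible[OF open_interior interior_element_nonempty[OF T0(2)]] .
  ultimately obtain p where p: "p \<in> interior T0" "p \<notin> N"
    using negligible_subset by blast
  define L where "L = range (\<lambda>s::real. p + s *\<^sub>R e)"
  have conL: "connected L"
    unfolding L_def by (intro connected_continuous_image continuous_intros connected_UNIV)
  define S where "S = \<Union>\<S>"
  have fS: "finite \<S>" using sub finite_\<T> finite_subset by blast
  have "compact S" unfolding S_def using fS sub compact_element by (intro compact_Union) auto
  \<comment> \<open>This makes \<open>L \<inter> S\<close> relatively open in the connected line
    \<open>L\<close>; it is relatively closed because \<open>S\<close> is compact.\<close>
  have LS: "L \<inter> S \<subseteq> interior S"
  proof
    fix x assume "x \<in> L \<inter> S"
    then obtain s T where x: "x = p + s *\<^sub>R e" and T: "T \<in> \<S>" "x \<in> T" by (auto simp: L_def S_def)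
    have TT: "T \<in> \<T>" using sub T by blast
    interpret X: full_simplex "verts T" using simplex_verts TT by blast
    have hT: "convex hull (verts T) = T" using simplex_verts TT by blast
    have TS: "T \<subseteq> S" using T S_def by blast
    have nonneg: "0 \<le> X.l w x" if "w \<in> verts T" for w using T(2) X.T_bary hT that by auto
    show "x \<in> interior S"
    proof (cases "\<exists>v\<in>verts T. X.l v x = 0")
      case False
      then have "0 < X.l w x" if "w \<in> verts T" for w using nonneg[OF that] that by force
      then have "x \<in> interior T" using X.interior_T hT by simp
      then show ?thesis using TS interior_mono by blast
    next
      case True
      then obtain v where v: "v \<in> verts T" "X.l v x = 0" by blast
      have pos: "0 < X.l w x" if "w \<in> verts T" "w \<noteq> v" for w
      proof -
        have "X.l w x \<noteq> 0"
        proof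
          assume "X.l w x = 0"
          then have "p \<in> B T v w" using v x unfolding B_def by blast
          then have "p \<in> N" unfolding N_def using TT v that by blast
          then show False using p by blast
        qed
        then show ?thesis using nonneg[OF that(1)] by simp
      qed
      obtain T' where T': "T' \<in> \<S>" "T' \<noteq> T" "convex hull (verts T - {v}) facet_of T'"
        using step T v by blast
      have "x \<in> interior (T \<union> T')"
        using facet_interior_Un[OF TT _ _ v(1) T'(3) v(2) pos] T' sub by blast
      moreover have "T \<union> T' \<subseteq> S" using T T' S_def by blast
      ultimately show ?thesis using interior_mono by blast
    qed
  qed
  have "p \<in> L" unfolding L_def by (rule image_eqI[of _ _ 0]) auto
  have pS: "p \<in> interior S" using p(1) T0(1) interior_mono[of T0 S] by (auto simp: S_def)
  have "L \<subseteq> S"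
  proof (rule ccontr)
    assume "\<not> L \<subseteq> S"
    then have "- S \<inter> L \<noteq> {}" by blast
    moreover have "interior S \<inter> L \<noteq> {}" using pS \<open>p \<in> L\<close> by blast
    moreover have "L \<subseteq> interior S \<union> - S" using LS by blast
    moreover have "interior S \<inter> - S \<inter> L = {}" using interior_subset by blast
    moreover have "open (interior S)" "open (- S)"
      using \<open>compact S\<close> by (auto simp: compact_imp_closed)
    ultimately show False using conL unfolding connected_def by blast
  qed
  then have "bounded L" using \<open>compact S\<close> compact_imp_bounded bounded_subset by blast
  then obtain b where b: "\<And>x. x \<in> L \<Longrightarrow> norm x \<le> b" unfolding bounded_iff by blast
  \<comment> \<open>The parameter is chosen so that the displacement from \<open>p\<close> alone has
    norm exceeding \<open>b + norm p\<close>.\<close>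
  have "norm (p + (b + norm p + 1) *\<^sub>R e) \<le> b" by (rule b) (auto simp: L_def)
  moreover have "norm ((b + norm p + 1) *\<^sub>R e) \<le> norm (p + (b + norm p + 1) *\<^sub>R e) + norm p"
    using norm_triangle_ineq4[of "p + (b + norm p + 1) *\<^sub>R e" p] by simp
  ultimately show False using e by simp
qed

end

section \<open>Riesz representation and Rayleigh quotients in finite dimension\<close>

text \<open>Subspaces and linear maps are phrased with the single operation \<open>u + a v\<close>,
  which covers sums, differences and multiples at once.\<close>

definition fun_subspace :: "('x \<Rightarrow> real) set \<Rightarrow> bool" where
  "fun_subspace V \<longleftrightarrow> (\<lambda>_. 0) \<in> V \<and> (\<forall>u\<in>V. \<forall>v\<in>V. \<forall>a. (\<lambda>x. u x + a * v x) \<in> V)"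

definition fun_linear :: "('x \<Rightarrow> real) set \<Rightarrow> (('x \<Rightarrow> real) \<Rightarrow> 'b::real_vector) \<Rightarrow> bool" where
  "fun_linear V f \<longleftrightarrow> (\<forall>u\<in>V. \<forall>v\<in>V. \<forall>a. f (\<lambda>x. u x + a * v x) = f u + a *\<^sub>R f v)"

lemma fun_subspaceD:
  assumes "fun_subspace V"
  shows "(\<lambda>_. 0) \<in> V" "u \<in> V \<Longrightarrow> v \<in> V \<Longrightarrow> (\<lambda>x. u x + a * v x) \<in> V"
  using assms by (auto simp: fun_subspace_def)

lemma fun_linearD: "fun_linear V f \<Longrightarrow> u \<in> V \<Longrightarrow> v \<in> V \<Longrightarrow> f (\<lambda>x. u x + a * v x) = f u + a *\<^sub>R f v"
  by (simp add: fun_linear_def)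

lemma fun_subspace_diff: "fun_subspace V \<Longrightarrow> u \<in> V \<Longrightarrow> v \<in> V \<Longrightarrow> (\<lambda>x. u x - v x) \<in> V"
  using fun_subspaceD(2)[of V u v "-1"] by simp

lemma fun_linear_diff: "fun_linear V f \<Longrightarrow> u \<in> V \<Longrightarrow> v \<in> V \<Longrightarrow> f (\<lambda>x. u x - v x) = f u - f v"
  using fun_linearD[of V f u v "-1"] by simp

lemma fun_linear_zero:
  assumes "fun_subspace V" "fun_linear V f" shows "f (\<lambda>_. 0) = 0"
  using fun_linear_diff[OF assms(2) fun_subspaceD(1) fun_subspaceD(1), OF assms(1) assms(1)] by simp

text \<open>Induction on the number of functionals: split off the kernel of one of them and complete it
  orthogonally.\<close>

lemma riesz_exists:
  fixes c :: "'k \<Rightarrow> ('x \<Rightarrow> real) \<Rightarrow> real"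
  assumes "finite K"
  shows "fun_subspace V \<Longrightarrow> (\<And>k. k \<in> K \<Longrightarrow> fun_linear V (c k)) \<Longrightarrow> fun_linear V f \<Longrightarrow>
    (\<And>v. v \<in> V \<Longrightarrow> (\<And>k. k \<in> K \<Longrightarrow> c k v = 0) \<Longrightarrow> v = (\<lambda>_. 0)) \<Longrightarrow>
    \<exists>z\<in>V. \<forall>v\<in>V. (\<Sum>k\<in>K. c k z * c k v) = f v"
  using assms
proof (induction K arbitrary: V f rule: finite_induct)
  case empty
  then have "v = (\<lambda>_. 0)" if "v \<in> V" for v using that by simp
  then have "f v = 0" if "v \<in> V" for v using that fun_linear_zero empty by metis
  then show ?case using fun_subspaceD(1)[OF empty(1)] by auto
next
  case (insert k K)
  note sub = insert.prems(1) and lc = insert.prems(2) and lf = insert.prems(3) and inj = insert.prems(4)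
  let ?B = "\<lambda>u v. \<Sum>k\<in>insert k K. c k u * c k v"
  have lin: "c j (\<lambda>x. u x + a * v x) = c j u + a * c j v" if "j \<in> insert k K" "u \<in> V" "v \<in> V" for j u v a
    using fun_linearD[OF lc] that by simp
  have Badd: "?B z (\<lambda>x. u x + a * v x) = ?B z u + a * ?B z v" if "u \<in> V" "v \<in> V" for z u v a
  proof -
    have "?B z (\<lambda>x. u x + a * v x) = (\<Sum>j\<in>insert k K. c j z * c j u + a * (c j z * c j v))"
      by (intro sum.cong refl) (simp add: lin that algebra_simps)
    then show ?thesis by (simp only: sum.distrib sum_distrib_left)
  qed
  have Bsym: "?B u v = ?B v u" for u v by (simp add: mult.commute)
  define V0 where "V0 = {v \<in> V. c k v = 0}"
  have V0V: "V0 \<subseteq> V" by (auto simp: V0_def)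
  have sub0: "fun_subspace V0"
    unfolding fun_subspace_def V0_def
    using fun_subspaceD[OF sub] fun_linear_zero[OF sub lc, of k] lin[of k] by auto
  have lc0: "fun_linear V0 (c j)" if "j \<in> insert k K" for j
    using lc[OF that] V0V unfolding fun_linear_def by blast
  \<comment> \<open>On the kernel the term with \<open>k\<close> drops out, so the induction
    hypothesis for \<open>K\<close> represents functionals by the full form.\<close>
  have ex0: "\<exists>z\<in>V0. \<forall>v\<in>V0. ?B z v = g v" if "fun_linear V0 g" for g
  proof -
    have "\<exists>z\<in>V0. \<forall>v\<in>V0. (\<Sum>k\<in>K. c k z * c k v) = g v"
      by (rule insert.IH) (use sub0 lc0 that inj V0V in \<open>auto simp: V0_def\<close>)
    then show ?thesis using insert.hyps by (auto simp: V0_def)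
  qed
  have "fun_linear V0 f" using lf V0V unfolding fun_linear_def by blast
  then obtain z0 where z0: "z0 \<in> V0" "\<And>v. v \<in> V0 \<Longrightarrow> ?B z0 v = f v" using ex0 by blast
  show ?case
  proof (cases "V0 = V")
    case True
    then show ?thesis using z0 by blast
  next
    case False
    then obtain w1 where w1: "w1 \<in> V" "c k w1 \<noteq> 0" using V0V unfolding V0_def by blast
    \<comment> \<open>The representative \<open>p\<close> of this functional is the orthogonal
      projection of \<open>w1\<close> onto \<open>V0\<close>, so \<open>w1 - p\<close> spans the
      orthogonal complement of \<open>V0\<close> in \<open>V\<close>.\<close>
    have "fun_linear V0 (\<lambda>v. ?B w1 v)"
      unfolding fun_linear_def real_scaleR_def using Badd V0V by blast
    then obtain p where p: "p \<in> V0" "\<And>v. v \<in> V0 \<Longrightarrow> ?B p v = ?B w1 v" using ex0 by blast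
    define w where "w = (\<lambda>x. w1 x + (-1) * p x)"
    have wV: "w \<in> V" unfolding w_def using w1 p V0V by (intro fun_subspaceD(2)[OF sub]) auto
    have ckw: "c k w \<noteq> 0" unfolding w_def using lin[of k w1 p "-1"] w1 p V0V by (auto simp: V0_def)
    have orth: "?B w v = 0" if "v \<in> V0" for v
    proof -
      have "?B v w = ?B v w1 + (-1) * ?B v p" unfolding w_def using Badd[of w1 p v "-1"] w1 p V0V by blast
      then show ?thesis using p(2)[OF that] Bsym[of v w] Bsym[of v w1] Bsym[of v p] by simp
    qed
    have Bw: "?B w w > 0"
    proof -
      have "0 < c k w * c k w" using ckw by (simp add: zero_less_mult_iff) (meson linorder_neqE_linordered_idom)
      moreover have "0 \<le> (\<Sum>k\<in>K. c k w * c k w)" by (intro sum_nonneg) simp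
      ultimately show ?thesis using insert.hyps by simp
    qed
    define z where "z = (\<lambda>x. z0 x + (f w / ?B w w) * w x)"
    have zV: "z \<in> V" unfolding z_def using z0 wV V0V by (intro fun_subspaceD(2)[OF sub]) auto
    have "?B z v = f v" if v: "v \<in> V" for v
    proof -
      define a where "a = c k v / c k w"
      define v0 where "v0 = (\<lambda>x. v x + (- a) * w x)"
      have v0: "v0 \<in> V0"
        using lin[of k v w "- a"] v wV ckw fun_subspaceD(2)[OF sub v wV, of "- a"]
        unfolding V0_def v0_def a_def by simp
      have v_eq: "v = (\<lambda>x. v0 x + a * w x)" by (auto simp: v0_def)
      have v0V: "v0 \<in> V" using v0 V0V by blast
      have "?B z v = ?B v z0 + (f w / ?B w w) * ?B v w"
        unfolding Bsym[of z v] unfolding z_def using Badd z0 wV V0V by blast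
      also have "?B v z0 = f v0"
      proof -
        have "?B z0 v = ?B z0 v0 + a * ?B z0 w" by (subst v_eq, rule Badd[OF v0V wV])
        then show ?thesis using z0 v0 orth[of z0] Bsym[of z0 w] Bsym[of z0 v] by simp
      qed
      also have "?B v w = a * ?B w w"
      proof -
        have "?B w v = ?B w v0 + a * ?B w w" by (subst v_eq, rule Badd[OF v0V wV])
        then show ?thesis using orth[OF v0] Bsym[of w v] by simp
      qed
      also have "f v0 + f w / ?B w w * (a * ?B w w) = f v0 + a * f w" using Bw by simp
      also have "\<dots> = f v" by (subst v_eq) (simp add: fun_linearD[OF lf v0V wV])
      finally show ?thesis .
    qed
    then show ?thesis using zV by blast
  qed
qed

text \<open>The energy is a sum of squares of finitely many functionals, the coordinates of
  \<open>D v t\<close> scaled by \<open>sqrt (m t)\<close>, as \<open>riesz_exists\<close> requires.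
  Uniqueness: the difference of two solutions, tested with itself, has zero energy.\<close>

lemma riesz_ex1:
  fixes D :: "('x \<Rightarrow> real) \<Rightarrow> 't \<Rightarrow> 'b::euclidean_space"
  assumes fin: "finite \<T>" and m: "\<And>t. t \<in> \<T> \<Longrightarrow> 0 < m t"
    and sub: "fun_subspace V" and lD: "\<And>t. t \<in> \<T> \<Longrightarrow> fun_linear V (\<lambda>v. D v t)" and lf: "fun_linear V f"
    and inj: "\<And>v. v \<in> V \<Longrightarrow> (\<And>t. t \<in> \<T> \<Longrightarrow> D v t = 0) \<Longrightarrow> v = (\<lambda>_. 0)"
  shows "\<exists>!z. z \<in> V \<and> (\<forall>v\<in>V. (\<Sum>t\<in>\<T>. m t * (D z t \<bullet> D v t)) = f v)"
proof -
  define c where "c = (\<lambda>(t, i) v. sqrt (m t) * (D v t \<bullet> i))"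
  have B: "(\<Sum>k\<in>\<T> \<times> Basis. c k u * c k v) = (\<Sum>t\<in>\<T>. m t * (D u t \<bullet> D v t))" for u v
  proof -
    have "(\<Sum>k\<in>\<T> \<times> Basis. c k u * c k v) = (\<Sum>t\<in>\<T>. \<Sum>i\<in>Basis. m t * ((D u t \<bullet> i) * (D v t \<bullet> i)))"
      unfolding sum.cartesian_product
      using m by (intro sum.cong refl) (auto simp: c_def less_imp_le real_sqrt_mult_self algebra_simps)
    then show ?thesis by (simp add: sum_distrib_left[symmetric] euclidean_inner[symmetric])
  qed
  have "\<exists>z\<in>V. \<forall>v\<in>V. (\<Sum>k\<in>\<T> \<times> Basis. c k z * c k v) = f v"
  proof (rule riesz_exists[OF _ sub _ lf])
    show "finite (\<T> \<times> (Basis :: 'b set))" using fin by simp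
    fix k :: "'t \<times> 'b" assume "k \<in> \<T> \<times> Basis"
    then show "fun_linear V (c k)"
      using lD by (auto simp: c_def fun_linear_def inner_add_left algebra_simps)
  next
    fix v assume v: "v \<in> V" and z: "\<And>k. k \<in> \<T> \<times> Basis \<Longrightarrow> c k v = 0"
    show "v = (\<lambda>_. 0)"
    proof (rule inj[OF v])
      fix t assume t: "t \<in> \<T>"
      show "D v t = 0"
      proof (rule euclidean_eqI)
        fix i :: 'b assume "i \<in> Basis"
        then have "c (t, i) v = 0" using z t by blast
        then show "D v t \<bullet> i = 0 \<bullet> i" using m[OF t] by (simp add: c_def)
      qed
    qed
  qed
  then obtain z where z: "z \<in> V" "\<And>v. v \<in> V \<Longrightarrow> (\<Sum>t\<in>\<T>. m t * (D z t \<bullet> D v t)) = f v"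
    unfolding B by blast
  show ?thesis
  proof (rule ex1I[of _ z])
    fix y assume y: "y \<in> V \<and> (\<forall>v\<in>V. (\<Sum>t\<in>\<T>. m t * (D y t \<bullet> D v t)) = f v)"
    define w where "w = (\<lambda>x. y x - z x)"
    have w: "w \<in> V" unfolding w_def using y z sub by (intro fun_subspace_diff) auto
    have "(\<Sum>t\<in>\<T>. m t * (D w t \<bullet> D w t)) = (\<Sum>t\<in>\<T>. m t * (D y t \<bullet> D w t) - m t * (D z t \<bullet> D w t))"
    proof (intro sum.cong refl)
      fix t assume "t \<in> \<T>"
      then have "D w t = D y t - D z t" unfolding w_def using fun_linear_diff[OF lD] y z by blast
      then show "m t * (D w t \<bullet> D w t) = m t * (D y t \<bullet> D w t) - m t * (D z t \<bullet> D w t)"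
        by (metis inner_diff_left right_diff_distrib)
    qed
    also have "\<dots> = 0" using y z w by (simp add: sum_subtractf)
    finally have "m t * (D w t \<bullet> D w t) = 0" if "t \<in> \<T>" for t
      using sum_nonneg_eq_0_iff[OF fin, of "\<lambda>t. m t * (D w t \<bullet> D w t)"] m that by (simp add: less_imp_le)
    then have "D w t = 0" if "t \<in> \<T>" for t using m that by fastforce
    then have "w = (\<lambda>_. 0)" using inj w by blast
    then show "y = z" unfolding w_def by (metis eq_iff_diff_eq_0 ext)
  qed (use z in blast)
qed

text \<open>The quotient is homogeneous of degree 0, so it is enough to maximise it over the unit
  sphere, which is compact.\<close>

lemma quadratic_ratio_attains_max:
  fixes A :: "'t \<Rightarrow> 't \<Rightarrow> 'b::euclidean_space" and m :: "'t \<Rightarrow> real"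
  assumes fin: "finite W" and ne: "W \<noteq> {}" and m: "\<And>t. t \<in> W \<Longrightarrow> 0 < m t"
  defines "Q \<equiv> \<lambda>c. \<Sum>t\<in>W. m t * (norm (\<Sum>s\<in>W. c s *\<^sub>R A s t))\<^sup>2"
    and "N \<equiv> \<lambda>c. \<Sum>t\<in>W. m t * (c t)\<^sup>2"
  obtains c where "\<exists>t\<in>W. c t \<noteq> (0::real)" "\<And>c'. \<exists>t\<in>W. c' t \<noteq> 0 \<Longrightarrow> Q c' / N c' \<le> Q c / N c"
proof -
  \<comment> \<open>Coordinates outside \<open>W\<close> are pinned to 0, so that the sphere sits
    inside a compact product even when the index type is infinite.\<close>
  define E where "E = (\<Pi>\<^sub>E t\<in>UNIV. if t \<in> W then {-1..1::real} else {0})"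
  define K where "K = E \<inter> {c. (\<Sum>t\<in>W. (c t)\<^sup>2) = 1}"
  have Npos: "0 < N c" if "\<exists>t\<in>W. c t \<noteq> 0" for c
  proof -
    from that obtain t where "t \<in> W" "c t \<noteq> 0" by blast
    then show ?thesis
      unfolding N_def using m fin by (intro sum_pos2[of W t]) (auto simp: less_imp_le)
  qed
  have cont_coord: "continuous_on S (\<lambda>c::'t \<Rightarrow> real. c t)" for S t
    by (rule continuous_on_subset[OF continuous_on_product_coordinates]) simp
  have "compact E"
    using compactin_PiE[of "\<lambda>_. euclidean" UNIV "\<lambda>t. if t \<in> W then {-1..1::real} else {0}"]
    by (simp add: E_def euclidean_product_topology)
  moreover have "closed {c::'t \<Rightarrow> real. (\<Sum>t\<in>W. (c t)\<^sup>2) = 1}"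
    by (intro closed_Collect_eq continuous_intros cont_coord)
  ultimately have K: "compact K" unfolding K_def by (rule compact_Int_closed)
  have Knz: "\<exists>t\<in>W. c t \<noteq> 0" if "c \<in> K" for c
  proof (rule ccontr)
    assume "\<not> ?thesis"
    then have "(\<Sum>t\<in>W. (c t)\<^sup>2) = 0" by simp
    then show False using that by (simp add: K_def)
  qed
  define r where "r c = sqrt (\<Sum>t\<in>W. (c t)\<^sup>2)" for c :: "'t \<Rightarrow> real"
  define nz where "nz c t = (if t \<in> W then c t / r c else 0)" for c t
  have nz: "nz c \<in> K \<and> Q (nz c) / N (nz c) = Q c / N c" if c: "\<exists>t\<in>W. c t \<noteq> 0" for c
  proof -
    from c obtain t0 where "t0 \<in> W" "c t0 \<noteq> 0" by blast
    then have "0 < (\<Sum>t\<in>W. (c t)\<^sup>2)" using fin by (intro sum_pos2[of W t0]) auto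
    then have r: "0 < r c" "(r c)\<^sup>2 = (\<Sum>t\<in>W. (c t)\<^sup>2)" by (auto simp: r_def)
    have s1: "(\<Sum>t\<in>W. (nz c t)\<^sup>2) = 1"
    proof -
      have "(\<Sum>t\<in>W. (nz c t)\<^sup>2) = (\<Sum>t\<in>W. (c t)\<^sup>2) / (r c)\<^sup>2"
        by (simp add: nz_def power_divide sum_divide_distrib)
      then show ?thesis unfolding r(2)[symmetric] using r(1) by simp
    qed
    have "- 1 \<le> nz c t \<and> nz c t \<le> 1" if "t \<in> W" for t
    proof -
      have "(nz c t)\<^sup>2 \<le> (\<Sum>t\<in>W. (nz c t)\<^sup>2)" using fin that by (intro member_le_sum) auto
      then show ?thesis using s1 abs_square_le_1[of "nz c t"] by (simp add: abs_le_iff)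
    qed
    then have "nz c t \<in> (if t \<in> W then {-1..1} else {0})" for t
      by (cases "t \<in> W") (simp_all, simp add: nz_def)
    then have "nz c \<in> E" unfolding E_def PiE_UNIV_domain by (simp only: Pi_iff) blast
    then have "nz c \<in> K" using s1 by (simp add: K_def)
    moreover have "Q (nz c) = Q c / (r c)\<^sup>2"
    proof -
      have "(\<Sum>s\<in>W. nz c s *\<^sub>R A s t) = (1 / r c) *\<^sub>R (\<Sum>s\<in>W. c s *\<^sub>R A s t)" for t
        by (simp add: nz_def scaleR_sum_right)
      then show ?thesis using r by (simp add: Q_def power_mult_distrib power_divide sum_divide_distrib)
    qed
    moreover have "N (nz c) = N c / (r c)\<^sup>2"
      by (simp add: N_def nz_def power_divide sum_divide_distrib)
    ultimately show ?thesis using r(1) by simp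
  qed
  have "K \<noteq> {}" using nz[of "\<lambda>_. 1"] ne by auto
  moreover have "continuous_on K (\<lambda>c. Q c / N c)"
  proof (intro continuous_on_divide ballI)
    show "continuous_on K Q" "continuous_on K N"
      unfolding Q_def N_def by (intro continuous_intros cont_coord)+
    show "N c \<noteq> 0" if "c \<in> K" for c using Npos[OF Knz[OF that]] by simp
  qed
  ultimately have "\<exists>c\<in>K. \<forall>y\<in>K. Q y / N y \<le> Q c / N c"
    by (rule continuous_attains_sup[OF K])
  then obtain c where c: "c \<in> K" "\<forall>y\<in>K. Q y / N y \<le> Q c / N c"
    by (rule bexE)
  show ?thesis
  proof (rule that[OF Knz[OF c(1)]])
    fix c' :: "'t \<Rightarrow> real" assume "\<exists>t\<in>W. c' t \<noteq> 0"
    then show "Q c' / N c' \<le> Q c / N c" using nz[of c'] bspec[OF c(2), of "nz c'"] by simp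
  qed
qed

section \<open>Calculus of elementwise affine functions\<close>

lemma gradient_eq:
  assumes "GDERIV f x :> D" shows "gradient f x = D"
  unfolding gradient_def
proof (rule the_equality)
  show "GDERIV f x :> D" by (rule assms)
next
  fix E assume "GDERIV f x :> E"
  then have "(\<bullet>) E = (\<bullet>) D" using assms unfolding gderiv_def
    by (metis (no_types, lifting) has_derivative_unique inner_commute ext)
  then show "E = D" by (metis inner_commute vector_eq_rdot)
qed

lemma gradient_affine:
  assumes "open U" "x \<in> U" "\<And>y. y \<in> U \<Longrightarrow> f y = a \<bullet> y + b"
  shows "gradient f x = a"
proof (rule gradient_eq)
  have "((\<lambda>y. a \<bullet> y + b) has_derivative (\<lambda>h. h \<bullet> a)) (at x)"
    by (auto intro!: derivative_eq_intros simp: inner_commute)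
  then show "GDERIV f x :> a"
    unfolding gderiv_def using assms by (auto intro: has_derivative_transform_within_open)
qed

context mesh begin

text \<open>Elementwise constants, in particular gradients of elementwise affine functions, are
  recorded by their value at one sample point per element.\<close>

definition "pt T = (SOME x. x \<in> interior T)"
definition "vol T = measure lebesgue (interior T)"

lemma pt: "T \<in> \<T> \<Longrightarrow> pt T \<in> interior T"
  unfolding pt_def using interior_element_nonempty by (simp add: some_in_eq)

lemma vol_pos: "T \<in> \<T> \<Longrightarrow> 0 < vol T"
proof -
  assume T: "T \<in> \<T>"
  have "interior T \<in> lmeasurable"
    using compact_imp_bounded[OF compact_element[OF T]] bounded_subset interior_subset
    by (metis lmeasurable_interior)
  moreover have "\<not> negligible (interior T)"
    using open_not_negligible[OF open_interior interior_element_nonempty[OF T]] .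
  ultimately show ?thesis unfolding vol_def by (simp add: negligible_iff_measure zero_less_measure_iff)
qed

definition "offset v T = v (pt T) - gradient v (pt T) \<bullet> pt T"

lemma
  assumes "v \<in> P1 \<T>" "T \<in> \<T>" "x \<in> interior T"
  shows P1_affine: "v x = gradient v (pt T) \<bullet> x + offset v T"
    and gradient_P1: "gradient v x = gradient v (pt T)"
proof -
  obtain a b where ab: "\<And>x. x \<in> interior T \<Longrightarrow> v x = a \<bullet> x + b"
    using assms(1,2) unfolding P1_def by blast
  have gr: "gradient v y = a" if "y \<in> interior T" for y
    using gradient_affine[OF open_interior that ab] by simp
  show "gradient v x = gradient v (pt T)" using gr pt[OF assms(2)] assms(3) by simp
  show "v x = gradient v (pt T) \<bullet> x + offset v T"
    using ab[OF assms(3)] ab[OF pt[OF assms(2)]] gr[OF pt[OF assms(2)]] by (simp add: offset_def)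
qed

lemma P1_zero: "v \<in> P1 \<T> \<Longrightarrow> x \<notin> \<Union>(interior ` \<T>) \<Longrightarrow> v x = 0"
  unfolding P1_def by blast

lemma P0_P1: "g \<in> P0 \<T> \<Longrightarrow> g \<in> P1 \<T>"
  unfolding P0_def P1_def constant_on_def by simp (metis inner_zero_left add.left_neutral)

lemma P0_eq: "g \<in> P0 \<T> \<Longrightarrow> T \<in> \<T> \<Longrightarrow> x \<in> interior T \<Longrightarrow> g x = g (pt T)"
  using pt unfolding P0_def constant_on_def by fastforce

lemma fun_subspace_P1: "fun_subspace (P1 \<T>)"
  unfolding fun_subspace_def
proof (intro conjI ballI allI)
  show "(\<lambda>_. 0) \<in> P1 \<T>" unfolding P1_def by (auto intro!: exI[of _ 0])
next
  fix u v and c :: real assume uv: "u \<in> P1 \<T>" "v \<in> P1 \<T>"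
  have "\<exists>a b. \<forall>x\<in>interior T. u x + c * v x = a \<bullet> x + b" if T: "T \<in> \<T>" for T
  proof -
    obtain a b a' b' where "\<forall>x\<in>interior T. u x = a \<bullet> x + b" "\<forall>x\<in>interior T. v x = a' \<bullet> x + b'"
      using uv T unfolding P1_def by blast
    then have "\<forall>x\<in>interior T. u x + c * v x = (a + c *\<^sub>R a') \<bullet> x + (b + c * b')"
      by (simp add: inner_add_left algebra_simps)
    then show ?thesis by blast
  qed
  then show "(\<lambda>x. u x + c * v x) \<in> P1 \<T>" using uv unfolding P1_def by simp
qed

lemma fun_linear_gradient_pt:
  assumes "T \<in> \<T>" shows "fun_linear (P1 \<T>) (\<lambda>v. gradient v (pt T))"
  unfolding fun_linear_def
proof (intro ballI allI)
  fix u v and c :: real assume uv: "u \<in> P1 \<T>" "v \<in> P1 \<T>"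
  show "gradient (\<lambda>x. u x + c * v x) (pt T) = gradient u (pt T) + c *\<^sub>R gradient v (pt T)"
    by (rule gradient_affine[OF open_interior pt[OF assms], where b = "offset u T + c * offset v T"])
      (simp add: P1_affine[OF uv(1) assms] P1_affine[OF uv(2) assms] inner_add_left algebra_simps)
qed

lemma broken_gradient_eq: "v \<in> P1 \<T> \<Longrightarrow> T \<in> \<T> \<Longrightarrow> x \<in> interior T \<Longrightarrow> broken_gradient \<T> v x = gradient v (pt T)"
  unfolding broken_gradient_def using gradient_P1 by auto

lemma broken_gradient_off: "x \<notin> \<Union>(interior ` \<T>) \<Longrightarrow> broken_gradient \<T> v x = 0"
  unfolding broken_gradient_def by simp

lemma P1_gradient_zero:
  assumes "v \<in> P1 \<T>" "\<And>T. T \<in> \<T> \<Longrightarrow> gradient v (pt T) = 0" shows "v \<in> P0 \<T>"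
  unfolding P0_def
proof (intro CollectI conjI ballI allI impI)
  fix T assume T: "T \<in> \<T>"
  show "v constant_on interior T"
    using P1_affine[OF assms(1) T] assms(2)[OF T] unfolding constant_on_def by auto
qed (use P1_zero assms in blast)

text \<open>Because \<open>f\<close> vanishes pointwise off the element interiors, it is exactly a
  finite sum of disjointly supported pieces. \<open>h T\<close> is a formula for \<open>f\<close> on
  the element, typically continuous on the whole space, from which integrability follows.\<close>

lemma integral_elements:
  fixes f :: "'a \<Rightarrow> real"
  assumes off: "\<And>x. x \<notin> \<Union>(interior ` \<T>) \<Longrightarrow> f x = 0"
    and eq: "\<And>T x. T \<in> \<T> \<Longrightarrow> x \<in> interior T \<Longrightarrow> f x = h T x"
    and inth: "\<And>T. T \<in> \<T> \<Longrightarrow> integrable (lebesgue_on (interior T)) (h T)"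
  shows "(LINT x|lebesgue_on \<Omega>. f x) = (\<Sum>T\<in>\<T>. LINT x|lebesgue_on (interior T). h T x)"
proof -
  have int: "integrable (lebesgue_on (interior T)) f" if "T \<in> \<T>" for T
    using inth[OF that] eq[OF that]
    by (subst Bochner_Integration.integrable_cong[OF refl, of _ f "h T"]) auto
  have ind: "indicator \<Omega> x *\<^sub>R f x = (\<Sum>T\<in>\<T>. indicator (interior T) x *\<^sub>R f x)" for x
  proof (cases "x \<in> \<Union>(interior ` \<T>)")
    case True
    then obtain T where T: "T \<in> \<T>" "x \<in> interior T" by blast
    have "indicator (interior T') x *\<^sub>R f x = 0" if "T' \<in> \<T> - {T}" for T'
      using interior_disjoint[OF T(1) _ T(2), of T'] that by (auto simp: indicator_def)
    then have "(\<Sum>T'\<in>\<T> - {T}. indicator (interior T') x *\<^sub>R f x) = 0" by (intro sum.neutral ballI)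
    then have "(\<Sum>T'\<in>\<T>. indicator (interior T') x *\<^sub>R f x) = indicator (interior T) x *\<^sub>R f x"
      by (simp only: sum.remove[OF finite_\<T> T(1)] add_0_right)
    moreover have "x \<in> \<Omega>" using T interior_element_subset by blast
    ultimately show ?thesis using T(2) by simp
  qed (simp add: off)
  have int': "integrable lebesgue (\<lambda>x. indicator (interior T) x *\<^sub>R f x)" if "T \<in> \<T>" for T
    using int[OF that] by (subst (asm) integrable_restrict_space) auto
  have "(LINT x|lebesgue_on \<Omega>. f x) = (LINT x|lebesgue. indicator \<Omega> x *\<^sub>R f x)"
    using open_\<Omega> by (intro integral_restrict_space) auto
  also have "\<dots> = (\<Sum>T\<in>\<T>. LINT x|lebesgue. indicator (interior T) x *\<^sub>R f x)"
    unfolding ind by (intro Bochner_Integration.integral_sum int')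
  also have "\<dots> = (\<Sum>T\<in>\<T>. LINT x|lebesgue_on (interior T). f x)"
    by (intro sum.cong refl integral_restrict_space[symmetric]) auto
  also have "\<dots> = (\<Sum>T\<in>\<T>. LINT x|lebesgue_on (interior T). h T x)"
    using eq by (intro sum.cong refl Bochner_Integration.integral_cong) auto
  finally show ?thesis .
qed

text \<open>Passes from the open element under Lebesgue measure, where the finite element functions
  live, to the closed simplex under \<open>lborel\<close>, where the moments were computed. The two
  sets differ inside the frontier of a convex set, which is negligible.\<close>

lemma integral_interior_element:
  fixes f :: "'a \<Rightarrow> real"
  assumes T: "T \<in> \<T>" and cont: "continuous_on UNIV f"
  shows "integrable (lebesgue_on (interior T)) f"
    and "(LINT x|lebesgue_on (interior T). f x) = (LINT x|lborel. indicator T x * f x)"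
proof -
  have int: "integrable lborel (\<lambda>x. indicator T x *\<^sub>R f x)"
    using borel_integrable_compact[OF compact_element[OF T], of f] cont continuous_on_subset by blast
  have [measurable]: "T \<in> sets borel" "f \<in> borel_measurable borel"
    using compact_element[OF T] compact_imp_closed borel_closed borel_measurable_continuous_onI[OF cont] by blast+
  have "negligible (frontier T)" using negligible_convex_frontier[OF convex_element[OF T]] .
  then have "AE x in lebesgue. x \<notin> frontier T" by (auto simp: negligible_iff_null_sets AE_not_in)
  then have ae: "AE x in lebesgue. indicator T x *\<^sub>R f x = indicator (interior T) x *\<^sub>R f x"
  proof eventually_elim
    case (elim x)
    have "x \<in> T \<longleftrightarrow> x \<in> interior T"
      using elim interior_subset[of T] closure_subset[of T] by (auto simp: frontier_def)
    then show ?case by (simp add: indicator_def)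
  qed
  have int': "integrable lebesgue (\<lambda>x. indicator T x *\<^sub>R f x)"
    using int by (simp add: integrable_completion)
  have int'': "integrable lebesgue (\<lambda>x. indicator (interior T) x *\<^sub>R f x)"
    by (rule integrable_cong_AE_imp[OF int']) (use ae in \<open>auto intro: measurable_completion\<close>)
  then show "integrable (lebesgue_on (interior T)) f"
    by (subst integrable_restrict_space) auto
  have "(LINT x|lebesgue_on (interior T). f x) = (LINT x|lebesgue. indicator (interior T) x *\<^sub>R f x)"
    by (intro integral_restrict_space) auto
  also have "\<dots> = (LINT x|lebesgue. indicator T x *\<^sub>R f x)"
    using int' int'' ae by (intro integral_cong_AE) auto
  also have "\<dots> = (LINT x|lborel. indicator T x *\<^sub>R f x)"
    by (intro integral_completion) measurable
  finally show "(LINT x|lebesgue_on (interior T). f x) = (LINT x|lborel. indicator T x * f x)" by simp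
qed

lemma vol_eq: "T \<in> \<T> \<Longrightarrow> (LINT x|lborel. indicator T x * 1) = vol T"
  using integral_interior_element(2)[of T "\<lambda>_. 1"] by (simp add: vol_def measure_restrict_space)

lemma integrable_P1: "v \<in> P1 \<T> \<Longrightarrow> T \<in> \<T> \<Longrightarrow> integrable (lebesgue_on (interior T)) v"
proof -
  assume v: "v \<in> P1 \<T>" and T: "T \<in> \<T>"
  have "integrable (lebesgue_on (interior T)) (\<lambda>x. gradient v (pt T) \<bullet> x + offset v T)"
    by (intro integral_interior_element(1)[OF T] continuous_intros)
  then show ?thesis
    by (subst Bochner_Integration.integrable_cong[OF refl, of _ v "\<lambda>x. gradient v (pt T) \<bullet> x + offset v T"])
      (auto simp: P1_affine[OF v T])
qed

lemma L2_inner_piecewise_constant: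
  assumes "\<And>x. x \<notin> \<Union>(interior ` \<T>) \<Longrightarrow> G x = 0"
    and G: "\<And>T x. T \<in> \<T> \<Longrightarrow> x \<in> interior T \<Longrightarrow> G x = G' T"
    and H: "\<And>T x. T \<in> \<T> \<Longrightarrow> x \<in> interior T \<Longrightarrow> H x = H' T"
  shows "L2_inner \<Omega> G H = (\<Sum>T\<in>\<T>. vol T * (G' T \<bullet> H' T))"
proof -
  have "L2_inner \<Omega> G H = (\<Sum>T\<in>\<T>. LINT x|lebesgue_on (interior T). G' T \<bullet> H' T)"
    unfolding L2_inner_def
    by (intro integral_elements integral_interior_element(1) continuous_intros) (simp_all add: assms)
  then show ?thesis by (simp add: vol_def measure_restrict_space)
qed

lemma L2_inner_broken_gradient:
  assumes "u \<in> P1 \<T>" "v \<in> P1 \<T>"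
  shows "L2_inner \<Omega> (broken_gradient \<T> u) (broken_gradient \<T> v) =
    (\<Sum>T\<in>\<T>. vol T * (gradient u (pt T) \<bullet> gradient v (pt T)))"
  by (intro L2_inner_piecewise_constant broken_gradient_off broken_gradient_eq assms) auto

lemma L2_norm_P0:
  assumes "g \<in> P0 \<T>" shows "(L2_norm \<Omega> g)\<^sup>2 = (\<Sum>T\<in>\<T>. vol T * (g (pt T))\<^sup>2)"
    and "g \<noteq> (\<lambda>_. 0) \<Longrightarrow> 0 < L2_norm \<Omega> g"
proof -
  have eq: "L2_inner \<Omega> g g = (\<Sum>T\<in>\<T>. vol T * (g (pt T))\<^sup>2)"
    using L2_inner_piecewise_constant[of g "\<lambda>T. g (pt T)" g "\<lambda>T. g (pt T)"] P0_eq[OF assms] P1_zero[OF P0_P1[OF assms]]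
    by (simp add: power2_eq_square)
  have nn: "0 \<le> vol T * (g (pt T))\<^sup>2" if "T \<in> \<T>" for T using vol_pos[OF that] by simp
  show "(L2_norm \<Omega> g)\<^sup>2 = (\<Sum>T\<in>\<T>. vol T * (g (pt T))\<^sup>2)"
    unfolding L2_norm_def eq using nn by (simp add: sum_nonneg)
  assume "g \<noteq> (\<lambda>_. 0)"
  then obtain x where "g x \<noteq> 0" by blast
  then obtain T where T: "T \<in> \<T>" "x \<in> interior T" using P1_zero[OF P0_P1[OF assms], of x] by blast
  then have "g (pt T) \<noteq> 0" using P0_eq[OF assms, of T x] \<open>g x \<noteq> 0\<close> by simp
  then have "0 < vol T * (g (pt T))\<^sup>2" using vol_pos[OF T(1)] by simp
  then have "0 < (\<Sum>T\<in>\<T>. vol T * (g (pt T))\<^sup>2)"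
    using nn T finite_\<T> by (intro sum_pos2[of _ T]) auto
  then show "0 < L2_norm \<Omega> g" unfolding L2_norm_def eq by simp
qed

lemma L2_inner_P0_P1:
  assumes g: "g \<in> P0 \<T>" and v: "v \<in> P1 \<T>"
  shows "L2_inner \<Omega> g v = (\<Sum>T\<in>\<T>. g (pt T) * (LINT x|lebesgue_on (interior T). v x))"
proof -
  have "L2_inner \<Omega> g v = (\<Sum>T\<in>\<T>. LINT x|lebesgue_on (interior T). g (pt T) * v x)"
    unfolding L2_inner_def
    by (rule integral_elements) (simp_all add: P1_zero[OF P0_P1[OF g]] P0_eq[OF g] integrable_P1[OF v])
  then show ?thesis by simp
qed

lemma fun_linear_L2_inner_P0:
  assumes g: "g \<in> P0 \<T>" shows "fun_linear (P1 \<T>) (L2_inner \<Omega> g)"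
  unfolding fun_linear_def
proof (intro ballI allI)
  fix u v and a :: real assume uv: "u \<in> P1 \<T>" "v \<in> P1 \<T>"
  have w: "(\<lambda>x. u x + a * v x) \<in> P1 \<T>" using fun_subspaceD(2)[OF fun_subspace_P1 uv] .
  show "L2_inner \<Omega> g (\<lambda>x. u x + a * v x) = L2_inner \<Omega> g u + a *\<^sub>R L2_inner \<Omega> g v"
    unfolding L2_inner_P0_P1[OF g w] L2_inner_P0_P1[OF g uv(1)] L2_inner_P0_P1[OF g uv(2)]
    using integrable_P1 uv
    by (simp add: sum_distrib_left flip: sum.distrib) (auto intro!: sum.cong simp: algebra_simps)
qed

end

section \<open>The Crouzeix--Raviart space\<close>

lemma integrable_lebesgue_on_compact:
  fixes f :: "'a::euclidean_space \<Rightarrow> real"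
  assumes "compact S" "continuous_on S f" shows "integrable (lebesgue_on S) f"
proof -
  have "integrable lborel (\<lambda>x. indicator S x *\<^sub>R f x)" using borel_integrable_compact assms by blast
  then have "integrable lebesgue (\<lambda>x. indicator S x *\<^sub>R f x)" by (simp add: integrable_completion)
  then show ?thesis
    using lmeasurable_compact[OF assms(1)] by (subst integrable_restrict_space) (auto simp: fmeasurableD)
qed

lemma full_dim_convex_not_negligible:
  fixes S :: "'a::euclidean_space set"
  assumes "convex S" "S \<noteq> {}" "aff_dim S = int DIM('a)" shows "\<not> negligible S"
  using assms by (simp add: negligible_convex_interior interior_rel_interior_gen rel_interior_eq_empty)

section \<open>Prisms over facets and face integrals\<close>

abbreviation prism :: "'a::euclidean_space set \<Rightarrow> 'a set" where
  "prism F \<equiv> {y + t *\<^sub>R unit_normal F | y t. y \<in> F \<and> 0 \<le> t \<and> t \<le> 1}"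

context mesh begin

lemma facet_props:
  assumes "T \<in> \<T>" "F facet_of T"
  shows "F \<subseteq> T" "convex F" "compact F" "F \<noteq> {}" "aff_dim F = int DIM('a) - 1"
proof -
  have "F face_of T" using assms(2) by (rule facet_of_imp_face_of)
  then show "F \<subseteq> T" by (rule face_of_imp_subset)
  show "convex F" using \<open>F face_of T\<close> by (rule face_of_imp_convex)
  show "compact F"
    using face_of_imp_compact[OF convex_element compact_element, OF assms(1) assms(1) \<open>F face_of T\<close>] .
  show "F \<noteq> {}" "aff_dim F = int DIM('a) - 1"
    using assms(2) aff_dim_element[OF assms(1)] by (auto simp: facet_of_def)
qed

lemma unit_normal:
  assumes "T \<in> \<T>" "F facet_of T"
  shows "norm (unit_normal F) = 1" and "x \<in> F \<Longrightarrow> y \<in> F \<Longrightarrow> unit_normal F \<bullet> (x - y) = 0"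
proof -
  have "aff_dim F = int (DIM('a) - 1)"
    using facet_props(5)[OF assms] by (simp add: of_nat_diff Suc_leI)
  then have "\<exists>a b. a \<noteq> 0 \<and> affine hull F = {x. a \<bullet> x = b}"
    by (rule aff_dim_eq_hyperplane[THEN iffD1])
  then obtain a b where ab: "a \<noteq> 0" "affine hull F = {x. a \<bullet> x = b}"
    by (elim exE conjE)
  have "a \<bullet> x = b" if "x \<in> F" for x
    using hull_inc[OF that, of affine] unfolding ab(2) by simp
  then have "norm (a /\<^sub>R norm a) = 1 \<and> (\<forall>x\<in>F. \<forall>y\<in>F. (a /\<^sub>R norm a) \<bullet> (x - y) = 0)"
    using ab(1) by (simp add: inner_diff_right)
  then have "norm (unit_normal F) = 1 \<and> (\<forall>x\<in>F. \<forall>y\<in>F. unit_normal F \<bullet> (x - y) = 0)"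
    unfolding unit_normal_def by (rule someI)
  then show "norm (unit_normal F) = 1" "x \<in> F \<Longrightarrow> y \<in> F \<Longrightarrow> unit_normal F \<bullet> (x - y) = 0" by blast+
qed

text \<open>Displacement along the normal is orthogonal to the affine hull of \<open>F\<close>, so
  by Pythagoras the nearest point of the hull is the foot \<open>y\<close>. Hence
  \<open>face_integral F f\<close> sees \<open>f\<close> only on \<open>F\<close>.\<close>

lemma closest_point_prism:
  assumes TF: "T \<in> \<T>" "F facet_of T" and y: "y \<in> F"
  shows "closest_point (affine hull F) (y + t *\<^sub>R unit_normal F) = y"
proof -
  let ?n = "unit_normal F"
  have n: "?n \<bullet> z = ?n \<bullet> y" if "z \<in> affine hull F" for z
  proof -
    have "F \<subseteq> {z. ?n \<bullet> z = ?n \<bullet> y}"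
      using unit_normal(2)[OF TF _ y] by (auto simp: inner_diff_right)
    then have "affine hull F \<subseteq> {z. ?n \<bullet> z = ?n \<bullet> y}"
      by (intro hull_minimal) (auto simp: affine_hyperplane)
    then show ?thesis using that by blast
  qed
  have "dist (y + t *\<^sub>R ?n) y \<le> dist (y + t *\<^sub>R ?n) z" if "z \<in> affine hull F" for z
  proof -
    have "?n \<bullet> (y - z) = 0" using n[OF that] by (simp add: inner_diff_right)
    then have "(y - z) \<bullet> ?n = 0" by (simp add: inner_commute)
    then have "(norm (y - z + t *\<^sub>R ?n))\<^sup>2 = (norm (y - z))\<^sup>2 + (norm (t *\<^sub>R ?n))\<^sup>2"
      by (intro norm_add_Pythagorean) (simp add: orthogonal_def)
    then have "(norm (t *\<^sub>R ?n))\<^sup>2 \<le> (norm (y - z + t *\<^sub>R ?n))\<^sup>2" by simp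
    then have "norm (t *\<^sub>R ?n) \<le> norm (y - z + t *\<^sub>R ?n)" by (rule power2_le_imp_le) simp
    then show ?thesis by (simp add: dist_norm algebra_simps)
  qed
  then show ?thesis
    using hull_inc[OF y, of affine]
    by (intro closest_point_unique[symmetric]) (auto simp: affine_imp_convex)
qed

lemma prism_image: "prism F = (\<lambda>(y, t). y + t *\<^sub>R unit_normal F) ` (F \<times> {0..1})"
  by (auto simp: image_iff) (metis atLeastAtMost_iff)+

lemma compact_prism:
  assumes "T \<in> \<T>" "F facet_of T" shows "compact (prism F)"
  unfolding prism_image using facet_props(3)[OF assms]
  by (intro compact_continuous_image compact_Times) (auto simp: split_def intro!: continuous_intros)

text \<open>The prism is convex and contains \<open>F\<close> together with
  \<open>y + unit_normal F\<close>, a point off the hyperplane of \<open>F\<close>, so it has full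
  dimension. Positivity lets a vanishing face integral of a constant force that constant to be
  zero.\<close>

lemma measure_prism_pos:
  assumes TF: "T \<in> \<T>" "F facet_of T" shows "0 < measure lebesgue (prism F)"
proof -
  let ?n = "unit_normal F"
  obtain y where y: "y \<in> F" using facet_props(4)[OF TF] by blast
  have "y + ?n \<notin> affine hull F"
  proof
    assume "y + ?n \<in> affine hull F"
    then have "closest_point (affine hull F) (y + 1 *\<^sub>R ?n) = y + ?n" by (simp add: closest_point_self)
    then have "?n = 0" using closest_point_prism[OF TF y, of 1] by simp
    then show False using unit_normal(1)[OF TF] by simp
  qed
  then have "aff_dim (insert (y + ?n) F) = int DIM('a)"
    using facet_props(5)[OF TF] by (simp add: aff_dim_insert)
  moreover have sub: "insert (y + ?n) F \<subseteq> prism F"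
  proof -
    have "y + ?n = y + 1 *\<^sub>R ?n" "\<And>z. z = z + 0 *\<^sub>R ?n" by simp_all
    then show ?thesis using y by (smt (verit, best) insertE mem_Collect_eq subsetI)
  qed
  ultimately have dim: "aff_dim (prism F) = int DIM('a)"
    using aff_dim_subset[of "insert (y + ?n) F" "prism F"] aff_dim_le_DIM[of "prism F"] by linarith
  have conv: "convex (prism F)"
    unfolding prism_image using facet_props(2)[OF TF]
    by (intro convex_linear_image convex_Times) (auto simp: linear_iff algebra_simps)
  have "prism F \<noteq> {}" using sub by (metis insert_not_empty subset_empty)
  then have "\<not> negligible (prism F)" using conv dim by (intro full_dim_convex_not_negligible)
  then show ?thesis
    using lmeasurable_compact[OF compact_prism[OF TF]] by (simp add: negligible_iff_measure zero_less_measure_iff)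
qed

lemma face_integral_cong:
  assumes TF: "T \<in> \<T>" "F facet_of T" and eq: "\<And>y. y \<in> F \<Longrightarrow> f y = g y"
  shows "face_integral F f = face_integral F g"
  unfolding face_integral_def
proof (rule Bochner_Integration.integral_cong[OF refl])
  fix x assume "x \<in> space (lebesgue_on (prism F))"
  then have "x \<in> prism F" by simp
  then obtain y t where "x = y + t *\<^sub>R unit_normal F" "y \<in> F" by blast
  then show "f (closest_point (affine hull F) x) = g (closest_point (affine hull F) x)"
    using closest_point_prism[OF TF] eq by simp
qed

lemma face_integral_linear:
  assumes TF: "T \<in> \<T>" "F facet_of T" and cont: "continuous_on UNIV f" "continuous_on UNIV g"
  shows "face_integral F (\<lambda>x. f x + c * g x) = face_integral F f + c * face_integral F g"
proof -
  have "continuous_on (prism F) (closest_point (affine hull F))"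
    using facet_props(4)[OF TF]
    by (intro continuous_on_closest_point) (auto simp: affine_imp_convex)
  then have int: "integrable (lebesgue_on (prism F)) (\<lambda>x. h (closest_point (affine hull F) x))"
    if "continuous_on UNIV h" for h :: "'a \<Rightarrow> real"
    by (intro integrable_lebesgue_on_compact compact_prism[OF TF] continuous_on_compose2[OF that]) auto
  show ?thesis
    unfolding face_integral_def using int[OF cont(1)] int[OF cont(2)] by simp
qed

lemma face_integral_const:
  "face_integral F (\<lambda>_. c) = c * measure lebesgue (prism F)" if "T \<in> \<T>" "F facet_of T"
  using lmeasurable_compact[OF compact_prism[OF that]]
  by (simp add: face_integral_def measure_restrict_space fmeasurableD)

text \<open>The affine function that \<open>v\<close> equals on the interior of \<open>T\<close>,
  continued to the whole space. Being continuous everywhere, it can replace traces inside face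
  integrals.\<close>

definition "ext v T x = gradient v (pt T) \<bullet> x + offset v T"

lemma fun_linear_ext: "T \<in> \<T> \<Longrightarrow> fun_linear (P1 \<T>) (\<lambda>v. ext v T x)"
  using fun_linearD[OF fun_linear_gradient_pt]
  by (simp add: fun_linear_def ext_def offset_def inner_add_left inner_diff_left algebra_simps)

lemma continuous_ext: "continuous_on S (ext v T)"
  unfolding ext_def by (intro continuous_intros)

text \<open>Every point of \<open>T\<close> is a limit point of its interior, so the limit defining
  the trace exists and is that of the affine continuation.\<close>

lemma trace_from_eq:
  assumes v: "v \<in> P1 \<T>" and T: "T \<in> \<T>" and x: "x \<in> T"
  shows "trace_from T v x = ext v T x"
  unfolding trace_from_def
proof (rule tendsto_Lim)
  have "x islimpt interior T"
  proof (cases "x \<in> interior T")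
    case True
    then show ?thesis by (simp add: interior_limit_point interior_interior)
  next
    case False
    then show ?thesis using element_subset_closure[OF T] x by (auto simp: closure_def)
  qed
  then show "\<not> trivial_limit (at x within interior T)" by (simp add: trivial_limit_within)
  have "(ext v T \<longlongrightarrow> ext v T x) (at x within interior T)"
    using continuous_ext[of UNIV v T] by (simp add: continuous_on_eq_continuous_at isCont_def Lim_at_imp_Lim_at_within)
  moreover have "\<forall>\<^sub>F y in at x within interior T. ext v T y = v y"
    using P1_affine[OF v T] by (auto simp: eventually_at_filter ext_def)
  ultimately show "(v \<longlongrightarrow> ext v T x) (at x within interior T)" by (rule Lim_transform_eventually)
qed

lemma ext_P0: "v \<in> P0 \<T> \<Longrightarrow> T \<in> \<T> \<Longrightarrow> ext v T x = v (pt T)"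
  using gradient_affine[OF open_interior pt, of T v 0 "v (pt T)"] P0_eq[of v T]
  by (simp add: ext_def offset_def)

lemma fun_linear_face_integral_trace:
  assumes T: "T \<in> \<T>" "F facet_of T"
  shows "fun_linear (P1 \<T>) (\<lambda>v. face_integral F (trace_from T v))"
  unfolding fun_linear_def
proof (intro ballI allI)
  fix u v and a :: real assume uv: "u \<in> P1 \<T>" "v \<in> P1 \<T>"
  have w: "(\<lambda>x. u x + a * v x) \<in> P1 \<T>" using fun_subspaceD(2)[OF fun_subspace_P1 uv] .
  have eq: "face_integral F (trace_from T f) = face_integral F (ext f T)" if "f \<in> P1 \<T>" for f
    using trace_from_eq[OF that T(1)] facet_props(1)[OF T] by (intro face_integral_cong[OF T]) auto
  have "ext (\<lambda>x. u x + a * v x) T = (\<lambda>x. ext u T x + a * ext v T x)"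
    using fun_linearD[OF fun_linear_ext[OF T(1)] uv] by auto
  then show "face_integral F (trace_from T (\<lambda>x. u x + a * v x)) =
      face_integral F (trace_from T u) + a *\<^sub>R face_integral F (trace_from T v)"
    unfolding eq[OF w] eq[OF uv(1)] eq[OF uv(2)] using face_integral_linear[OF T continuous_ext continuous_ext] by simp
qed

lemma face_integral_jump:
  assumes T: "T \<in> \<T>" "F facet_of T" "T' \<in> \<T>" "F facet_of T'" and v: "v \<in> P1 \<T>"
  shows "face_integral F (\<lambda>x. trace_from T v x - trace_from T' v x) =
    face_integral F (trace_from T v) - face_integral F (trace_from T' v)"
proof -
  have "face_integral F (\<lambda>x. trace_from T v x - trace_from T' v x) = face_integral F (\<lambda>x. ext v T x + (-1) * ext v T' x)"
    using trace_from_eq[OF v T(1)] trace_from_eq[OF v T(3)] facet_props(1)[OF T(1,2)] facet_props(1)[OF T(3,4)]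
    by (intro face_integral_cong[OF T(1,2)]) (simp add: subset_iff)
  also have "\<dots> = face_integral F (ext v T) + (-1) * face_integral F (ext v T')"
    by (rule face_integral_linear[OF T(1,2) continuous_ext continuous_ext])
  also have "face_integral F (ext v T) = face_integral F (trace_from T v)"
    using trace_from_eq[OF v T(1)] facet_props(1)[OF T(1,2)] by (intro face_integral_cong[OF T(1,2)]) auto
  also have "face_integral F (ext v T') = face_integral F (trace_from T' v)"
    using trace_from_eq[OF v T(3)] facet_props(1)[OF T(3,4)] by (intro face_integral_cong[OF T(1,2)]) auto
  finally show ?thesis by simp
qed

text \<open>Each jump integral separates into two trace integrals, both linear in \<open>v\<close>,
  so the defining conditions become linear equations.\<close>

lemma V_CR_eq:
  "V_CR \<Omega> \<T> = {v \<in> P1 \<T>.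
     (\<forall>F. \<forall>T\<in>\<T>. \<forall>T'\<in>\<T>. T \<noteq> T' \<and> F facet_of T \<and> F facet_of T' \<longrightarrow>
        face_integral F (trace_from T v) = face_integral F (trace_from T' v)) \<and>
     (\<forall>F. \<forall>T\<in>\<T>. F facet_of T \<and> F \<subseteq> frontier \<Omega> \<longrightarrow> face_integral F (trace_from T v) = 0)}"
proof -
  have jump: "(face_integral F (\<lambda>x. trace_from T v x - trace_from T' v x) = 0) =
      (face_integral F (trace_from T v) = face_integral F (trace_from T' v))"
    if "v \<in> P1 \<T>" "T \<in> \<T>" "T' \<in> \<T>" "F facet_of T" "F facet_of T'" for v F T T'
    using face_integral_jump[of T F T' v] that by simp
  show ?thesis unfolding V_CR_def
    by (intro Collect_cong conj_cong[OF refl] conj_cong[OF _ refl] iff_allI ball_cong refl imp_cong jump) auto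
qed

lemma V_CR_P1: "V_CR \<Omega> \<T> \<subseteq> P1 \<T>"
  unfolding V_CR_def by blast

lemma fun_subspace_V_CR: "fun_subspace (V_CR \<Omega> \<T>)"
  unfolding fun_subspace_def
proof (intro conjI ballI allI)
  show "(\<lambda>_. 0) \<in> V_CR \<Omega> \<T>"
    unfolding V_CR_eq using fun_subspaceD(1)[OF fun_subspace_P1]
      fun_linear_zero[OF fun_subspace_P1 fun_linear_face_integral_trace] by simp
next
  fix u v and a :: real assume uv: "u \<in> V_CR \<Omega> \<T>" "v \<in> V_CR \<Omega> \<T>"
  then have P: "u \<in> P1 \<T>" "v \<in> P1 \<T>" using V_CR_P1 by auto
  show "(\<lambda>x. u x + a * v x) \<in> V_CR \<Omega> \<T>"
    using uv fun_subspaceD(2)[OF fun_subspace_P1 P]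
      fun_linearD[OF fun_linear_face_integral_trace P]
    unfolding V_CR_eq by simp
qed

lemma V_CR_inj:
  assumes v: "v \<in> V_CR \<Omega> \<T>" and g0: "\<And>T. T \<in> \<T> \<Longrightarrow> gradient v (pt T) = 0"
  shows "v = (\<lambda>_. 0)"
proof (rule ccontr)
  assume "v \<noteq> (\<lambda>_. 0)"
  then obtain x where x: "v x \<noteq> 0" by blast
  have vP1: "v \<in> P1 \<T>" using v V_CR_P1 by blast
  have vP0: "v \<in> P0 \<T>" using P1_gradient_zero[OF vP1 g0] .
  define c where "c = v x"
  obtain T0 where T0: "T0 \<in> \<T>" "x \<in> interior T0" using P1_zero[OF vP1, of x] x by blast
  define \<S> where "\<S> = {T \<in> \<T>. v (pt T) = c}"
  have "T0 \<in> \<S>" using T0 P0_eq[OF vP0 T0] by (simp add: \<S>_def c_def)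
  \<comment> \<open>Constant traces integrate to the element value times a positive measure, so
    conditions on face integrals become conditions on the values.\<close>
  have tr: "face_integral F (trace_from T v) = v (pt T) * measure lebesgue (prism F)"
    if T: "T \<in> \<T>" "F facet_of T" for T F
  proof -
    have "face_integral F (trace_from T v) = face_integral F (\<lambda>_. v (pt T))"
      using trace_from_eq[OF vP1 T(1)] facet_props(1)[OF T] ext_P0[OF vP0 T(1)]
      by (intro face_integral_cong[OF T]) auto
    then show ?thesis using face_integral_const[OF T] by simp
  qed
  show False
  proof (rule no_facet_closed_submesh)
    show "\<S> \<subseteq> \<T>" "\<S> \<noteq> {}" using \<open>T0 \<in> \<S>\<close> by (auto simp: \<S>_def)
    fix T w assume "T \<in> \<S>" and w: "w \<in> verts T"
    then have T: "T \<in> \<T>" "v (pt T) = c" by (auto simp: \<S>_def)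
    let ?F = "convex hull (verts T - {w})"
    have F: "?F facet_of T" by (rule facet_vertex[OF T(1) w])
    have pos: "0 < measure lebesgue (prism ?F)" by (rule measure_prism_pos[OF T(1) F])
    have "\<not> ?F \<subseteq> frontier \<Omega>"
    proof
      assume "?F \<subseteq> frontier \<Omega>"
      then have "face_integral ?F (trace_from T v) = 0" using v T(1) F unfolding V_CR_eq by blast
      then show False using tr[OF T(1) F] pos T(2) x c_def by simp
    qed
    then obtain T' where T': "T' \<in> \<T>" "T' \<noteq> T" "?F facet_of T'"
      using shared_facet[OF T(1) w] by blast
    then have "face_integral ?F (trace_from T v) = face_integral ?F (trace_from T' v)"
      using v T(1) F unfolding V_CR_eq by blast
    then have "v (pt T') = c" using tr[OF T(1) F] tr[OF T'(1) T'(3)] pos T(2) by simp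
    then show "\<exists>T'\<in>\<S>. T' \<noteq> T \<and> ?F facet_of T'" using T' by (auto simp: \<S>_def)
  qed
qed

end

section \<open>Test functions and the conforming space\<close>

text \<open>The squared positive part is the building block of \<open>cutoff\<close>: it is
  differentiable across the kink, where the difference quotient is at most
  \<open>\<bar>h\<bar>\<close> in modulus.\<close>

lemma DERIV_max_0_power2: "((\<lambda>y::real. (max 0 y)\<^sup>2) has_real_derivative 2 * max 0 y) (at y)"
proof (cases y "0::real" rule: linorder_cases)
  case less
  have "((\<lambda>y::real. 0) has_real_derivative 2 * max 0 y) (at y)" using less by simp
  then show ?thesis
    by (rule has_field_derivative_transform_within_open[of _ _ _ "{..<0}"]) (use less in \<open>auto simp: max_def\<close>)
next
  case greater
  have "((\<lambda>y::real. y\<^sup>2) has_real_derivative 2 * max 0 y) (at y)"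
    using greater by (auto intro!: derivative_eq_intros)
  then show ?thesis
    by (rule has_field_derivative_transform_within_open[of _ _ _ "{0<..}"]) (use greater in \<open>auto simp: max_def\<close>)
next
  case equal
  have "((\<lambda>h::real. ((max 0 (0 + h))\<^sup>2 - (max 0 0)\<^sup>2) / h) \<longlongrightarrow> 0) (at 0)"
  proof (rule Lim_null_comparison)
    show "\<forall>\<^sub>F h::real in at 0. norm (((max 0 (0 + h))\<^sup>2 - (max 0 0)\<^sup>2) / h) \<le> \<bar>h\<bar>"
      by (intro always_eventually) (auto simp: max_def power2_eq_square)
    show "((\<lambda>h::real. \<bar>h\<bar>) \<longlongrightarrow> 0) (at 0)" by (intro tendsto_eq_intros) auto
  qed
  then show ?thesis unfolding DERIV_def using equal by simp
qed

lemma differentiable_GDERIV: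
  fixes f :: "'a::euclidean_space \<Rightarrow> real"
  assumes "f differentiable (at x)" shows "GDERIV f x :> gradient f x"
proof -
  obtain D where D: "(f has_derivative D) (at x)" using assms by (auto simp: differentiable_def)
  define g where "g = (\<Sum>i\<in>Basis. D i *\<^sub>R i)"
  interpret D: bounded_linear D using D by (rule has_derivative_bounded_linear)
  have "D h = h \<bullet> g" for h
  proof -
    have "D h = D (\<Sum>i\<in>Basis. (h \<bullet> i) *\<^sub>R i)" by (simp add: euclidean_representation)
    also have "\<dots> = (\<Sum>i\<in>Basis. (h \<bullet> i) * D i)" by (simp add: D.sum D.scaleR)
    finally show ?thesis by (simp add: g_def inner_sum_right mult.commute)
  qed
  then have "D = (\<lambda>h. h \<bullet> g)" by auto
  then have "GDERIV f x :> g" using D by (simp add: gderiv_def)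
  then show ?thesis using gradient_eq by metis
qed

lemma gradient_linear:
  fixes u v :: "'a::euclidean_space \<Rightarrow> real"
  assumes "u differentiable (at x)" "v differentiable (at x)"
  shows "gradient (\<lambda>x. u x + a * v x) x = gradient u x + a *\<^sub>R gradient v x"
  using GDERIV_add[OF differentiable_GDERIV[OF assms(1)] GDERIV_mult[OF GDERIV_const[of a] differentiable_GDERIV[OF assms(2)]]]
  by (intro gradient_eq) simp

lemma C_k_linear: "C_k k u \<Longrightarrow> C_k k v \<Longrightarrow> C_k k (\<lambda>x. u x + a * v x)"
proof (induction k arbitrary: u v)
  case 0
  then show ?case by (auto intro!: continuous_intros)
next
  case (Suc k)
  have "gradient (\<lambda>x. u x + a * v x) = (\<lambda>x. gradient u x + a *\<^sub>R gradient v x)"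
    using Suc.prems by (intro ext gradient_linear) auto
  moreover have "C_k k (\<lambda>x. gradient u x \<bullet> i + a * (gradient v x \<bullet> i))" if "i \<in> Basis" for i
    using Suc that by auto
  ultimately show ?case using Suc.prems by (auto simp: inner_add_left)
qed

lemma C_k_const_zero: "C_k k (\<lambda>_. 0)"
proof (induction k)
  case (Suc k)
  have "gradient (\<lambda>_. 0) x = 0" for x :: 'a using GDERIV_const by (rule gradient_eq)
  then show ?case using Suc by simp
qed simp

lemma test_function_props:
  fixes \<phi> :: "'a::euclidean_space \<Rightarrow> real"
  assumes "test_function \<Omega> \<phi>"
  shows "\<phi> differentiable (at x)" "continuous_on UNIV \<phi>" "continuous_on UNIV (gradient \<phi>)"
    "compact (closure {x. \<phi> x \<noteq> 0})" "closure {x. \<phi> x \<noteq> 0} \<subseteq> \<Omega>"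
proof -
  have C: "C_k k \<phi>" for k using assms by (simp add: test_function_def)
  show "\<phi> differentiable (at x)" using C[of "Suc 0"] by simp
  show "continuous_on UNIV \<phi>" using C[of 0] by simp
  have "continuous_on UNIV (\<lambda>x. gradient \<phi> x \<bullet> i)" if "i \<in> Basis" for i
    using C[of "Suc 0"] that by simp
  then show "continuous_on UNIV (gradient \<phi>)" by (subst continuous_on_componentwise) blast
  show "compact (closure {x. \<phi> x \<noteq> 0})" "closure {x. \<phi> x \<noteq> 0} \<subseteq> \<Omega>"
    using assms by (auto simp: test_function_def)
qed

lemma test_function_linear:
  assumes u: "test_function \<Omega> u" and v: "test_function \<Omega> v"
  shows "test_function \<Omega> (\<lambda>x. u x + a * v x)"
proof -
  have "{x. u x + a * v x \<noteq> 0} \<subseteq> {x. u x \<noteq> 0} \<union> {x. v x \<noteq> 0}" by auto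
  then have sub: "closure {x. u x + a * v x \<noteq> 0} \<subseteq> closure {x. u x \<noteq> 0} \<union> closure {x. v x \<noteq> 0}"
    unfolding closure_Un[symmetric] by (rule closure_mono)
  have "compact (closure {x. u x + a * v x \<noteq> 0})"
    using compact_Int_closed[OF compact_Un[OF test_function_props(4)[OF u] test_function_props(4)[OF v]] closed_closure, of "{x. u x + a * v x \<noteq> 0}"]
      sub by (simp add: Int_absorb1)
  then show ?thesis
    using sub test_function_props(5)[OF u] test_function_props(5)[OF v] u v C_k_linear
    unfolding test_function_def by blast
qed

lemma test_function_zero: "test_function \<Omega> (\<lambda>_. 0)"
  by (simp add: test_function_def C_k_const_zero)

text \<open>Difference quotients integrate to zero by translation invariance.\<close>

lemma integral_directional_derivative:
  fixes f :: "'a::euclidean_space \<Rightarrow> real"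
  assumes der: "\<And>x. GDERIV f x :> g x" and cont: "continuous_on UNIV g"
    and S: "compact S" and off: "\<And>x. x \<notin> S \<Longrightarrow> f x = 0" and e: "norm e = 1"
  shows "(LINT x|lborel. g x \<bullet> e) = 0"
proof -
  have contf: "continuous_on UNIV f"
    using der by (intro continuous_at_imp_continuous_on ballI) (auto simp: gderiv_def intro: has_derivative_continuous)
  obtain R where R: "\<And>x. x \<in> S \<Longrightarrow> norm x \<le> R" "0 < R"
    using compact_imp_bounded[OF S] bounded_pos by metis
  \<comment> \<open>The extra 1 in the radius leaves room for steps of length at most 1, so that all
    difference quotients below vanish outside \<open>B\<close>.\<close>
  define B where "B = cball (0::'a) (R + 1)"
  have off': "f x = 0" if "R < norm x" for x using off R(1)[of x] that by auto
  have cB: "compact B" by (simp add: B_def)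
  obtain K where K: "\<And>x. x \<in> B \<Longrightarrow> norm (g x) \<le> K"
    using compact_imp_bounded[OF compact_continuous_image[OF continuous_on_subset[OF cont] cB]]
    unfolding bounded_iff by auto
  have g0: "g x = 0" if "R < norm x" for x
  proof -
    have "open {x::'a. R < norm x}" by (intro open_Collect_less continuous_intros)
    then have "gradient f x = 0"
      using that off' by (intro gradient_affine[of "{x. R < norm x}" x f 0 0]) auto
    then show ?thesis using gradient_eq[OF der] by metis
  qed
  have Kg: "norm (g x) \<le> K" for x
    using K[of x] order_trans[OF norm_ge_zero[of "g 0"] K[of 0]] g0[of x] R(2)
    by (cases "x \<in> B") (auto simp: B_def)
  have line: "((\<lambda>s. f (x + s *\<^sub>R e)) has_real_derivative g (x + s *\<^sub>R e) \<bullet> e) (at s)" for x s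
  proof -
    have "((\<lambda>s. x + s *\<^sub>R e) has_derivative (\<lambda>h. h *\<^sub>R e)) (at s)" by (auto intro!: derivative_eq_intros)
    from has_derivative_compose[OF this der[of "x + s *\<^sub>R e", unfolded gderiv_def]]
    show ?thesis by (simp add: has_field_derivative_def inner_commute mult_commute_abs)
  qed
  have [measurable]: "f \<in> borel_measurable borel" using contf borel_measurable_continuous_onI by blast
  have [measurable]: "(\<lambda>x. g x \<bullet> e) \<in> borel_measurable borel"
    by (intro borel_measurable_continuous_onI continuous_intros cont)
  have intf: "integrable lborel f"
  proof -
    have "integrable lborel (\<lambda>x. indicator B x *\<^sub>R f x)"
      using borel_integrable_compact[OF cB] contf continuous_on_subset by blast
    moreover have "indicator B x *\<^sub>R f x = f x" for x using off'[of x] by (auto simp: indicator_def B_def)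
    ultimately show ?thesis by (simp only:)
  qed
  \<comment> \<open>Difference quotients along \<open>e\<close> with step
    \<open>1 / real (Suc n)\<close>; each integrates to zero, and the mean value theorem bounds it
    by \<open>K\<close>.\<close>
  define D where "D n x = (f (x + (1 / real (Suc n)) *\<^sub>R e) - f x) * real (Suc n)" for n x
  have shift: "integrable lborel (\<lambda>x. f (x + c)) \<and> (LINT x|lborel. f (x + c)) = (LINT x|lborel. f x)" for c
  proof -
    have "integrable (distr lborel borel (\<lambda>x. c + x)) f" using intf by (simp add: lborel_distr_plus)
    then have "integrable lborel (\<lambda>x. f (c + x))" by (subst (asm) integrable_distr_eq) auto
    moreover have "(LINT x|lborel. f x) = (LINT x|lborel. f (c + x))"
      by (subst (1) lborel_distr_plus[of c, symmetric], subst integral_distr) auto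
    ultimately show ?thesis by (simp add: add.commute)
  qed
  have D0: "(LINT x|lborel. D n x) = 0" for n
    unfolding D_def using shift[of "(1 / real (Suc n)) *\<^sub>R e"] intf by (simp del: of_nat_Suc)
  have "(\<lambda>n. LINT x|lborel. D n x) \<longlonglongrightarrow> (LINT x|lborel. g x \<bullet> e)"
  proof (rule integral_dominated_convergence[where w = "\<lambda>x. indicator (cball (0::'a) (R + 1)) x *\<^sub>R K"])
    show "integrable lborel (\<lambda>x. indicator (cball (0::'a) (R + 1)) x *\<^sub>R K)"
      by (intro borel_integrable_compact continuous_intros) auto
    show "AE x in lborel. (\<lambda>n. D n x) \<longlonglongrightarrow> g x \<bullet> e"
    proof (intro AE_I2)
      fix x
      have "((\<lambda>h. (f (x + h *\<^sub>R e) - f x) / h) \<longlongrightarrow> g x \<bullet> e) (at 0)"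
        using line[of x 0] by (simp add: DERIV_def)
      moreover have "filterlim (\<lambda>n. 1 / real (Suc n)) (at 0) sequentially"
        using LIMSEQ_inverse_real_of_nat by (simp add: filterlim_at inverse_eq_divide del: of_nat_Suc)
      ultimately have "(\<lambda>n. (f (x + (1 / real (Suc n)) *\<^sub>R e) - f x) / (1 / real (Suc n))) \<longlonglongrightarrow> g x \<bullet> e"
        by (rule filterlim_compose)
      then show "(\<lambda>n. D n x) \<longlonglongrightarrow> g x \<bullet> e" by (simp add: D_def del: of_nat_Suc)
    qed
    fix n
    show "AE x in lborel. norm (D n x) \<le> indicator (cball (0::'a) (R + 1)) x *\<^sub>R K"
    proof (intro AE_I2)
      fix x
      let ?h = "1 / real (Suc n)"
      have h: "0 < ?h" "?h \<le> 1" by auto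
      show "norm (D n x) \<le> indicator (cball (0::'a) (R + 1)) x *\<^sub>R K"
      proof (cases "x \<in> cball 0 (R + 1)")
        case True
        obtain z where "f (x + ?h *\<^sub>R e) - f (x + 0 *\<^sub>R e) = (?h - 0) * (g (x + z *\<^sub>R e) \<bullet> e)"
          using MVT2[OF h(1), of "\<lambda>s. f (x + s *\<^sub>R e)" "\<lambda>s. g (x + s *\<^sub>R e) \<bullet> e"] line by blast
        then have "D n x = g (x + z *\<^sub>R e) \<bullet> e" by (simp add: D_def del: of_nat_Suc)
        moreover have "\<bar>g (x + z *\<^sub>R e) \<bullet> e\<bar> \<le> K"
          using Cauchy_Schwarz_ineq2[of "g (x + z *\<^sub>R e)" e] Kg[of "x + z *\<^sub>R e"] e by simp
        ultimately show ?thesis using True by simp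
      next
        case False
        then have "R + 1 < norm x" by simp
        moreover have "norm x \<le> norm (x + ?h *\<^sub>R e) + ?h"
          using norm_triangle_ineq4[of "x + ?h *\<^sub>R e" "?h *\<^sub>R e"] e h by simp
        ultimately have "R < norm (x + ?h *\<^sub>R e)" "R < norm x" using h(2) by linarith+
        then have "f (x + ?h *\<^sub>R e) = 0" "f x = 0" by (simp_all only: off')
        then show ?thesis using False by (simp add: D_def)
      qed
    qed
  qed (auto simp: D_def)
  then show ?thesis by (simp only: D0 LIMSEQ_const_iff)
qed

section \<open>Elementary L2 estimates\<close>

lemma L2_norm_power2:
  "(L2_norm \<Omega> f)\<^sup>2 = (LINT x|lebesgue_on \<Omega>. (norm (f x))\<^sup>2)"
  unfolding L2_norm_def L2_inner_def by (simp add: dot_square_norm)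

text \<open>Applied under the integral, this takes the place of the triangle inequality for
  \<open>L2_norm\<close>.\<close>

lemma norm_add_scaleR_power2_le:
  fixes u v :: "'b::real_normed_vector"
  shows "(norm (u + a *\<^sub>R v))\<^sup>2 \<le> 2 * (norm u)\<^sup>2 + 2 * a\<^sup>2 * (norm v)\<^sup>2"
proof -
  have "(norm (u + a *\<^sub>R v))\<^sup>2 \<le> (norm u + \<bar>a\<bar> * norm v)\<^sup>2"
    using norm_triangle_ineq[of u "a *\<^sub>R v"] by (intro power_mono) auto
  also have "\<dots> \<le> 2 * (norm u)\<^sup>2 + 2 * (\<bar>a\<bar> * norm v)\<^sup>2"
    using zero_le_power2[of "norm u - \<bar>a\<bar> * norm v"] by (simp add: power2_diff power2_sum)
  finally show ?thesis by (simp add: power_mult_distrib)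
qed

lemma L2_fun_linear:
  fixes f g :: "'a::euclidean_space \<Rightarrow> 'b::euclidean_space"
  assumes f: "L2_fun \<Omega> f" and g: "L2_fun \<Omega> g"
  shows "L2_fun \<Omega> (\<lambda>x. f x + a *\<^sub>R g x)"
    and "(L2_norm \<Omega> (\<lambda>x. f x + a *\<^sub>R g x))\<^sup>2 \<le> 2 * (L2_norm \<Omega> f)\<^sup>2 + 2 * a\<^sup>2 * (L2_norm \<Omega> g)\<^sup>2"
proof -
  have [measurable]: "f \<in> borel_measurable (lebesgue_on \<Omega>)" "g \<in> borel_measurable (lebesgue_on \<Omega>)"
    using f g by (auto simp: L2_fun_def)
  have int: "integrable (lebesgue_on \<Omega>) (\<lambda>x. 2 * (norm (f x))\<^sup>2 + 2 * a\<^sup>2 * (norm (g x))\<^sup>2)"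
    using f g by (auto simp: L2_fun_def)
  have int': "integrable (lebesgue_on \<Omega>) (\<lambda>x. (norm (f x + a *\<^sub>R g x))\<^sup>2)"
    by (rule Bochner_Integration.integrable_bound[OF int])
      (auto intro!: AE_I2 order_trans[OF norm_add_scaleR_power2_le])
  then show "L2_fun \<Omega> (\<lambda>x. f x + a *\<^sub>R g x)" by (simp add: L2_fun_def)
  have "(L2_norm \<Omega> (\<lambda>x. f x + a *\<^sub>R g x))\<^sup>2 \<le> (LINT x|lebesgue_on \<Omega>. 2 * (norm (f x))\<^sup>2 + 2 * a\<^sup>2 * (norm (g x))\<^sup>2)"
    unfolding L2_norm_power2 by (intro integral_mono int int' norm_add_scaleR_power2_le)
  also have "\<dots> = 2 * (L2_norm \<Omega> f)\<^sup>2 + 2 * a\<^sup>2 * (L2_norm \<Omega> g)\<^sup>2"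
    unfolding L2_norm_power2 using f g by (simp add: L2_fun_def)
  finally show "(L2_norm \<Omega> (\<lambda>x. f x + a *\<^sub>R g x))\<^sup>2 \<le> 2 * (L2_norm \<Omega> f)\<^sup>2 + 2 * a\<^sup>2 * (L2_norm \<Omega> g)\<^sup>2" .
qed

lemma L2_norm_tendsto_linear:
  fixes f g :: "nat \<Rightarrow> 'a::euclidean_space \<Rightarrow> 'b::euclidean_space"
  assumes "\<And>n. L2_fun \<Omega> (f n)" "\<And>n. L2_fun \<Omega> (g n)"
    and lim: "(\<lambda>n. L2_norm \<Omega> (f n)) \<longlonglongrightarrow> 0" "(\<lambda>n. L2_norm \<Omega> (g n)) \<longlonglongrightarrow> 0"
  shows "(\<lambda>n. L2_norm \<Omega> (\<lambda>x. f n x + a *\<^sub>R g n x)) \<longlonglongrightarrow> 0"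
proof -
  have "(\<lambda>n. 2 * (L2_norm \<Omega> (f n))\<^sup>2 + 2 * a\<^sup>2 * (L2_norm \<Omega> (g n))\<^sup>2) \<longlonglongrightarrow> 2 * 0\<^sup>2 + 2 * a\<^sup>2 * 0\<^sup>2"
    by (intro tendsto_intros lim)
  then have "(\<lambda>n. sqrt (2 * (L2_norm \<Omega> (f n))\<^sup>2 + 2 * a\<^sup>2 * (L2_norm \<Omega> (g n))\<^sup>2)) \<longlonglongrightarrow> sqrt 0"
    by (intro tendsto_real_sqrt) simp
  then have lim0: "(\<lambda>n. sqrt (2 * (L2_norm \<Omega> (f n))\<^sup>2 + 2 * a\<^sup>2 * (L2_norm \<Omega> (g n))\<^sup>2)) \<longlonglongrightarrow> 0"
    by simp
  have "norm (L2_norm \<Omega> (\<lambda>x. f n x + a *\<^sub>R g n x)) \<le> sqrt (2 * (L2_norm \<Omega> (f n))\<^sup>2 + 2 * a\<^sup>2 * (L2_norm \<Omega> (g n))\<^sup>2)" for n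
    using real_sqrt_le_mono[OF L2_fun_linear(2)[OF assms(1)[of n] assms(2)[of n], of a]] by simp
  then show ?thesis by (rule Lim_null_comparison[OF always_eventually[OF allI] lim0])
qed

lemma integrable_L2_scaleR:
  fixes u :: "'a::euclidean_space \<Rightarrow> real" and g :: "'a \<Rightarrow> 'b::euclidean_space"
  assumes u: "L2_fun \<Omega> u" and g: "L2_fun \<Omega> g"
  shows "integrable (lebesgue_on \<Omega>) (\<lambda>x. u x *\<^sub>R g x)"
proof -
  have [measurable]: "u \<in> borel_measurable (lebesgue_on \<Omega>)" "g \<in> borel_measurable (lebesgue_on \<Omega>)"
    using u g by (auto simp: L2_fun_def)
  have int: "integrable (lebesgue_on \<Omega>) (\<lambda>x. (norm (u x))\<^sup>2 + (norm (g x))\<^sup>2)"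
    using u g by (auto simp: L2_fun_def)
  have "\<bar>a\<bar> * b \<le> a\<^sup>2 + b\<^sup>2" for a b :: real
  proof -
    have "2 * (\<bar>a\<bar> * b) \<le> a\<^sup>2 + b\<^sup>2"
      using zero_le_power2[of "\<bar>a\<bar> - b"] by (simp add: power2_diff)
    then show ?thesis using zero_le_power2[of a] zero_le_power2[of b] by linarith
  qed
  then show ?thesis
    by (intro Bochner_Integration.integrable_bound[OF int]) (auto intro!: AE_I2)
qed

section \<open>Linear structure of \<open>H10\<close> and of the conforming space\<close>

context mesh begin

lemma integrable_continuous_\<Omega>:
  fixes f :: "'a \<Rightarrow> real"
  assumes "continuous_on UNIV f" shows "integrable (lebesgue_on \<Omega>) f"
proof -
  have "continuous_on (closure \<Omega>) f" using assms continuous_on_subset by blast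
  then have "integrable (lebesgue_on (closure \<Omega>)) f"
    using bounded_\<Omega> by (intro integrable_lebesgue_on_compact) (auto simp: compact_closure)
  then have "integrable lebesgue (\<lambda>x. indicator (closure \<Omega>) x *\<^sub>R f x)"
    by (subst (asm) integrable_restrict_space) auto
  then have "integrable lebesgue (\<lambda>x. indicator \<Omega> x *\<^sub>R (indicator (closure \<Omega>) x *\<^sub>R f x))"
    by (rule integrable_mult_indicator[rotated]) (use open_\<Omega> in auto)
  moreover have "indicator \<Omega> x *\<^sub>R (indicator (closure \<Omega>) x *\<^sub>R f x) = indicator \<Omega> x *\<^sub>R f x" for x
    using closure_subset[of \<Omega>] by (auto simp: indicator_def)
  ultimately have "integrable lebesgue (\<lambda>x. indicator \<Omega> x *\<^sub>R f x)" by (simp only:)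
  then show ?thesis using open_\<Omega> by (subst integrable_restrict_space) auto
qed

lemma L2_fun_continuous:
  fixes f :: "'a \<Rightarrow> 'b::euclidean_space"
  assumes "continuous_on UNIV f" shows "L2_fun \<Omega> f"
proof -
  have "f \<in> borel_measurable lebesgue"
    using borel_measurable_continuous_onI[OF assms] by (intro measurable_completion) simp
  then show ?thesis
    unfolding L2_fun_def
    by (intro conjI measurable_restrict_space1 integrable_continuous_\<Omega> continuous_intros assms)
qed

lemma weak_gradient_linear:
  assumes u: "L2_fun \<Omega> u" "L2_fun \<Omega> G" "weak_gradient \<Omega> u G"
    and v: "L2_fun \<Omega> v" "L2_fun \<Omega> H" "weak_gradient \<Omega> v H"
  shows "weak_gradient \<Omega> (\<lambda>x. u x + a * v x) (\<lambda>x. G x + a *\<^sub>R H x)"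
  unfolding weak_gradient_def
proof (intro allI impI)
  fix \<phi> assume \<phi>: "test_function \<Omega> \<phi>"
  have L2: "L2_fun \<Omega> \<phi>" "L2_fun \<Omega> (gradient \<phi>)"
    using L2_fun_continuous test_function_props(2,3)[OF \<phi>] by blast+
  have "(LINT x|lebesgue_on \<Omega>. (u x + a * v x) *\<^sub>R gradient \<phi> x) =
      (LINT x|lebesgue_on \<Omega>. u x *\<^sub>R gradient \<phi> x + a *\<^sub>R (v x *\<^sub>R gradient \<phi> x))"
    by (simp add: scaleR_add_left)
  also have "\<dots> = (LINT x|lebesgue_on \<Omega>. u x *\<^sub>R gradient \<phi> x) + a *\<^sub>R (LINT x|lebesgue_on \<Omega>. v x *\<^sub>R gradient \<phi> x)"
    using integrable_L2_scaleR[OF u(1) L2(2)] integrable_L2_scaleR[OF v(1) L2(2)] by (simp del: scaleR_scaleR)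
  also have "\<dots> = - ((LINT x|lebesgue_on \<Omega>. \<phi> x *\<^sub>R G x) + a *\<^sub>R (LINT x|lebesgue_on \<Omega>. \<phi> x *\<^sub>R H x))"
    using u(3) v(3) \<phi> by (simp add: weak_gradient_def)
  also have "(LINT x|lebesgue_on \<Omega>. \<phi> x *\<^sub>R G x) + a *\<^sub>R (LINT x|lebesgue_on \<Omega>. \<phi> x *\<^sub>R H x) =
      (LINT x|lebesgue_on \<Omega>. \<phi> x *\<^sub>R G x + a *\<^sub>R (\<phi> x *\<^sub>R H x))"
    using integrable_L2_scaleR[OF L2(1) u(2)] integrable_L2_scaleR[OF L2(1) v(2)] by (simp del: scaleR_scaleR)
  also have "\<dots> = (LINT x|lebesgue_on \<Omega>. \<phi> x *\<^sub>R (G x + a *\<^sub>R H x))"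
    by (simp add: scaleR_add_right mult.commute)
  finally show "(LINT x|lebesgue_on \<Omega>. (u x + a * v x) *\<^sub>R gradient \<phi> x) =
      - (LINT x|lebesgue_on \<Omega>. \<phi> x *\<^sub>R (G x + a *\<^sub>R H x))" .
qed

lemma L2_fun_test_diff:
  assumes "test_function \<Omega> \<phi>"
  shows "L2_fun \<Omega> v \<Longrightarrow> L2_fun \<Omega> (\<lambda>x. \<phi> x - v x)"
    and "L2_fun \<Omega> G \<Longrightarrow> L2_fun \<Omega> (\<lambda>x. gradient \<phi> x - G x)"
  using L2_fun_linear(1)[OF L2_fun_continuous[OF test_function_props(2)[OF assms]], of v "-1"]
    L2_fun_linear(1)[OF L2_fun_continuous[OF test_function_props(3)[OF assms]], of G "-1"]
  by simp_all

lemma fun_subspace_H10: "fun_subspace (H10 \<Omega>)"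
  unfolding fun_subspace_def
proof (intro conjI ballI allI)
  have z: "gradient (\<lambda>_. 0) x = 0" for x :: 'a using GDERIV_const by (rule gradient_eq)
  have "L2_fun \<Omega> (\<lambda>_. 0 :: real)" "L2_fun \<Omega> (\<lambda>_. 0 :: 'a)" by (simp_all add: L2_fun_def)
  then show "(\<lambda>_. 0) \<in> H10 \<Omega>"
    unfolding H10_def
    by (intro CollectI conjI exI[of _ "\<lambda>_. 0"] exI[of _ "\<lambda>_ _. 0"])
      (auto simp: weak_gradient_def test_function_zero L2_norm_def L2_inner_def z)
next
  fix u v and a :: real assume "u \<in> H10 \<Omega>" "v \<in> H10 \<Omega>"
  then obtain G \<phi> H \<psi> where
    u: "L2_fun \<Omega> u" "L2_fun \<Omega> G" "weak_gradient \<Omega> u G" "\<And>n::nat. test_function \<Omega> (\<phi> n)"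
      "(\<lambda>n. L2_norm \<Omega> (\<lambda>x. \<phi> n x - u x)) \<longlonglongrightarrow> 0" "(\<lambda>n. L2_norm \<Omega> (\<lambda>x. gradient (\<phi> n) x - G x)) \<longlonglongrightarrow> 0" and
    v: "L2_fun \<Omega> v" "L2_fun \<Omega> H" "weak_gradient \<Omega> v H" "\<And>n::nat. test_function \<Omega> (\<psi> n)"
      "(\<lambda>n. L2_norm \<Omega> (\<lambda>x. \<psi> n x - v x)) \<longlonglongrightarrow> 0" "(\<lambda>n. L2_norm \<Omega> (\<lambda>x. gradient (\<psi> n) x - H x)) \<longlonglongrightarrow> 0"
    unfolding H10_def by auto
  have "L2_fun \<Omega> (\<lambda>x. u x + a * v x)" "L2_fun \<Omega> (\<lambda>x. G x + a *\<^sub>R H x)"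
    using L2_fun_linear(1)[OF u(1) v(1), of a] L2_fun_linear(1)[OF u(2) v(2), of a] by simp_all
  moreover have "weak_gradient \<Omega> (\<lambda>x. u x + a * v x) (\<lambda>x. G x + a *\<^sub>R H x)"
    by (rule weak_gradient_linear[OF u(1-3) v(1-3)])
  moreover have "test_function \<Omega> (\<lambda>x. \<phi> n x + a * \<psi> n x)" for n
    by (rule test_function_linear[OF u(4) v(4)])
  moreover have "(\<lambda>n. L2_norm \<Omega> (\<lambda>x. (\<phi> n x + a * \<psi> n x) - (u x + a * v x))) \<longlonglongrightarrow> 0"
  proof -
    have "(\<phi> n x + a * \<psi> n x) - (u x + a * v x) = (\<phi> n x - u x) + a *\<^sub>R (\<psi> n x - v x)" for n x
      by (simp add: algebra_simps)
    then show ?thesis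
      using L2_norm_tendsto_linear[OF L2_fun_test_diff(1)[OF u(4) u(1)] L2_fun_test_diff(1)[OF v(4) v(1)] u(5) v(5), of a]
      by (simp only:)
  qed
  moreover have "(\<lambda>n. L2_norm \<Omega> (\<lambda>x. gradient (\<lambda>x. \<phi> n x + a * \<psi> n x) x - (G x + a *\<^sub>R H x))) \<longlonglongrightarrow> 0"
  proof -
    have "gradient (\<lambda>x. \<phi> n x + a * \<psi> n x) x - (G x + a *\<^sub>R H x) =
        (gradient (\<phi> n) x - G x) + a *\<^sub>R (gradient (\<psi> n) x - H x)" for n x
      using gradient_linear[OF test_function_props(1)[OF u(4)[of n], of x] test_function_props(1)[OF v(4)[of n], of x], of a]
      by (simp add: algebra_simps)
    then show ?thesis
      using L2_norm_tendsto_linear[OF L2_fun_test_diff(2)[OF u(4) u(2)] L2_fun_test_diff(2)[OF v(4) v(2)] u(6) v(6), of a]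
      by (simp only:)
  qed
  ultimately show "(\<lambda>x. u x + a * v x) \<in> H10 \<Omega>"
    unfolding H10_def
    by (intro CollectI conjI exI[of _ "\<lambda>x. G x + a *\<^sub>R H x"] exI[of _ "\<lambda>n x. \<phi> n x + a * \<psi> n x"]) auto
qed

lemma fun_subspace_V_c: "fun_subspace (V_c \<Omega> \<T>)"
  using fun_subspace_P1 fun_subspace_H10 unfolding V_c_def fun_subspace_def by blast

end

text \<open>The derivative of \<open>cutoff m\<close> is Lipschitz and vanishes at \<open>0\<close> and outside \<open>{-m<..<m}\<close>.\<close>

definition cutoff :: "real \<Rightarrow> real \<Rightarrow> real" where
  "cutoff m t = 1 - (max 0 (1 - (t / m)\<^sup>2))\<^sup>2"

definition cutoff_deriv :: "real \<Rightarrow> real \<Rightarrow> real" where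
  "cutoff_deriv m t = 4 * max 0 (1 - (t / m)\<^sup>2) * (t / m\<^sup>2)"

lemma DERIV_cutoff:
  assumes "m > 0" shows "(cutoff m has_real_derivative cutoff_deriv m t) (at t)"
proof -
  have "((\<lambda>t. 1 - (t / m)\<^sup>2) has_real_derivative - 2 * t / m\<^sup>2) (at t)"
    using assms by (auto intro!: derivative_eq_intros simp: power2_eq_square divide_simps)
  from DERIV_chain2[OF DERIV_max_0_power2 this]
  have "((\<lambda>t. 1 - (max 0 (1 - (t / m)\<^sup>2))\<^sup>2) has_real_derivative 0 - 2 * max 0 (1 - (t / m)\<^sup>2) * (- 2 * t / m\<^sup>2)) (at t)"
    by (intro DERIV_diff DERIV_const)
  then show ?thesis
    by (simp add: cutoff_def[abs_def] cutoff_deriv_def mult.assoc)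
qed

lemma cutoff_weight_bound:
  fixes m t c :: real
  assumes m: "m > 0" and c: "m \<le> \<bar>c\<bar>"
  shows "max 0 (1 - (t / m)\<^sup>2) \<le> 2 / m * \<bar>t - c\<bar>"
proof (cases "\<bar>t\<bar> \<le> m")
  case True
  have "1 - (t / m)\<^sup>2 = (1 - \<bar>t\<bar> / m) * (1 + \<bar>t\<bar> / m)"
  proof -
    have "(t / m)\<^sup>2 = (\<bar>t\<bar> / m)\<^sup>2" unfolding power_divide by simp
    then show ?thesis by (simp only: power2_eq_square) (simp add: algebra_simps)
  qed
  also have "\<dots> \<le> (1 - \<bar>t\<bar> / m) * 2"
    using True m by (intro mult_left_mono) (auto simp: field_simps)
  also have "\<dots> = 2 / m * (m - \<bar>t\<bar>)" using m by (simp add: field_simps)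
  also have "\<dots> \<le> 2 / m * \<bar>t - c\<bar>" using m c by (intro mult_left_mono) auto
  finally show ?thesis using m by simp
next
  case False
  then have "1 \<le> \<bar>t / m\<bar>" using m by (simp add: field_simps)
  then have "1 \<le> \<bar>t / m\<bar>\<^sup>2" by (rule one_le_power)
  then have "1 \<le> (t / m)\<^sup>2" by (simp only: power2_abs)
  then show ?thesis using m by simp
qed

text \<open>Here \<open>c\<close> stands for a value of the piecewise constant limit and
  \<open>t\<close> for that of an approximating test function: the derivative is controlled by the
  approximation error. In every case the weight times \<open>\<bar>t\<bar>\<close> is at most
  \<open>2 * \<bar>t - c\<bar>\<close>, whence 8 = 4 * 2.\<close>

lemma cutoff_deriv_bound:
  assumes m: "m > 0" and c: "c = 0 \<or> m \<le> \<bar>c\<bar>"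
  shows "\<bar>cutoff_deriv m t\<bar> \<le> 8 / m\<^sup>2 * \<bar>t - c\<bar>"
proof -
  let ?w = "max 0 (1 - (t / m)\<^sup>2)"
  have w: "0 \<le> ?w" "?w \<le> 1" by auto
  have eq: "\<bar>cutoff_deriv m t\<bar> = 4 / m\<^sup>2 * (?w * \<bar>t\<bar>)"
    using w by (simp add: cutoff_deriv_def abs_mult)
  have "?w * \<bar>t\<bar> \<le> 2 * \<bar>t - c\<bar>"
  proof (cases "c = 0")
    case True
    have "?w * \<bar>t\<bar> \<le> 1 * \<bar>t\<bar>" using w by (intro mult_right_mono) auto
    then show ?thesis using True by simp
  next
    case False
    show ?thesis
    proof (cases "\<bar>t\<bar> \<le> m")
      case True
      have "?w * \<bar>t\<bar> \<le> (2 / m * \<bar>t - c\<bar>) * m"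
        using cutoff_weight_bound[OF m, of c t] c False True w m by (intro mult_mono) auto
      then show ?thesis using m by simp
    next
      case False
      then have "1 \<le> \<bar>t / m\<bar>" using m by (simp add: field_simps)
      then have "1 \<le> \<bar>t / m\<bar>\<^sup>2" by (rule one_le_power)
  then have "1 \<le> (t / m)\<^sup>2" by (simp only: power2_abs)
      then show ?thesis by simp
    qed
  qed
  then have "4 / m\<^sup>2 * (?w * \<bar>t\<bar>) \<le> 4 / m\<^sup>2 * (2 * \<bar>t - c\<bar>)" by (intro mult_left_mono) auto
  then show ?thesis unfolding eq by simp
qed

lemma continuous_cutoff_deriv: "continuous_on S (cutoff_deriv m)"
  unfolding cutoff_deriv_def[abs_def] divide_inverse by (intro continuous_intros)

section \<open>A conforming function with vanishing broken gradient is zero\<close>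

context mesh begin

text \<open>\<open>D\<close> is the derivative along \<open>e\<close> of
  \<open>(x \<bullet> e) * cutoff m (\<phi> x)\<close>. The factor \<open>x \<bullet> e\<close> has
  derivative 1, so the vanishing integral trades the integral of the cutoff for one containing its
  derivative.\<close>

lemma integral_cutoff_gradient:
  assumes \<phi>: "test_function \<Omega> \<phi>" and m: "0 < m" and e: "norm e = 1"
  defines "D \<equiv> \<lambda>x. cutoff m (\<phi> x) + (x \<bullet> e) * (cutoff_deriv m (\<phi> x) * (gradient \<phi> x \<bullet> e))"
  shows "integrable (lebesgue_on \<Omega>) D" and "(LINT x|lebesgue_on \<Omega>. D x) = 0"
proof -
  note c\<phi> = test_function_props(2,3)[OF \<phi>]
  have ccut: "continuous_on UNIV (cutoff m)"
    using DERIV_cutoff[OF m] by (intro DERIV_continuous_on) auto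
  define g where "g x = (x \<bullet> e) *\<^sub>R (cutoff_deriv m (\<phi> x) *\<^sub>R gradient \<phi> x) + cutoff m (\<phi> x) *\<^sub>R e" for x
  have contg: "continuous_on UNIV g"
    unfolding g_def
    by (intro continuous_intros c\<phi> continuous_on_compose2[OF ccut c\<phi>(1)] continuous_on_compose2[OF continuous_cutoff_deriv c\<phi>(1)]) auto
  have Dg: "D x = g x \<bullet> e" for x
    using e by (simp add: D_def g_def inner_add_left dot_square_norm)
  have der: "GDERIV (\<lambda>x. (x \<bullet> e) * cutoff m (\<phi> x)) x :> g x" for x
  proof -
    have "GDERIV (\<lambda>x. cutoff m (\<phi> x)) x :> cutoff_deriv m (\<phi> x) *\<^sub>R gradient \<phi> x"
      by (rule GDERIV_DERIV_compose[OF differentiable_GDERIV[OF test_function_props(1)[OF \<phi>]] DERIV_cutoff[OF m]])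
    moreover have "GDERIV (\<lambda>x. x \<bullet> e) x :> e"
      unfolding gderiv_def by (auto intro!: derivative_eq_intros)
    ultimately show ?thesis unfolding g_def by (intro GDERIV_mult)
  qed
  let ?S = "closure {x. \<phi> x \<noteq> 0}"
  have off: "(x \<bullet> e) * cutoff m (\<phi> x) = 0" if "x \<notin> ?S" for x
  proof -
    have "\<phi> x = 0" using that closure_subset[of "{x. \<phi> x \<noteq> 0}"] by auto
    then show ?thesis by (simp add: cutoff_def)
  qed
  have int0: "(LINT x|lborel. D x) = 0"
    unfolding Dg by (rule integral_directional_derivative[OF der contg test_function_props(4)[OF \<phi>] off e])
  have contD: "continuous_on UNIV D" unfolding Dg[abs_def] by (intro continuous_intros contg)
  then show "integrable (lebesgue_on \<Omega>) D" by (rule integrable_continuous_\<Omega>)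
  have D0: "D x = 0" if "x \<notin> \<Omega>" for x
  proof -
    have x: "x \<in> - ?S" using that test_function_props(5)[OF \<phi>] by auto
    then have "\<phi> x = 0" using closure_subset[of "{x. \<phi> x \<noteq> 0}"] by auto
    then show ?thesis by (simp add: D_def cutoff_def cutoff_deriv_def)
  qed
  have "(LINT x|lebesgue_on \<Omega>. D x) = (LINT x|lebesgue. indicator \<Omega> x *\<^sub>R D x)"
    using open_\<Omega> by (intro integral_restrict_space) auto
  also have "(\<lambda>x. indicator \<Omega> x *\<^sub>R D x) = D" by (rule ext) (metis D0 indicator_simps(1) mult_zero_right real_scaleR_def scaleR_one)
  also have "(LINT x|lebesgue. D x) = (LINT x|lborel. D x)"
    using borel_measurable_continuous_onI[OF contD] by (intro integral_completion) simp
  finally show "(LINT x|lebesgue_on \<Omega>. D x) = 0" using int0 by simp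
qed

text \<open>Pointwise on \<Omega> the indicator of the element is at most \<open>D\<close> plus
  error terms, and \<open>D\<close> integrates to zero. On the element
  \<open>cutoff m (\<phi> x)\<close> is close to 1 where \<phi> is close to \<open>v\<close>, as
  \<open>v\<close> has modulus at least \<open>m\<close> there. The derivative term carries the
  factor |\<phi> - v|, so a bound on the gradients is enough.\<close>

lemma vol_le_of_H10:
  assumes v: "L2_fun \<Omega> v" and G: "L2_fun \<Omega> G" and \<phi>: "test_function \<Omega> \<phi>"
    and m: "0 < m" and val: "\<And>x. x \<in> \<Omega> \<Longrightarrow> v x = 0 \<or> m \<le> \<bar>v x\<bar>"
    and R: "\<And>x. x \<in> \<Omega> \<Longrightarrow> norm x \<le> R" and eps: "0 < \<epsilon>"
    and T: "T \<in> \<T>" and vT: "\<And>x. x \<in> interior T \<Longrightarrow> v x \<noteq> 0"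
  shows "vol T \<le> 4 / m\<^sup>2 * (L2_norm \<Omega> (\<lambda>x. \<phi> x - v x))\<^sup>2 +
    R * (8 / m\<^sup>2) * (1 / \<epsilon> * (L2_norm \<Omega> (\<lambda>x. \<phi> x - v x))\<^sup>2 +
      \<epsilon> * (2 * (L2_norm \<Omega> (\<lambda>x. gradient \<phi> x - G x))\<^sup>2 + 2 * (L2_norm \<Omega> G)\<^sup>2))"
proof -
  obtain e :: 'a where e: "e \<in> Basis" using nonempty_Basis by blast
  then have ne: "norm e = 1" by simp
  obtain x0 where "x0 \<in> \<Omega>" using nonempty by blast
  then have R0: "0 \<le> R" using R[of x0] norm_ge_zero[of x0] by linarith
  define D where "D x = cutoff m (\<phi> x) + (x \<bullet> e) * (cutoff_deriv m (\<phi> x) * (gradient \<phi> x \<bullet> e))" for x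
  note D = integral_cutoff_gradient[OF \<phi> m ne, folded D_def]
  let ?a = "\<lambda>x. (norm (\<phi> x - v x))\<^sup>2" and ?b = "\<lambda>x. (norm (gradient \<phi> x - G x))\<^sup>2" and ?c = "\<lambda>x. (norm (G x))\<^sup>2"
  let ?rhs = "\<lambda>x. D x + (4 / m\<^sup>2 * ?a x + R * (8 / m\<^sup>2) * (1 / \<epsilon> * ?a x + \<epsilon> * (2 * ?b x + 2 * ?c x)))"
  have point: "indicator (interior T) x \<le> ?rhs x" if x: "x \<in> \<Omega>" for x
  proof -
    have 1: "indicator (interior T) x \<le> cutoff m (\<phi> x) + 4 / m\<^sup>2 * ?a x"
    proof (cases "x \<in> interior T")
      case True
      then have "m \<le> \<bar>v x\<bar>" using vT val[OF x] by auto
      then have "max 0 (1 - (\<phi> x / m)\<^sup>2) \<le> 2 / m * \<bar>\<phi> x - v x\<bar>" by (rule cutoff_weight_bound[OF m])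
      then have "(max 0 (1 - (\<phi> x / m)\<^sup>2))\<^sup>2 \<le> (2 / m * \<bar>\<phi> x - v x\<bar>)\<^sup>2" by (intro power_mono) auto
      then show ?thesis using True by (simp add: cutoff_def power_mult_distrib power_divide)
    next
      case False
      have "(max 0 (1 - (\<phi> x / m)\<^sup>2))\<^sup>2 \<le> 1" by (intro power_le_one) auto
      then show ?thesis using False by (simp add: cutoff_def)
    qed
    have "\<bar>(x \<bullet> e) * (cutoff_deriv m (\<phi> x) * (gradient \<phi> x \<bullet> e))\<bar>
        \<le> R * ((8 / m\<^sup>2 * \<bar>\<phi> x - v x\<bar>) * norm (gradient \<phi> x))"
      unfolding abs_mult
      using Cauchy_Schwarz_ineq2[of x e] Cauchy_Schwarz_ineq2[of "gradient \<phi> x" e] ne R[OF x] R0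
        cutoff_deriv_bound[OF m val[OF x], of "\<phi> x"]
      by (intro mult_mono) auto
    also have "\<dots> = R * (8 / m\<^sup>2) * (\<bar>\<phi> x - v x\<bar> * norm (gradient \<phi> x))" by simp
    also have "\<dots> \<le> R * (8 / m\<^sup>2) * (1 / \<epsilon> * ?a x + \<epsilon> * (2 * ?b x + 2 * ?c x))"
    proof (intro mult_left_mono)
      \<comment> \<open>Young's inequality with a weight: the small factor \<epsilon> goes to the
        gradient, whose norm is merely bounded.\<close>
      have pq: "p * q \<le> 1 / \<epsilon> * p\<^sup>2 + \<epsilon> * q\<^sup>2" for p q :: real
      proof -
        have "0 \<le> (p - \<epsilon> * q)\<^sup>2 + p\<^sup>2 + (\<epsilon> * q)\<^sup>2" by simp
        then have "\<epsilon> * (p * q) \<le> p\<^sup>2 + (\<epsilon> * q)\<^sup>2" by (simp add: power2_diff algebra_simps)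
        then have "\<epsilon> * (p * q) \<le> \<epsilon> * (1 / \<epsilon> * p\<^sup>2 + \<epsilon> * q\<^sup>2)"
          using eps by (simp add: algebra_simps power2_eq_square)
        then show ?thesis using eps by simp
      qed
      have "\<bar>\<phi> x - v x\<bar> * norm (gradient \<phi> x) \<le> 1 / \<epsilon> * ?a x + \<epsilon> * (norm (gradient \<phi> x))\<^sup>2"
        using pq[of "\<bar>\<phi> x - v x\<bar>" "norm (gradient \<phi> x)"] by simp
      moreover have "(norm (gradient \<phi> x))\<^sup>2 \<le> 2 * ?b x + 2 * ?c x"
        using norm_add_scaleR_power2_le[of "gradient \<phi> x - G x" 1 "G x"] by simp
      ultimately show "\<bar>\<phi> x - v x\<bar> * norm (gradient \<phi> x) \<le> 1 / \<epsilon> * ?a x + \<epsilon> * (2 * ?b x + 2 * ?c x)"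
        using eps mult_left_mono[of "(norm (gradient \<phi> x))\<^sup>2" "2 * ?b x + 2 * ?c x" \<epsilon>] by linarith
    qed (use R0 in auto)
    finally show ?thesis using 1 unfolding D_def by linarith
  qed
  have ia: "integrable (lebesgue_on \<Omega>) ?a" "integrable (lebesgue_on \<Omega>) ?b" "integrable (lebesgue_on \<Omega>) ?c"
    using L2_fun_test_diff(1)[OF \<phi> v] L2_fun_test_diff(2)[OF \<phi> G] G by (auto simp: L2_fun_def)
  have irhs: "integrable (lebesgue_on \<Omega>) ?rhs" using ia D(1) by (intro Bochner_Integration.integrable_add Bochner_Integration.integrable_mult_right) auto
  have iT: "interior T \<inter> \<Omega> = interior T" using interior_element_subset[OF T] by blast
  have iT': "(LINT x|lebesgue_on \<Omega>. indicator (interior T) x) = vol T"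
    using open_\<Omega> measure_restrict_space[of \<Omega> lebesgue "interior T"] interior_element_subset[OF T]
    by (simp add: iT vol_def)
  have iTm: "indicator (interior T) \<in> borel_measurable (lebesgue_on \<Omega>)"
    using open_\<Omega> interior_element_subset[OF T]
    by (intro borel_measurable_indicator) (simp add: sets_restrict_space_iff)
  have "integrable (lebesgue_on \<Omega>) (indicator (interior T) :: 'a \<Rightarrow> real)"
    by (rule Bochner_Integration.integrable_bound[OF integrable_continuous_\<Omega>[of "\<lambda>_. 1"] iTm])
      (simp_all add: indicator_def)
  then have "vol T \<le> (LINT x|lebesgue_on \<Omega>. ?rhs x)"
    unfolding iT'[symmetric] using irhs point by (intro integral_mono) auto
  also have "\<dots> = 4 / m\<^sup>2 * (LINT x|lebesgue_on \<Omega>. ?a x) +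
      R * (8 / m\<^sup>2) * (1 / \<epsilon> * (LINT x|lebesgue_on \<Omega>. ?a x) +
      \<epsilon> * (2 * (LINT x|lebesgue_on \<Omega>. ?b x) + 2 * (LINT x|lebesgue_on \<Omega>. ?c x)))"
    using ia D by simp
  finally show ?thesis unfolding L2_norm_power2 .
qed

lemma V_c_inj:
  assumes v: "v \<in> V_c \<Omega> \<T>" and g0: "\<And>T. T \<in> \<T> \<Longrightarrow> gradient v (pt T) = 0"
  shows "v = (\<lambda>_. 0)"
proof (rule ccontr)
  assume "v \<noteq> (\<lambda>_. 0)"
  then obtain x where x: "v x \<noteq> 0" by blast
  have vP1: "v \<in> P1 \<T>" using v by (simp add: V_c_def)
  have vP0: "v \<in> P0 \<T>" using P1_gradient_zero[OF vP1 g0] .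
  obtain T0 where T0: "T0 \<in> \<T>" "x \<in> interior T0" using P1_zero[OF vP1, of x] x by blast
  have vT0: "v y \<noteq> 0" if "y \<in> interior T0" for y
    using P0_eq[OF vP0 T0] P0_eq[OF vP0 T0(1) that] x by simp
  define A where "A = (\<lambda>T. \<bar>v (pt T)\<bar>) ` \<T> - {0}"
  have "finite A" using finite_\<T> by (simp add: A_def)
  have "A \<noteq> {}" using T0 vT0[OF pt[OF T0(1)]] by (auto simp: A_def)
  \<comment> \<open>The smallest nonzero modulus among the finitely many values of
    \<open>v\<close>.\<close>
  define m where "m = Min A"
  have "m \<in> A" unfolding m_def using \<open>finite A\<close> \<open>A \<noteq> {}\<close> by (rule Min_in)
  then have m: "0 < m" by (auto simp: A_def)
  have val: "v y = 0 \<or> m \<le> \<bar>v y\<bar>" for y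
  proof (cases "y \<in> \<Union>(interior ` \<T>)")
    case True
    then obtain T where T: "T \<in> \<T>" "y \<in> interior T" by blast
    show ?thesis
    proof (cases "v y = 0")
      case False
      then have "\<bar>v y\<bar> \<in> A" using P0_eq[OF vP0 T] T(1) by (auto simp: A_def)
      then show ?thesis using \<open>finite A\<close> by (simp add: m_def)
    qed simp
  qed (simp add: P1_zero[OF vP1])
  obtain R where R: "\<And>y. y \<in> \<Omega> \<Longrightarrow> norm y \<le> R" using bounded_\<Omega> unfolding bounded_iff by blast
  obtain G \<phi> where vH: "L2_fun \<Omega> v" "L2_fun \<Omega> G" "\<And>n::nat. test_function \<Omega> (\<phi> n)"
    "(\<lambda>n. L2_norm \<Omega> (\<lambda>x. \<phi> n x - v x)) \<longlonglongrightarrow> 0" "(\<lambda>n. L2_norm \<Omega> (\<lambda>x. gradient (\<phi> n) x - G x)) \<longlonglongrightarrow> 0"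
    using v unfolding V_c_def H10_def by auto
  define K where "K = R * (8 / m\<^sup>2) * (2 * (L2_norm \<Omega> G)\<^sup>2)"
  \<comment> \<open>With \<epsilon> fixed, convergence of the test functions removes every term
    except the one proportional to \<epsilon>; afterwards \<epsilon> is made small.\<close>
  have bound: "vol T0 \<le> K * \<epsilon>" if eps: "0 < \<epsilon>" for \<epsilon>
  proof -
    let ?f = "\<lambda>n. 4 / m\<^sup>2 * (L2_norm \<Omega> (\<lambda>x. \<phi> n x - v x))\<^sup>2 +
      R * (8 / m\<^sup>2) * (1 / \<epsilon> * (L2_norm \<Omega> (\<lambda>x. \<phi> n x - v x))\<^sup>2 +
        \<epsilon> * (2 * (L2_norm \<Omega> (\<lambda>x. gradient (\<phi> n) x - G x))\<^sup>2 + 2 * (L2_norm \<Omega> G)\<^sup>2))"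
    have "?f \<longlonglongrightarrow> 4 / m\<^sup>2 * 0\<^sup>2 + R * (8 / m\<^sup>2) * (1 / \<epsilon> * 0\<^sup>2 + \<epsilon> * (2 * 0\<^sup>2 + 2 * (L2_norm \<Omega> G)\<^sup>2))"
      by (intro tendsto_add tendsto_mult tendsto_power tendsto_const vH(4,5))
    moreover have "vol T0 \<le> ?f n" for n
      by (rule vol_le_of_H10[OF vH(1,2,3) m val R eps T0(1) vT0])
    ultimately have "vol T0 \<le> 4 / m\<^sup>2 * 0\<^sup>2 + R * (8 / m\<^sup>2) * (1 / \<epsilon> * 0\<^sup>2 + \<epsilon> * (2 * 0\<^sup>2 + 2 * (L2_norm \<Omega> G)\<^sup>2))"
      by (intro tendsto_lowerbound[OF _ always_eventually]) auto
    then show ?thesis by (simp add: K_def algebra_simps)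
  qed
  have pos: "0 < vol T0" using vol_pos[OF T0(1)] .
  \<comment> \<open>For \<epsilon> = \<open>vol T0 / (2 * (\<bar>K\<bar> + 1))\<close> the bound
    \<open>K * \<epsilon>\<close> is below \<open>vol T0\<close>.\<close>
  have "K * (vol T0 / (2 * (\<bar>K\<bar> + 1))) \<le> \<bar>K\<bar> * (vol T0 / (2 * (\<bar>K\<bar> + 1)))"
    using pos by (intro mult_right_mono) auto
  also have "\<dots> < vol T0" using pos by (simp add: field_simps add_nonneg_pos)
  finally show False using bound[of "vol T0 / (2 * (\<bar>K\<bar> + 1))"] pos by auto
qed

end

section \<open>Discrete solutions and the constants\<close>

lemma fun_linear_sum:
  assumes V: "fun_subspace V" and L: "fun_linear V L" and h: "\<And>i. i \<in> I \<Longrightarrow> h i \<in> V" and "finite I"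
  shows "(\<lambda>x. \<Sum>i\<in>I. c i * h i x) \<in> V \<and> L (\<lambda>x. \<Sum>i\<in>I. c i * h i x) = (\<Sum>i\<in>I. c i *\<^sub>R L (h i))"
  using \<open>finite I\<close> h
proof (induction I rule: finite_induct)
  case empty
  then show ?case using fun_subspaceD(1)[OF V] fun_linear_zero[OF V L] by simp
next
  case (insert j I)
  then have IH: "(\<lambda>x. \<Sum>i\<in>I. c i * h i x) \<in> V" "L (\<lambda>x. \<Sum>i\<in>I. c i * h i x) = (\<Sum>i\<in>I. c i *\<^sub>R L (h i))"
    and j: "h j \<in> V" by auto
  have "(\<lambda>x. \<Sum>i\<in>insert j I. c i * h i x) = (\<lambda>x. (\<Sum>i\<in>I. c i * h i x) + c j * h j x)"
    using insert.hyps by (auto simp: add.commute)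
  then show ?case
    using fun_subspaceD(2)[OF V IH(1) j, of "c j"] fun_linearD[OF L IH(1) j, of "c j"] IH(2) insert.hyps
    by (simp add: add.commute)
qed

context mesh begin

text \<open>The common form of \<open>z_c\<close> and \<open>z_CR\<close>, so that both discrete
  problems are treated at once.\<close>

definition "galerkin V g = (THE z. z \<in> V \<and> (\<forall>v\<in>V.
  L2_inner \<Omega> (broken_gradient \<T> z) (broken_gradient \<T> v) = L2_inner \<Omega> g v))"

lemma z_galerkin: "z_c \<Omega> \<T> = galerkin (V_c \<Omega> \<T>)" "z_CR \<Omega> \<T> = galerkin (V_CR \<Omega> \<T>)"
  by (auto simp: z_c_def z_CR_def galerkin_def)

lemma fun_subspace_P0: "fun_subspace (P0 \<T>)"
  unfolding fun_subspace_def
proof (intro conjI ballI allI)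
  show "(\<lambda>_. 0) \<in> P0 \<T>" unfolding P0_def constant_on_def by simp
  fix u v and a :: real assume uv: "u \<in> P0 \<T>" "v \<in> P0 \<T>"
  have "(\<lambda>x. u x + a * v x) constant_on interior T" if "T \<in> \<T>" for T
    using P0_eq[OF uv(1) that] P0_eq[OF uv(2) that] unfolding constant_on_def by auto
  then show "(\<lambda>x. u x + a * v x) \<in> P0 \<T>" using uv unfolding P0_def by simp
qed

text \<open>The last clause says that the energy form is definite on \<open>V\<close>; for the two
  finite element spaces it is \<open>V_c_inj\<close> and \<open>V_CR_inj\<close>.\<close>

definition "admissible V \<longleftrightarrow> fun_subspace V \<and> V \<subseteq> P1 \<T> \<and>
  (\<forall>v\<in>V. (\<forall>T\<in>\<T>. gradient v (pt T) = 0) \<longrightarrow> v = (\<lambda>_. 0))"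

lemma admissible: "admissible (V_c \<Omega> \<T>)" "admissible (V_CR \<Omega> \<T>)"
  unfolding admissible_def
  using fun_subspace_V_c fun_subspace_V_CR V_CR_P1 V_c_inj V_CR_inj by (auto simp: V_c_def)

lemma galerkin_ex1:
  assumes V: "admissible V" and g: "g \<in> P0 \<T>"
  shows "\<exists>!z. z \<in> V \<and> (\<forall>v\<in>V. L2_inner \<Omega> (broken_gradient \<T> z) (broken_gradient \<T> v) = L2_inner \<Omega> g v)"
proof -
  have sub: "fun_subspace V" "V \<subseteq> P1 \<T>" using V by (auto simp: admissible_def)
  have "\<exists>!z. z \<in> V \<and> (\<forall>v\<in>V. (\<Sum>T\<in>\<T>. vol T * (gradient z (pt T) \<bullet> gradient v (pt T))) = L2_inner \<Omega> g v)"
  proof (rule riesz_ex1[OF finite_\<T> vol_pos sub(1)])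
    show "fun_linear V (\<lambda>v. gradient v (pt T))" if "T \<in> \<T>" for T
      using fun_linear_gradient_pt[OF that] sub(2) unfolding fun_linear_def by blast
    show "fun_linear V (L2_inner \<Omega> g)"
      using fun_linear_L2_inner_P0[OF g] sub(2) unfolding fun_linear_def by blast
    show "v = (\<lambda>_. 0)" if "v \<in> V" "\<And>T. T \<in> \<T> \<Longrightarrow> gradient v (pt T) = 0" for v
      using V that unfolding admissible_def by blast
  qed
  moreover have "L2_inner \<Omega> (broken_gradient \<T> z) (broken_gradient \<T> v) =
      (\<Sum>T\<in>\<T>. vol T * (gradient z (pt T) \<bullet> gradient v (pt T)))" if "z \<in> V" "v \<in> V" for z v
    using L2_inner_broken_gradient sub(2) that by blast
  ultimately show ?thesis by (simp cong: conj_cong)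
qed

lemma galerkin:
  assumes V: "admissible V" and g: "g \<in> P0 \<T>"
  shows "galerkin V g \<in> V"
    and "v \<in> V \<Longrightarrow> L2_inner \<Omega> (broken_gradient \<T> (galerkin V g)) (broken_gradient \<T> v) = L2_inner \<Omega> g v"
  using theI'[OF galerkin_ex1[OF V g]] unfolding galerkin_def by blast+

lemma galerkin_P1: "admissible V \<Longrightarrow> g \<in> P0 \<T> \<Longrightarrow> galerkin V g \<in> P1 \<T>"
  using galerkin(1) by (auto simp: admissible_def)

text \<open>By uniqueness: the combination of the solutions solves the problem with combined
  data.\<close>

lemma galerkin_linear:
  assumes V: "admissible V" and gh: "g \<in> P0 \<T>" "h \<in> P0 \<T>"
  shows "galerkin V (\<lambda>x. g x + a * h x) = (\<lambda>x. galerkin V g x + a * galerkin V h x)"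
proof -
  let ?z = "\<lambda>x. galerkin V g x + a * galerkin V h x"
  have k: "(\<lambda>x. g x + a * h x) \<in> P0 \<T>" by (rule fun_subspaceD(2)[OF fun_subspace_P0 gh])
  have sub: "fun_subspace V" "V \<subseteq> P1 \<T>" using V by (auto simp: admissible_def)
  have zV: "?z \<in> V" by (intro fun_subspaceD(2)[OF sub(1)] galerkin V gh)
  have "L2_inner \<Omega> (broken_gradient \<T> ?z) (broken_gradient \<T> v) = L2_inner \<Omega> (\<lambda>x. g x + a * h x) v"
    if v: "v \<in> V" for v
  proof -
    have vP: "v \<in> P1 \<T>" using v sub by blast
    note zP = galerkin_P1[OF V gh(1)] galerkin_P1[OF V gh(2)]
    have "L2_inner \<Omega> (broken_gradient \<T> ?z) (broken_gradient \<T> v) =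
        (\<Sum>T\<in>\<T>. vol T * (gradient ?z (pt T) \<bullet> gradient v (pt T)))"
      using zV sub(2) vP by (intro L2_inner_broken_gradient) auto
    also have "\<dots> = (\<Sum>T\<in>\<T>. vol T * (gradient (galerkin V g) (pt T) \<bullet> gradient v (pt T)) +
        a * (vol T * (gradient (galerkin V h) (pt T) \<bullet> gradient v (pt T))))"
      by (intro sum.cong refl) (simp add: fun_linearD[OF fun_linear_gradient_pt zP] inner_add_left algebra_simps)
    also have "\<dots> = L2_inner \<Omega> g v + a * L2_inner \<Omega> h v"
      using galerkin(2)[OF V gh(1) v] galerkin(2)[OF V gh(2) v]
      unfolding L2_inner_broken_gradient[OF zP(1) vP] L2_inner_broken_gradient[OF zP(2) vP]
      by (simp add: sum.distrib flip: sum_distrib_left)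
    also have "\<dots> = L2_inner \<Omega> (\<lambda>x. g x + a * h x) v"
      unfolding L2_inner_P0_P1[OF k vP] L2_inner_P0_P1[OF gh(1) vP] L2_inner_P0_P1[OF gh(2) vP]
      by (simp add: sum.distrib sum_distrib_left algebra_simps)
    finally show ?thesis .
  qed
  then show ?thesis
    using zV unfolding galerkin_def[of V "\<lambda>x. g x + a * h x"]
    by (intro the1_equality[OF galerkin_ex1[OF V k]]) blast
qed

section \<open>The gap as a quadratic form in the element values\<close>

definition "gap_gradient g T = gradient (z_CR \<Omega> \<T> g) (pt T) - gradient (z_c \<Omega> \<T> g) (pt T)"

lemma z_P1: "g \<in> P0 \<T> \<Longrightarrow> z_c \<Omega> \<T> g \<in> P1 \<T>" "g \<in> P0 \<T> \<Longrightarrow> z_CR \<Omega> \<T> g \<in> P1 \<T>"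
  by (simp_all add: z_galerkin galerkin_P1 admissible)

lemma fun_linear_gap_gradient: "T \<in> \<T> \<Longrightarrow> fun_linear (P0 \<T>) (\<lambda>g. gap_gradient g T)"
  unfolding fun_linear_def
proof (intro ballI allI)
  fix g h and a :: real assume T: "T \<in> \<T>" and gh: "g \<in> P0 \<T>" "h \<in> P0 \<T>"
  show "gap_gradient (\<lambda>x. g x + a * h x) T = gap_gradient g T + a *\<^sub>R gap_gradient h T"
    unfolding gap_gradient_def z_galerkin galerkin_linear[OF admissible(1) gh] galerkin_linear[OF admissible(2) gh]
      fun_linearD[OF fun_linear_gradient_pt[OF T] galerkin_P1[OF admissible(1) gh(1)] galerkin_P1[OF admissible(1) gh(2)]]
      fun_linearD[OF fun_linear_gradient_pt[OF T] galerkin_P1[OF admissible(2) gh(1)] galerkin_P1[OF admissible(2) gh(2)]]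
    by (simp add: algebra_simps)
qed

definition "gap g = L2_norm \<Omega> (broken_gradient \<T> (\<lambda>x. z_CR \<Omega> \<T> g x - z_c \<Omega> \<T> g x))"

lemma gap_power2:
  assumes g: "g \<in> P0 \<T>" shows "(gap g)\<^sup>2 = (\<Sum>T\<in>\<T>. vol T * (norm (gap_gradient g T))\<^sup>2)"
proof -
  let ?z = "\<lambda>x. z_CR \<Omega> \<T> g x - z_c \<Omega> \<T> g x"
  have P: "?z \<in> P1 \<T>" by (intro fun_subspace_diff[OF fun_subspace_P1] z_P1 g)
  have "gradient ?z (pt T) = gap_gradient g T" if "T \<in> \<T>" for T
    unfolding gap_gradient_def by (rule fun_linear_diff[OF fun_linear_gradient_pt[OF that] z_P1(2)[OF g] z_P1(1)[OF g]])
  then have "L2_inner \<Omega> (broken_gradient \<T> ?z) (broken_gradient \<T> ?z) = (\<Sum>T\<in>\<T>. vol T * (norm (gap_gradient g T))\<^sup>2)"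
    unfolding L2_inner_broken_gradient[OF P P] by (simp add: dot_square_norm)
  moreover have "0 \<le> (\<Sum>T\<in>\<T>. vol T * (norm (gap_gradient g T))\<^sup>2)"
    using vol_pos by (intro sum_nonneg) (simp add: less_imp_le)
  ultimately show ?thesis unfolding gap_def L2_norm_def by simp
qed

lemma gap_nonneg: "0 \<le> gap g"
  by (simp add: gap_def L2_norm_def L2_inner_def)

lemma indicator_P0: "S \<in> \<T> \<Longrightarrow> indicator (interior S) \<in> P0 \<T>"
proof -
  assume S: "S \<in> \<T>"
  have "(indicator (interior S) :: 'a \<Rightarrow> real) constant_on interior T" if "T \<in> \<T>" for T
  proof (cases "T = S")
    case False
    then have "indicator (interior S) x = (0 :: real)" if "x \<in> interior T" for x
      using interior_disjoint[OF \<open>T \<in> \<T>\<close> S that] by (auto simp: indicator_def)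
    then show ?thesis unfolding constant_on_def by blast
  qed (auto simp: constant_on_def)
  then show ?thesis using S unfolding P0_def by auto
qed

lemma indicator_pt:
  "S \<in> \<T> \<Longrightarrow> T \<in> \<T> \<Longrightarrow> indicator (interior S) (pt T) = (if T = S then 1 else 0 :: real)"
  using pt[of T] interior_disjoint[of T S "pt T"] by (auto simp: indicator_def)

text \<open>Indicators of element interiors serve as coordinates on \<open>P0 \<T>\<close>; by
  linearity every gap gradient is a combination of those of the indicators.\<close>

lemma P0_sum:
  fixes c :: "'a set \<Rightarrow> real"
  defines "g \<equiv> \<lambda>x. \<Sum>S\<in>\<T>. c S * indicator (interior S) x"
  shows "g \<in> P0 \<T>" and "T \<in> \<T> \<Longrightarrow> g (pt T) = c T"
    and "T \<in> \<T> \<Longrightarrow> gap_gradient g T = (\<Sum>S\<in>\<T>. c S *\<^sub>R gap_gradient (indicator (interior S)) T)"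
proof -
  obtain T0 where "T0 \<in> \<T>" using \<T>_nonempty by blast
  show gP: "g \<in> P0 \<T>"
    unfolding g_def
    by (rule fun_linear_sum[where h = "\<lambda>S. indicator (interior S)", OF fun_subspace_P0 fun_linear_gap_gradient[OF \<open>T0 \<in> \<T>\<close>]
        indicator_P0 finite_\<T>, THEN conjunct1])
  show "gap_gradient g T = (\<Sum>S\<in>\<T>. c S *\<^sub>R gap_gradient (indicator (interior S)) T)" if T: "T \<in> \<T>"
    unfolding g_def
    by (rule fun_linear_sum[where h = "\<lambda>S. indicator (interior S)", OF fun_subspace_P0 fun_linear_gap_gradient[OF T]
        indicator_P0 finite_\<T>, THEN conjunct2])
  show "g (pt T) = c T" if T: "T \<in> \<T>"
  proof -
    have "g (pt T) = (\<Sum>S\<in>\<T>. if S = T then c S else 0)"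
      unfolding g_def using indicator_pt T by (intro sum.cong refl) auto
    then show ?thesis using finite_\<T> T by simp
  qed
qed

lemma P0_ext: "g \<in> P0 \<T> \<Longrightarrow> h \<in> P0 \<T> \<Longrightarrow> (\<And>T. T \<in> \<T> \<Longrightarrow> g (pt T) = h (pt T)) \<Longrightarrow> g = h"
proof (rule ext)
  fix x assume gh: "g \<in> P0 \<T>" "h \<in> P0 \<T>" and eq: "\<And>T. T \<in> \<T> \<Longrightarrow> g (pt T) = h (pt T)"
  show "g x = h x"
  proof (cases "x \<in> \<Union>(interior ` \<T>)")
    case True
    then obtain T where "T \<in> \<T>" "x \<in> interior T" by blast
    then show ?thesis using P0_eq[OF gh(1)] P0_eq[OF gh(2)] eq by metis
  qed (simp add: P1_zero[OF P0_P1[OF gh(1)]] P1_zero[OF P0_P1[OF gh(2)]])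
qed

text \<open>In the element values of \<open>g\<close> the squared gap and the squared norm are the
  forms of \<open>quadratic_ratio_attains_max\<close>. The maximiser found there makes the
  \<open>GREATEST\<close> in \<open>gamma_gap\<close> an attained value.\<close>

lemma gap_ratio_attains_max:
  obtains g0 where "g0 \<in> P0 \<T> - {\<lambda>_. 0}" "gamma_gap \<Omega> \<T> = gap g0 / L2_norm \<Omega> g0"
    "\<And>g. g \<in> P0 \<T> - {\<lambda>_. 0} \<Longrightarrow> gap g / L2_norm \<Omega> g \<le> gap g0 / L2_norm \<Omega> g0"
proof -
  define A where "A S T = gap_gradient (indicator (interior S)) T" for S T
  define Q where "Q c = (\<Sum>t\<in>\<T>. vol t * (norm (\<Sum>s\<in>\<T>. c s *\<^sub>R A s t))\<^sup>2)" for c :: "'a set \<Rightarrow> real"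
  define N where "N c = (\<Sum>t\<in>\<T>. vol t * (c t)\<^sup>2)" for c :: "'a set \<Rightarrow> real"
  obtain c where c: "\<exists>t\<in>\<T>. c t \<noteq> (0::real)" "\<And>c'. \<exists>t\<in>\<T>. c' t \<noteq> 0 \<Longrightarrow> Q c' / N c' \<le> Q c / N c"
    using quadratic_ratio_attains_max[where A = A and m = vol, OF finite_\<T> \<T>_nonempty vol_pos, folded Q_def N_def]
    by metis
  have ratio: "(gap g / L2_norm \<Omega> g)\<^sup>2 = Q (\<lambda>T. g (pt T)) / N (\<lambda>T. g (pt T))" if g: "g \<in> P0 \<T>" for g
  proof -
    have "g = (\<lambda>x. \<Sum>S\<in>\<T>. g (pt S) * indicator (interior S) x)"
      by (rule P0_ext[OF g P0_sum(1)]) (simp add: P0_sum(2)[of _ "\<lambda>S. g (pt S)"])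
    then have "gap_gradient g T = (\<Sum>S\<in>\<T>. g (pt S) *\<^sub>R A S T)" if "T \<in> \<T>" for T
      using P0_sum(3)[OF that, of "\<lambda>S. g (pt S)"] unfolding A_def by simp
    then have "(gap g)\<^sup>2 = Q (\<lambda>T. g (pt T))" unfolding gap_power2[OF g] Q_def by (intro sum.cong) auto
    moreover have "(L2_norm \<Omega> g)\<^sup>2 = N (\<lambda>T. g (pt T))" unfolding L2_norm_P0(1)[OF g] N_def ..
    ultimately show ?thesis by (simp add: power_divide)
  qed
  define g0 where "g0 = (\<lambda>x. \<Sum>S\<in>\<T>. c S * indicator (interior S) x)"
  have g0: "g0 \<in> P0 \<T>" "\<And>T. T \<in> \<T> \<Longrightarrow> g0 (pt T) = c T" unfolding g0_def by (rule P0_sum(1), rule P0_sum(2))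
  have g0nz: "g0 \<noteq> (\<lambda>_. 0)" using c(1) g0(2) by auto
  have QN0: "Q (\<lambda>T. g0 (pt T)) / N (\<lambda>T. g0 (pt T)) = Q c / N c"
    unfolding Q_def N_def using g0(2) by (simp cong: sum.cong)
  have max: "gap g / L2_norm \<Omega> g \<le> gap g0 / L2_norm \<Omega> g0" if g: "g \<in> P0 \<T> - {\<lambda>_. 0}" for g
  proof -
    have gP: "g \<in> P0 \<T>" "g \<noteq> (\<lambda>_. 0)" using g by auto
    have "\<exists>T\<in>\<T>. g (pt T) \<noteq> 0" using P0_ext[OF gP(1) fun_subspaceD(1)[OF fun_subspace_P0]] gP(2) by blast
    then have "(gap g / L2_norm \<Omega> g)\<^sup>2 \<le> (gap g0 / L2_norm \<Omega> g0)\<^sup>2"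
      unfolding ratio[OF gP(1)] ratio[OF g0(1)] QN0 using c(2)[of "\<lambda>T. g (pt T)"] by simp
    moreover have "0 \<le> gap g0 / L2_norm \<Omega> g0"
      using gap_nonneg[of g0] L2_norm_P0(2)[OF g0(1) g0nz] by simp
    ultimately show ?thesis by (rule power2_le_imp_le)
  qed
  have "gamma_gap \<Omega> \<T> = gap g0 / L2_norm \<Omega> g0"
    unfolding gamma_gap_def gap_def[symmetric]
  proof (rule Greatest_equality)
    show "\<exists>g\<in>P0 \<T> - {\<lambda>_. 0}. gap g0 / L2_norm \<Omega> g0 = gap g / L2_norm \<Omega> g" using g0(1) g0nz by blast
  qed (use max in blast)
  then show ?thesis using that[of g0] g0 g0nz max by blast
qed

section \<open>The flux error and the two-sided bound\<close>

definition "moment T = (LINT x|lborel. indicator T x * (norm (x - barycentre T))\<^sup>2)"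

lemma diameter_le_mesh_size: "T \<in> \<T> \<Longrightarrow> diameter T \<le> mesh_size \<T>"
  unfolding mesh_size_def using finite_\<T> by simp

lemma moment_bounds:
  assumes T: "T \<in> \<T>"
  fixes d :: real defines "d \<equiv> DIM('a)"
  shows "vol T * (diameter T)\<^sup>2 / ((d + 1)\<^sup>2 * (d + 2)) \<le> moment T"
    and "moment T \<le> vol T * d * (mesh_size \<T>)\<^sup>2 / (2 * (d + 1) * (d + 2))"
proof -
  interpret S: full_simplex "verts T" using simplex_verts T by blast
  have hT: "convex hull (verts T) = T" using simplex_verts T by blast
  note b = S.I_norm_minus_barycentre_bounds[unfolded hT vol_eq[OF T], folded moment_def d_def]
  show "vol T * (diameter T)\<^sup>2 / ((d + 1)\<^sup>2 * (d + 2)) \<le> moment T" by (rule b(1))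
  have "0 \<le> diameter T" using diameter_ge_0[OF compact_imp_bounded[OF compact_element[OF T]]] .
  then have "(diameter T)\<^sup>2 \<le> (mesh_size \<T>)\<^sup>2" using diameter_le_mesh_size[OF T] by (intro power_mono)
  then have "vol T * d * (diameter T)\<^sup>2 / (2 * (d + 1) * (d + 2)) \<le> vol T * d * (mesh_size \<T>)\<^sup>2 / (2 * (d + 1) * (d + 2))"
    using vol_pos[OF T] by (intro divide_right_mono mult_left_mono) (auto simp: d_def)
  then show "moment T \<le> vol T * d * (mesh_size \<T>)\<^sup>2 / (2 * (d + 1) * (d + 2))" using b(2) by linarith
qed

definition "flux_error g = L2_norm \<Omega> (\<lambda>x. marini_flux \<Omega> \<T> g x - broken_gradient \<T> (z_c \<Omega> \<T> g) x)"

lemma flux_error_power2: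
  assumes g: "g \<in> P0 \<T>"
  shows "(flux_error g)\<^sup>2 = (gap g)\<^sup>2 + (\<Sum>T\<in>\<T>. (g (pt T) / DIM('a))\<^sup>2 * moment T)"
proof -
  let ?f = "\<lambda>x. marini_flux \<Omega> \<T> g x - broken_gradient \<T> (z_c \<Omega> \<T> g) x"
  define F where "F T x = (norm (gap_gradient g T))\<^sup>2 - 2 * (g (pt T) / DIM('a)) * (gap_gradient g T \<bullet> (x - barycentre T))
    + (g (pt T) / DIM('a))\<^sup>2 * (norm (x - barycentre T))\<^sup>2" for T x
  have expand: "(norm (a - c *\<^sub>R y))\<^sup>2 = (norm a)\<^sup>2 - 2 * c * (a \<bullet> y) + c\<^sup>2 * (norm y)\<^sup>2" for a y :: 'a and c
    unfolding power2_norm_eq_inner by (simp add: inner_diff_left inner_diff_right inner_commute power2_eq_square algebra_simps)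
  have F: "(norm (?f x))\<^sup>2 = F T x" if T: "T \<in> \<T>" and x: "x \<in> interior T" for T x
  proof -
    have "?f x = gap_gradient g T - (g (pt T) / DIM('a)) *\<^sub>R (x - barycentre T)"
      unfolding marini_flux_def gap_gradient_def
      using broken_gradient_eq[OF z_P1(1)[OF g] T x] broken_gradient_eq[OF z_P1(2)[OF g] T x]
        P0_eq[OF g T x] element_at_eq[OF T x] by (simp add: algebra_simps)
    then show ?thesis unfolding F_def by (simp only: expand)
  qed
  have contF: "continuous_on UNIV (F T)" for T unfolding F_def[abs_def] by (intro continuous_intros)
  have intF: "(LINT x|lebesgue_on (interior T). F T x) =
      vol T * (norm (gap_gradient g T))\<^sup>2 + (g (pt T) / DIM('a))\<^sup>2 * moment T" if T: "T \<in> \<T>" for T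
  proof -
    interpret S: full_simplex "verts T" using simplex_verts T by blast
    have hT: "convex hull (verts T) = T" using simplex_verts T by blast
    have "(LINT x|lebesgue_on (interior T). F T x) = (LINT x|lborel. indicator T x * F T x)"
      by (rule integral_interior_element(2)[OF T contF])
    also have "\<dots> = (LINT x|lborel. (norm (gap_gradient g T))\<^sup>2 * (indicator T x * 1)
        - 2 * (g (pt T) / DIM('a)) * (indicator T x * (gap_gradient g T \<bullet> (x - barycentre T)))
        + (g (pt T) / DIM('a))\<^sup>2 * (indicator T x * (norm (x - barycentre T))\<^sup>2))"
      unfolding F_def by (intro Bochner_Integration.integral_cong refl) (simp add: algebra_simps)
    also have "\<dots> = (norm (gap_gradient g T))\<^sup>2 * (LINT x|lborel. indicator T x * 1)
        - 2 * (g (pt T) / DIM('a)) * (LINT x|lborel. indicator T x * (gap_gradient g T \<bullet> (x - barycentre T)))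
        + (g (pt T) / DIM('a))\<^sup>2 * moment T"
    proof -
      have i: "integrable lborel (\<lambda>x. indicator T x * f x)" if "continuous_on UNIV f" for f :: "'a \<Rightarrow> real"
        using S.integrable_I[OF that] hT by simp
      have "integrable lborel (\<lambda>x. indicator T x * (1::real))"
        "integrable lborel (\<lambda>x. indicator T x * (gap_gradient g T \<bullet> (x - barycentre T)))"
        "integrable lborel (\<lambda>x. indicator T x * (norm (x - barycentre T))\<^sup>2)"
        by (intro i continuous_intros)+
      then show ?thesis unfolding moment_def
        by (simp only: Bochner_Integration.integral_add Bochner_Integration.integral_diff integral_mult_right_zero
          Bochner_Integration.integrable_mult_right Bochner_Integration.integrable_diff)
    qed
    also have "(LINT x|lborel. indicator T x * (gap_gradient g T \<bullet> (x - barycentre T))) = 0"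
      using S.I_minus_barycentre[of "gap_gradient g T"] unfolding hT .
    finally show ?thesis
      by (simp only: vol_eq[OF T]) simp
  qed
  have "(flux_error g)\<^sup>2 = (LINT x|lebesgue_on \<Omega>. (norm (?f x))\<^sup>2)"
    unfolding flux_error_def by (rule L2_norm_power2)
  also have "\<dots> = (\<Sum>T\<in>\<T>. LINT x|lebesgue_on (interior T). F T x)"
  proof (rule integral_elements[OF _ F integral_interior_element(1)[OF _ contF]])
    fix x assume "x \<notin> \<Union>(interior ` \<T>)"
    then show "(norm (?f x))\<^sup>2 = 0"
      using broken_gradient_off[of x] P1_zero[OF P0_P1[OF g]] by (simp add: marini_flux_def)
  qed
  also have "\<dots> = (\<Sum>T\<in>\<T>. vol T * (norm (gap_gradient g T))\<^sup>2 + (g (pt T) / DIM('a))\<^sup>2 * moment T)"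
    by (intro sum.cong refl intF)
  finally show ?thesis by (simp only: sum.distrib gap_power2[OF g])
qed

lemma flux_error_nonneg: "0 \<le> flux_error g"
  by (simp add: flux_error_def L2_norm_def L2_inner_def)

lemma moment_nonneg: "0 \<le> moment T"
  unfolding moment_def by (intro Bochner_Integration.integral_nonneg) simp

theorem kappa_M_bounds:
  fixes d :: real defines "d \<equiv> DIM('a)"
  shows "gamma_gap \<Omega> \<T> \<le> kappa_M \<Omega> \<T>"
    and "mesh_size \<T> / (d * (d + 1) * sqrt (d + 2)) \<le> kappa_M \<Omega> \<T>"
    and "kappa_M \<Omega> \<T> \<le> sqrt ((gamma_gap \<Omega> \<T>)\<^sup>2 + (mesh_size \<T>)\<^sup>2 / (2 * d * (d + 1) * (d + 2)))"
    and "0 \<le> gamma_gap \<Omega> \<T>"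
proof -
  have d: "0 < d" by (simp add: d_def)
  let ?h = "mesh_size \<T>" and ?\<gamma> = "gamma_gap \<Omega> \<T>"
  let ?C = "?h\<^sup>2 / (2 * d * (d + 1) * (d + 2))"
  obtain g0 where g0: "g0 \<in> P0 \<T> - {\<lambda>_. 0}" "?\<gamma> = gap g0 / L2_norm \<Omega> g0"
    "\<And>g. g \<in> P0 \<T> - {\<lambda>_. 0} \<Longrightarrow> gap g / L2_norm \<Omega> g \<le> ?\<gamma>"
    using gap_ratio_attains_max by metis
  have \<gamma>0: "0 \<le> ?\<gamma>" unfolding g0(2) using gap_nonneg[of g0] L2_norm_P0(2)[of g0] g0(1) by (simp add: less_imp_le)
  then show "0 \<le> gamma_gap \<Omega> \<T>" .
  have \<kappa>: "kappa_M \<Omega> \<T> = (SUP g \<in> P0 \<T> - {\<lambda>_. 0}. flux_error g / L2_norm \<Omega> g)"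
    by (simp add: kappa_M_def flux_error_def)
  have upper: "flux_error g / L2_norm \<Omega> g \<le> sqrt (?\<gamma>\<^sup>2 + ?C)" if g: "g \<in> P0 \<T> - {\<lambda>_. 0}" for g
  proof -
    have gP: "g \<in> P0 \<T>" "g \<noteq> (\<lambda>_. 0)" using g by auto
    have pos: "0 < L2_norm \<Omega> g" using L2_norm_P0(2)[OF gP] .
    have "(\<Sum>T\<in>\<T>. (g (pt T) / d)\<^sup>2 * moment T) \<le> (\<Sum>T\<in>\<T>. ?C * (vol T * (g (pt T))\<^sup>2))"
    proof (rule sum_mono)
      fix T assume T: "T \<in> \<T>"
      have "(g (pt T) / d)\<^sup>2 * moment T \<le> (g (pt T) / d)\<^sup>2 * (vol T * d * ?h\<^sup>2 / (2 * (d + 1) * (d + 2)))"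
        using moment_bounds(2)[OF T] by (intro mult_left_mono) (auto simp: d_def)
      also have "\<dots> = ?C * (vol T * (g (pt T))\<^sup>2)"
        using d by (simp add: power2_eq_square divide_simps)
      finally show "(g (pt T) / d)\<^sup>2 * moment T \<le> ?C * (vol T * (g (pt T))\<^sup>2)" .
    qed
    also have "\<dots> = ?C * (L2_norm \<Omega> g)\<^sup>2"
      unfolding L2_norm_P0(1)[OF gP(1)] by (rule sum_distrib_left[symmetric])
    finally have "(flux_error g)\<^sup>2 \<le> (gap g)\<^sup>2 + ?C * (L2_norm \<Omega> g)\<^sup>2"
      unfolding flux_error_power2[OF gP(1)] d_def by simp
    then have "(flux_error g)\<^sup>2 / (L2_norm \<Omega> g)\<^sup>2 \<le> ((gap g)\<^sup>2 + ?C * (L2_norm \<Omega> g)\<^sup>2) / (L2_norm \<Omega> g)\<^sup>2"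
      by (intro divide_right_mono) auto
    also have "\<dots> = (gap g / L2_norm \<Omega> g)\<^sup>2 + ?C"
      using pos by (simp add: power_divide add_divide_distrib)
    also have "(gap g / L2_norm \<Omega> g)\<^sup>2 \<le> ?\<gamma>\<^sup>2"
      using g0(3)[OF g] gap_nonneg[of g] pos by (intro power_mono) auto
    finally have "(flux_error g / L2_norm \<Omega> g)\<^sup>2 \<le> ?\<gamma>\<^sup>2 + ?C" by (simp add: power_divide)
    then show ?thesis by (rule real_le_rsqrt)
  qed
  \<comment> \<open>The supremum in \<open>kappa_M\<close> dominates its members only over a bounded
    set, so the upper estimate has to come before both lower ones.\<close>
  have bdd: "bdd_above ((\<lambda>g. flux_error g / L2_norm \<Omega> g) ` (P0 \<T> - {\<lambda>_. 0}))"
    using upper by (intro bdd_aboveI2)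
  show "kappa_M \<Omega> \<T> \<le> sqrt (?\<gamma>\<^sup>2 + ?C)"
    unfolding \<kappa> using g0(1) upper by (intro cSUP_least) auto
  have lower: "flux_error g / L2_norm \<Omega> g \<le> kappa_M \<Omega> \<T>" if "g \<in> P0 \<T> - {\<lambda>_. 0}" for g
    unfolding \<kappa> using that bdd by (intro cSUP_upper)
  have "?\<gamma> \<le> flux_error g0 / L2_norm \<Omega> g0"
  proof -
    have "(gap g0)\<^sup>2 \<le> (flux_error g0)\<^sup>2"
    proof -
      have "0 \<le> (\<Sum>T\<in>\<T>. (g0 (pt T) / DIM('a))\<^sup>2 * moment T)"
        by (intro sum_nonneg mult_nonneg_nonneg moment_nonneg) simp
      then show ?thesis using flux_error_power2[of g0] g0(1) by simp
    qed
    then have "gap g0 \<le> flux_error g0" using flux_error_nonneg by (rule power2_le_imp_le)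
    then show ?thesis unfolding g0(2) using L2_norm_P0(2)[of g0] g0(1) by (intro divide_right_mono) auto
  qed
  then show "?\<gamma> \<le> kappa_M \<Omega> \<T>" using lower[OF g0(1)] by linarith
  have "?h \<in> diameter ` \<T>" unfolding mesh_size_def using finite_\<T> \<T>_nonempty by (intro Max_in) auto
  then obtain T where T: "T \<in> \<T>" "diameter T = ?h" by auto
  define g where "g = (indicator (interior T) :: 'a \<Rightarrow> real)"
  have gP: "g \<in> P0 \<T>" unfolding g_def by (rule indicator_P0[OF T(1)])
  have gT: "g (pt S) = (if S = T then 1 else 0)" if "S \<in> \<T>" for S
    unfolding g_def using indicator_pt[OF T(1) that] .
  have gnz: "g \<noteq> (\<lambda>_. 0)" using gT[OF T(1)] by auto
  have "(L2_norm \<Omega> g)\<^sup>2 = (\<Sum>S\<in>\<T>. if S = T then vol S else 0)"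
    unfolding L2_norm_P0(1)[OF gP] by (intro sum.cong) (auto simp: gT)
  then have n2: "(L2_norm \<Omega> g)\<^sup>2 = vol T" using finite_\<T> T by simp
  have "(\<Sum>S\<in>\<T>. (g (pt S) / d)\<^sup>2 * moment S) = (\<Sum>S\<in>\<T>. if S = T then moment S / d\<^sup>2 else 0)"
    by (intro sum.cong) (auto simp: gT power_divide)
  also have "\<dots> = moment T / d\<^sup>2" using finite_\<T> T by simp
  finally have "moment T / d\<^sup>2 \<le> (flux_error g)\<^sup>2"
    unfolding flux_error_power2[OF gP] d_def by simp
  moreover have "vol T * ?h\<^sup>2 / ((d + 1)\<^sup>2 * (d + 2)) / d\<^sup>2 \<le> moment T / d\<^sup>2"
    using moment_bounds(1)[OF T(1)] unfolding T(2) d_def by (intro divide_right_mono) auto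
  \<comment> \<open>Division by \<open>vol T\<close>, the squared norm of the indicator
    \<open>g\<close>, removes the size of the element and leaves only its diameter.\<close>
  ultimately have "vol T * ?h\<^sup>2 / ((d + 1)\<^sup>2 * (d + 2)) / d\<^sup>2 / vol T \<le> (flux_error g)\<^sup>2 / vol T"
    using vol_pos[OF T(1)] by (intro divide_right_mono) auto
  moreover have "vol T * ?h\<^sup>2 / ((d + 1)\<^sup>2 * (d + 2)) / d\<^sup>2 / vol T = (?h / (d * (d + 1) * sqrt (d + 2)))\<^sup>2"
    using vol_pos[OF T(1)] d by (simp add: power_divide power_mult_distrib mult_ac)
  moreover have "(flux_error g)\<^sup>2 / vol T = (flux_error g / L2_norm \<Omega> g)\<^sup>2"
    by (simp only: power_divide n2)
  ultimately have "(?h / (d * (d + 1) * sqrt (d + 2)))\<^sup>2 \<le> (flux_error g / L2_norm \<Omega> g)\<^sup>2"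
    by (simp only:)
  moreover have "0 \<le> flux_error g / L2_norm \<Omega> g"
    using flux_error_nonneg[of g] L2_norm_P0(2)[OF gP gnz] by simp
  ultimately have "?h / (d * (d + 1) * sqrt (d + 2)) \<le> flux_error g / L2_norm \<Omega> g"
    by (rule power2_le_imp_le)
  then show "?h / (d * (d + 1) * sqrt (d + 2)) \<le> kappa_M \<Omega> \<T>"
    using lower[of g] gP gnz by auto
qed

text \<open>Zero diameter would make an element a single point. Strict positivity is what finally
  contradicts smallness relative to the mesh size.\<close>

lemma mesh_size_pos: "0 < mesh_size \<T>"
proof (rule ccontr)
  obtain T where T: "T \<in> \<T>" using \<T>_nonempty by blast
  assume "\<not> 0 < mesh_size \<T>"
  then have "diameter T \<le> 0" using diameter_le_mesh_size[OF T] by linarith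
  then have "dist x y \<le> 0" if "x \<in> T" "y \<in> T" for x y
    using diameter_bounded_bound[OF compact_imp_bounded[OF compact_element[OF T]] that] by linarith
  moreover have "pt T \<in> T" using pt[OF T] interior_subset[of T] by (rule subsetD[rotated])
  ultimately have "T \<subseteq> {pt T}" by (simp add: subset_iff)
  then have "aff_dim T \<le> 0" using aff_dim_subset[of T "{pt T}"] by simp
  then show False using aff_dim_element[OF T] by simp
qed

end

text \<open>Let \<open>h\<close> be the height above the boundary graph: locally \<Omega> is the set
  where \<open>h\<close> is positive, and its closure lies where \<open>h\<close> is nonnegative. A
  point in the interior of the closure but outside \<Omega> has \<open>h\<close> at most 0; moving
  it slightly along \<open>- e\<close> stays in the closure but makes \<open>h\<close>
  negative.\<close>

lemma lipschitz_interior_closure: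
  fixes \<Omega> :: "'a::euclidean_space set"
  assumes op: "open \<Omega>" and lip: "lipschitz_boundary \<Omega>"
  shows "interior (closure \<Omega>) = \<Omega>"
proof
  show "\<Omega> \<subseteq> interior (closure \<Omega>)" using op closure_subset interior_maximal by metis
  show "interior (closure \<Omega>) \<subseteq> \<Omega>"
  proof (rule ccontr)
    assume "\<not> interior (closure \<Omega>) \<subseteq> \<Omega>"
    then obtain p where p: "p \<in> interior (closure \<Omega>)" "p \<notin> \<Omega>" by blast
    have "p \<in> frontier \<Omega>"
      using p interior_subset[of "closure \<Omega>"] op by (auto simp: frontier_def interior_open)
    then obtain U e \<psi> L where U: "open U" "p \<in> U" and e: "norm e = 1"
      and \<psi>: "lipschitz_on L {y. y \<bullet> e = 0} \<psi>"
      and eq: "\<Omega> \<inter> U = {y \<in> U. \<psi> (y - (y \<bullet> e) *\<^sub>R e) < y \<bullet> e}"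
      using lip unfolding lipschitz_boundary_def by meson
    have ee: "e \<bullet> e = 1" using e by (simp add: dot_square_norm)
    define h where "h y = y \<bullet> e - \<psi> (y - (y \<bullet> e) *\<^sub>R e)" for y
    have conth: "continuous_on UNIV h"
      unfolding h_def
      by (intro continuous_intros continuous_on_compose2[OF lipschitz_on_continuous_on[OF \<psi>]])
        (auto simp: inner_diff_left ee)
    have h\<Omega>: "0 \<le> h y" if y: "y \<in> U" "y \<in> closure \<Omega>" for y
    proof (rule ccontr)
      assume "\<not> 0 \<le> h y"
      define W where "W = U \<inter> {y. h y < 0}"
      have "open W" unfolding W_def using U(1) conth by (intro open_Int open_Collect_less continuous_on_const)
      moreover have "y \<in> W" using y \<open>\<not> 0 \<le> h y\<close> by (simp add: W_def)
      ultimately obtain z where "z \<in> \<Omega>" "z \<in> W" using y(2) by (auto simp: closure_iff_nhds_not_empty)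
      then have "z \<in> \<Omega> \<inter> U" by (simp add: W_def)
      then have "0 < h z" unfolding eq by (simp add: h_def)
      then show False using \<open>z \<in> W\<close> by (simp add: W_def)
    qed
    have "p \<notin> \<Omega> \<inter> U" using p(2) by blast
    then have "h p \<le> 0" unfolding eq using U(2) by (simp add: h_def not_less)
    define q where "q t = p - t *\<^sub>R e" for t :: real
    have hq: "h (q t) = h p - t" for t
      by (simp add: h_def q_def inner_diff_left ee algebra_simps)
    have "open (U \<inter> interior (closure \<Omega>))" "p \<in> U \<inter> interior (closure \<Omega>)" using U p by auto
    then obtain t where "0 < t" "p + t *\<^sub>R (- e) \<in> U \<inter> interior (closure \<Omega>)"
      by (rule line_meets_open)
    then have t: "q t \<in> U" "q t \<in> interior (closure \<Omega>)" "0 < t" by (auto simp: q_def)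
    then have "0 \<le> h (q t)" using h\<Omega> interior_subset by blast
    then show False using hq[of t] \<open>h p \<le> 0\<close> t(3) by simp
  qed
qed

section \<open>The result for polyhedral Lipschitz domains\<close>

lemma mesh_if_conforming:
  assumes "polyhedral_lipschitz_domain \<Omega>" "conforming_triangulation \<Omega> \<T>" shows "mesh \<Omega> \<T>"
  using assms lipschitz_interior_closure by (auto simp: polyhedral_lipschitz_domain_def mesh_def)

theorem corollary6p3:
  fixes \<Omega> :: "(real ^ 'd::finite) set"
    and d :: real
  assumes "d = real CARD('d)" and "CARD('d) \<in> {2, 3}"
    and "polyhedral_lipschitz_domain \<Omega>"
  shows "(\<forall>\<T>. conforming_triangulation \<Omega> \<T> \<longrightarrow>
            max (gamma_gap \<Omega> \<T>) (mesh_size \<T> / (d * (d + 1) * sqrt (d + 2))) \<le> kappa_M \<Omega> \<T> \<and>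
            kappa_M \<Omega> \<T> \<le>
              sqrt ((gamma_gap \<Omega> \<T>)\<^sup>2 + (mesh_size \<T>)\<^sup>2 / (2 * d * (d + 1) * (d + 2)))) \<and>
         (\<forall>(\<T> :: 'i \<Rightarrow> (real ^ 'd) set set) (\<F> :: 'i filter).
            \<F> \<noteq> bot \<and> (\<forall>i. conforming_triangulation \<Omega> (\<T> i)) \<and>
            ((\<lambda>i. mesh_size (\<T> i)) \<longlongrightarrow> 0) \<F> \<longrightarrow>
              ((\<lambda>i. kappa_M \<Omega> (\<T> i)) \<in> O[\<F>](\<lambda>i. mesh_size (\<T> i)) \<longleftrightarrow>
               (\<lambda>i. gamma_gap \<Omega> (\<T> i)) \<in> O[\<F>](\<lambda>i. mesh_size (\<T> i))) \<and>
              (\<lambda>i. kappa_M \<Omega> (\<T> i)) \<notin> o[\<F>](\<lambda>i. mesh_size (\<T> i)))"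
proof -
  have d: "d = real DIM(real ^ 'd)" "0 < d" using assms(1) by simp_all
  have bounds: "gamma_gap \<Omega> \<T> \<le> kappa_M \<Omega> \<T>"
    "mesh_size \<T> / (d * (d + 1) * sqrt (d + 2)) \<le> kappa_M \<Omega> \<T>"
    "kappa_M \<Omega> \<T> \<le> sqrt ((gamma_gap \<Omega> \<T>)\<^sup>2 + (mesh_size \<T>)\<^sup>2 / (2 * d * (d + 1) * (d + 2)))"
    "0 \<le> gamma_gap \<Omega> \<T>" "0 < mesh_size \<T>"
    if T: "conforming_triangulation \<Omega> \<T>" for \<T>
    using mesh.kappa_M_bounds[OF mesh_if_conforming[OF assms(3) T]] mesh.mesh_size_pos[OF mesh_if_conforming[OF assms(3) T]]
    unfolding d(1) by auto
  have asymp: "((\<lambda>i. kappa_M \<Omega> (\<T> i)) \<in> O[\<F>](\<lambda>i. mesh_size (\<T> i)) \<longleftrightarrow>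
      (\<lambda>i. gamma_gap \<Omega> (\<T> i)) \<in> O[\<F>](\<lambda>i. mesh_size (\<T> i))) \<and>
      (\<lambda>i. kappa_M \<Omega> (\<T> i)) \<notin> o[\<F>](\<lambda>i. mesh_size (\<T> i))"
    if F: "\<F> \<noteq> bot" and T: "\<And>i. conforming_triangulation \<Omega> (\<T> i)"
    for \<T> :: "'i \<Rightarrow> (real ^ 'd) set set" and \<F> :: "'i filter"
  proof (intro conjI iffI notI)
    let ?\<kappa> = "\<lambda>i. kappa_M \<Omega> (\<T> i)" and ?\<gamma> = "\<lambda>i. gamma_gap \<Omega> (\<T> i)" and ?h = "\<lambda>i. mesh_size (\<T> i)"
    note b = bounds[OF T]
    {
      assume "?\<kappa> \<in> O[\<F>](?h)"
      moreover have "?\<gamma> \<in> O[\<F>](?\<kappa>)"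
      proof (intro landau_o.big_mono always_eventually allI)
        show "norm (?\<gamma> i) \<le> norm (?\<kappa> i)" for i using b(1,4)[of i] by simp
      qed
      ultimately show "?\<gamma> \<in> O[\<F>](?h)" using landau_o.big_trans by blast
    next
      assume \<gamma>: "?\<gamma> \<in> O[\<F>](?h)"
      \<comment> \<open>The factor of the mesh size once the upper bound is linearised by
        \<open>sqrt (a^2 + b^2) \<le> a + b\<close> for nonnegative \<open>a\<close> and
        \<open>b\<close>.\<close>
      define C where "C = sqrt (1 / (2 * d * (d + 1) * (d + 2)))"
      have "?\<kappa> \<in> O[\<F>](\<lambda>i. ?\<gamma> i + C * ?h i)"
      proof (intro landau_o.big_mono always_eventually allI)
        fix i
        have C: "0 \<le> C" using d(2) by (simp add: C_def)
        have "?\<kappa> i \<le> sqrt ((?\<gamma> i)\<^sup>2 + (C * ?h i)\<^sup>2)"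
          using b(3)[of i] d(2) by (simp add: C_def power_mult_distrib)
        also have "\<dots> \<le> ?\<gamma> i + C * ?h i"
          using b(4,5)[of i] C by (intro sqrt_sum_squares_le_sum) auto
        finally show "norm (?\<kappa> i) \<le> norm (?\<gamma> i + C * ?h i)" using b(1,4)[of i] by simp
      qed
      also have "(\<lambda>i. ?\<gamma> i + C * ?h i) \<in> O[\<F>](?h)"
      proof (intro sum_in_bigo \<gamma>)
        have "C \<noteq> 0" using d(2) by (simp add: C_def)
        then show "(\<lambda>i. C * ?h i) \<in> O[\<F>](?h)" by simp
      qed
      finally show "?\<kappa> \<in> O[\<F>](?h)" .
    next
      assume "?\<kappa> \<in> o[\<F>](?h)"
      \<comment> \<open>\<open>kappa_M\<close> is at least \<open>c\<close> times the positive mesh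
        size, so the constant \<open>c / 2\<close> refutes smallness at every index; since the
        filter is not \<open>bot\<close>, this is a contradiction.\<close>
      define c where "c = 1 / (d * (d + 1) * sqrt (d + 2))"
      have c: "0 < c" using d(2) by (simp add: c_def)
      have "\<forall>\<^sub>F i in \<F>. norm (?\<kappa> i) \<le> c / 2 * norm (?h i)"
        using \<open>?\<kappa> \<in> o[\<F>](?h)\<close> c by (intro landau_o.smallD) auto
      moreover have "\<not> norm (?\<kappa> i) \<le> c / 2 * norm (?h i)" for i
      proof -
        have "c * ?h i \<le> ?\<kappa> i" using b(2)[of i] by (simp add: c_def)
        moreover have "0 < c * ?h i" using c b(5)[of i] by simp
        ultimately show ?thesis using b(5)[of i] by simp
      qed
      ultimately show False using F by (simp add: eventually_False)
    }
  qed
  show ?thesis using bounds asymp by (auto simp: max_def)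
qed

end
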